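(* Let $W$ be a vector space over $\mathbb{C}$, let $\Gamma$ be a subgroup of $\mathbb{C}^\times$, and let $U$ be a $\mathcal{Y}_\Gamma$-closed quasi local subspace of $\mathcal{E}(W)$ containing $1_W$. Then for every $\alpha\in\Gamma$ and $a(x)\in U$, $$\mathcal{Y}_\alpha(1_W,x_0)a(x)=a(x),\qquad \mathcal{Y}_\alpha(a(x),x_0)1_W=e^{\alpha^{-1}x_0D}R_\alpha a(x),$$ and for any $a(x),b(x)\in U$ and $\alpha,\beta\in\Gamma$ the following identity (of operators on $U$) holds: $$x_0^{-1}\delta\left(\frac{x_1-\alpha\beta^{-1}x_2}{x_0}\right)\mathcal{Y}_\alpha(a(x),x_1)\mathcal{Y}_\beta(b(x),x_2)-x_0^{-1}\delta\left(\frac{-\alpha\beta^{-1}x_2+x_1}{x_0}\right)\mathcal{Y}_\beta(b(x),x_2)\mathcal{Y}_\alpha(a(x),x_1)$$ $$=x_1^{-1}\delta\left(\frac{\alpha\beta^{-1}x_2+x_0}{x_1}\right)\mathcal{Y}_\beta\bigl(\mathcal{Y}_{\alpha\beta^{-1}}(a(x),x_0)b(x),x_2\bigr).$$ In particular, $(U,\mathcal{Y}_1,1_W)$ carries the structure of a vertex algebra. Furthermore, for any quasi local subset $S$ of $\mathcal{E}(W)$, $(\langle S\rangle_\Gamma,\mathcal{Y}_1,1_W)$ carries the structure of a vertex algebra, where $\langle S\rangle_\Gamma$ is the smallest $\mathcal{Y}_\Gamma$-closed quasi local subspace of $\mathcal{E}(W)$ containing $S$ and $1_W$.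
   Context: All vector spaces are over $\mathbb{C}$; $x,x_0,x_1,x_2$ are commuting formal variables; $U((x))$ is the space of lower truncated Laurent series, $U((x_1))((x_2))=(U((x_1)))((x_2))$, $U((x_1,x_2))=U[[x_1,x_2]][x_1^{-1},x_2^{-1}]$. $\delta(z)=\sum_{n\in\mathbb{Z}}z^n$; integer powers of a binomial such as $x_1-\alpha x_2$ or $-\alpha x_2+x_1$ are expanded in nonnegative powers of the second-written term. For a vector space $W$, $\mathcal{E}(W)=\operatorname{Hom}(W,W((x)))$, $1_W\in\mathcal{E}(W)$ is the identity operator viewed as a constant series, $D=\frac{d}{dx}$, and $R_\alpha a(x)=a(\alpha x)$ for $\alpha\in\mathbb{C}^\times$. Compatibility: an ordered pair $(a(x),b(x))$ in $\mathcal{E}(W)$ is compatible if there is a nonzero polynomial $f(x_1,x_2)\in\mathbb{C}[x_1,x_2]$ with $f(x_1,x_2)a(x_1)b(x_2)\in \operatorname{Hom}(W,W((x_1,x_2)))$. A subspace is pairwise compatible if every ordered pair in it is compatible. Partial operations: for a compatible pair $(a(x),b(x))$, such an $f$, and $\alpha\in\mathbb{C}^\times$, define $a(x)_{(\alpha,n)}b(x)$ ($n\in\mathbb{Z}$) by $$\mathcal{Y}_\alpha(a(x),x_0)b(x)=\sum_{n\in\mathbb{Z}}\bigl(a(x)_{(\alpha,n)}b(x)\bigr)x_0^{-n-1}=\iota_{x,x_0}\bigl(f(x_0+\alpha x,x)^{-1}\bigr)\,\bigl(f(x_1,x)a(x_1)b(x)\bigr)\big|_{x_1=\alpha x+x_0},$$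 where $\iota_{x,x_0}(f(x_0+\alpha x,x)^{-1})$ is the inverse of the nonzero polynomial $f(x_0+\alpha x,x)$ in the field $\mathbb{C}((x))((x_0))$ and in the substitution powers of $\alpha x+x_0$ are expanded in nonnegative powers of $x_0$. This is independent of the choice of $f$, and $a(x)_{(\alpha,n)}b(x)\in\mathcal{E}(W)$. Quasi locality: $a(x),b(x)\in\mathcal{E}(W)$ are mutually quasi local if there is a nonzero polynomial $f(x_1,x_2)$ with $f(x_1,x_2)a(x_1)b(x_2)=f(x_1,x_2)b(x_2)a(x_1)$. A subset (subspace) of $\mathcal{E}(W)$ is quasi local if any two of its elements (possibly equal) are mutually quasi local. Any quasi local subspace is pairwise compatible. For a subgroup $\Gamma$ of $\mathbb{C}^\times$, a pairwise compatible subspace $U$ of $\mathcal{E}(W)$ is $\mathcal{Y}_\Gamma$-closed if $a(x)_{(\alpha,n)}b(x)\in U$ for all $a(x),b(x)\in U$, $\alpha\in\Gamma$, $n\in\mathbb{Z}$. For every quasi local subset $S$ the smallest $\mathcal{Y}_\Gamma$-closed quasi local subspace $\langle S\rangle_\Gamma$ containing $S$ and $1_W$ exists. A vertex algebra is a triple $(V,Y,\mathbf 1)$ with $Y:V\to\operatorname{Hom}(V,V((x)))$ linear satisfying $Y(\mathbf 1,x)=1$, $Y(v,x)\mathbf 1\in V[[x]]$ with $\lim_{x\to0}Y(v,x)\mathbf 1=v$, and the Jacobi identity $x_0^{-1}\delta(\frac{x_1-x_2}{x_0})Y(u,x_1)Y(v,x_2)-x_0^{-1}\delta(\frac{x_2-x_1}{-x_0})Y(v,x_2)Y(u,x_1)=x_2^{-1}\delta(\frac{x_1-x_0}{x_2})Y(Y(u,x_0)v,x_2)$.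 *)

theory Defs
  imports
    Complex_Main
    "HOL.Hull"
    "HOL-Library.Function_Algebras"
    "HOL-Library.Groups_Big_Fun"
    "HOL-Computational_Algebra.Polynomial_FPS"
    "HOL-Computational_Algebra.Formal_Laurent_Series"
begin

text \<open>
  A formal series in one variable, infinite in both directions, with coefficients of type
  \<open>'v\<close> is a function \<open>int \<Rightarrow> 'v\<close>, whose value at \<open>n\<close> is the coefficient of \<open>x\<close> to the power
  \<open>n\<close>; series in several variables are curried.  The vector space structure is pointwise
  (addition is the one of \<^theory>\<open>HOL-Library.Function_Algebras\<close>).  Coefficients of products
  and substitutions are written with \<^const>\<open>Sum_any\<close>, the sum of a finitely supported family
  (it is 0 if the support is infinite).
\<close>

section \<open>The space of fields on W\<close>

definition lower_truncated :: "(int \<Rightarrow> 'v::zero) \<Rightarrow> bool"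
  where "lower_truncated g \<longleftrightarrow> (\<exists>N. \<forall>n<N. g n = 0)"

definition op_scale :: "(complex \<Rightarrow> 'w \<Rightarrow> 'w) \<Rightarrow> complex \<Rightarrow> ('w \<Rightarrow> 'w) \<Rightarrow> 'w \<Rightarrow> 'w"
  where "op_scale s c T = (\<lambda>w. s c (T w))"

definition field_scale ::
    "(complex \<Rightarrow> 'w \<Rightarrow> 'w) \<Rightarrow> complex \<Rightarrow> (int \<Rightarrow> 'w \<Rightarrow> 'w) \<Rightarrow> int \<Rightarrow> 'w \<Rightarrow> 'w"
  where "field_scale s c a = (\<lambda>n. op_scale s c (a n))"

text \<open>\<open>Hom(W, W((x)))\<close>; \<open>a n w\<close> is the coefficient of the \<open>n\<close>-th power of \<open>x\<close> in \<open>a(x)w\<close>.\<close>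
definition fields :: "(complex \<Rightarrow> 'w::ab_group_add \<Rightarrow> 'w) \<Rightarrow> (int \<Rightarrow> 'w \<Rightarrow> 'w) set"
  where "fields s = {a. (\<forall>n. Vector_Spaces.linear s s (a n)) \<and> (\<forall>w. lower_truncated (\<lambda>n. a n w))}"

definition id_field :: "int \<Rightarrow> 'w::zero \<Rightarrow> 'w"
  where "id_field = (\<lambda>n w. if n = 0 then w else 0)"

definition deriv_field ::
    "(complex \<Rightarrow> 'w \<Rightarrow> 'w) \<Rightarrow> (int \<Rightarrow> 'w \<Rightarrow> 'w) \<Rightarrow> int \<Rightarrow> 'w \<Rightarrow> 'w"
  where "deriv_field s a = (\<lambda>n. op_scale s (of_int (n + 1)) (a (n + 1)))"

definition rescale_field ::
    "(complex \<Rightarrow> 'w \<Rightarrow> 'w) \<Rightarrow> complex \<Rightarrow> (int \<Rightarrow> 'w \<Rightarrow> 'w) \<Rightarrow> int \<Rightarrow> 'w \<Rightarrow> 'w"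
  where "rescale_field s \<alpha> a = (\<lambda>n. op_scale s (\<alpha> powi n) (a n))"

text \<open>\<open>exp(c x\<^sub>0 D) a(x)\<close>, as a series in \<open>x\<^sub>0\<close> with coefficients in the space of fields.\<close>
definition exp_deriv_field ::
    "(complex \<Rightarrow> 'w \<Rightarrow> 'w) \<Rightarrow> complex \<Rightarrow> (int \<Rightarrow> 'w \<Rightarrow> 'w) \<Rightarrow> int \<Rightarrow> (int \<Rightarrow> 'w::zero \<Rightarrow> 'w)"
  where "exp_deriv_field s c a = (\<lambda>k. if k < 0 then (\<lambda>n w. 0)
           else field_scale s (c ^ nat k / fact (nat k)) ((deriv_field s ^^ nat k) a))"

section \<open>Compatibility and quasi locality\<close>

text \<open>
  A polynomial \<open>f(x\<^sub>1,x\<^sub>2)\<close> is an element of \<^typ>\<open>complex poly poly\<close> whose outer variable is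
  \<open>x\<^sub>1\<close> and whose inner variable is \<open>x\<^sub>2\<close>.
\<close>
definition poly2_mult ::
    "(complex \<Rightarrow> 'v \<Rightarrow> 'v) \<Rightarrow> complex poly poly \<Rightarrow> (int \<Rightarrow> int \<Rightarrow> 'v) \<Rightarrow> int \<Rightarrow> int \<Rightarrow> 'v::comm_monoid_add"
  where "poly2_mult s f g = (\<lambda>m n. \<Sum>i\<le>degree f. \<Sum>j\<le>degree (coeff f i).
           s (coeff (coeff f i) j) (g (m - int i) (n - int j)))"

text \<open>\<open>f(x\<^sub>1,x\<^sub>2)a(x\<^sub>1)b(x\<^sub>2)\<close>; the first index belongs to \<open>x\<^sub>1\<close>.\<close>
definition poly2_mult_fields ::
    "(complex \<Rightarrow> 'w \<Rightarrow> 'w) \<Rightarrow> complex poly poly \<Rightarrow> (int \<Rightarrow> 'w \<Rightarrow> 'w) \<Rightarrow> (int \<Rightarrow> 'w \<Rightarrow> 'w)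
      \<Rightarrow> int \<Rightarrow> int \<Rightarrow> 'w \<Rightarrow> 'w::comm_monoid_add"
  where "poly2_mult_fields s f a b = poly2_mult (op_scale s) f (\<lambda>m n. a m \<circ> b n)"

text \<open>Membership in \<open>W((x\<^sub>1,x\<^sub>2))\<close>.\<close>
definition lower_truncated2 :: "(int \<Rightarrow> int \<Rightarrow> 'v::zero) \<Rightarrow> bool"
  where "lower_truncated2 g \<longleftrightarrow> (\<exists>N. \<forall>m n. m < N \<or> n < N \<longrightarrow> g m n = 0)"

definition compatible_poly ::
    "(complex \<Rightarrow> 'w \<Rightarrow> 'w) \<Rightarrow> (int \<Rightarrow> 'w \<Rightarrow> 'w) \<Rightarrow> (int \<Rightarrow> 'w \<Rightarrow> 'w::comm_monoid_add)
      \<Rightarrow> complex poly poly \<Rightarrow> bool"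
  where "compatible_poly s a b f \<longleftrightarrow>
           f \<noteq> 0 \<and> (\<forall>w. lower_truncated2 (\<lambda>m n. poly2_mult_fields s f a b m n w))"

definition compatible ::
    "(complex \<Rightarrow> 'w \<Rightarrow> 'w) \<Rightarrow> (int \<Rightarrow> 'w \<Rightarrow> 'w) \<Rightarrow> (int \<Rightarrow> 'w \<Rightarrow> 'w::comm_monoid_add) \<Rightarrow> bool"
  where "compatible s a b \<longleftrightarrow> (\<exists>f. compatible_poly s a b f)"

definition mutually_quasi_local ::
    "(complex \<Rightarrow> 'w \<Rightarrow> 'w) \<Rightarrow> (int \<Rightarrow> 'w \<Rightarrow> 'w) \<Rightarrow> (int \<Rightarrow> 'w \<Rightarrow> 'w::comm_monoid_add) \<Rightarrow> bool"
  where "mutually_quasi_local s a b \<longleftrightarrow> (\<exists>f. f \<noteq> 0 \<and>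
           poly2_mult (op_scale s) f (\<lambda>m n. a m \<circ> b n) = poly2_mult (op_scale s) f (\<lambda>m n. b n \<circ> a m))"

definition quasi_local ::
    "(complex \<Rightarrow> 'w \<Rightarrow> 'w) \<Rightarrow> (int \<Rightarrow> 'w \<Rightarrow> 'w::ab_group_add) set \<Rightarrow> bool"
  where "quasi_local s S \<longleftrightarrow> S \<subseteq> fields s \<and> (\<forall>a\<in>S. \<forall>b\<in>S. mutually_quasi_local s a b)"

section \<open>The partial operations\<close>

text \<open>
  \<open>C((x))((x\<^sub>0))\<close> is \<^typ>\<open>complex fls fls\<close>: the outer variable is \<open>x\<^sub>0\<close> and the inner variable
  is \<open>x\<close>.  The following is \<open>f(x\<^sub>0 + \<alpha> x, x)\<close>.
\<close>
definition poly2_shift :: "complex \<Rightarrow> complex poly poly \<Rightarrow> complex fls fls"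
  where "poly2_shift \<alpha> f =
           poly (map_poly (\<lambda>p. fls_const (fps_to_fls (fps_of_poly p))) f)
             (fls_X + fls_const (fls_const \<alpha> * fls_X))"

text \<open>
  \<open>g(\<alpha> x + x\<^sub>0, x)\<close> for \<open>g \<in> W((x\<^sub>1,x))\<close>; the first index of the result belongs to \<open>x\<^sub>0\<close>,
  the second to \<open>x\<close>.
\<close>
definition subst_shift ::
    "(complex \<Rightarrow> 'w \<Rightarrow> 'w) \<Rightarrow> complex \<Rightarrow> (int \<Rightarrow> int \<Rightarrow> 'w) \<Rightarrow> int \<Rightarrow> int \<Rightarrow> 'w::comm_monoid_add"
  where "subst_shift s \<alpha> g = (\<lambda>k l. if k < 0 then 0
           else Sum_any (\<lambda>m. s ((of_int m gchoose nat k) * \<alpha> powi (m - k)) (g m (l - m + k))))"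

definition fls2_mult ::
    "(complex \<Rightarrow> 'w \<Rightarrow> 'w) \<Rightarrow> complex fls fls \<Rightarrow> (int \<Rightarrow> int \<Rightarrow> 'w) \<Rightarrow> int \<Rightarrow> int \<Rightarrow> 'w::comm_monoid_add"
  where "fls2_mult s H g =
           (\<lambda>k l. Sum_any (\<lambda>(i, j). s (fls_nth (fls_nth H i) j) (g (k - i) (l - j))))"

text \<open>
  \<open>Y_op s \<alpha> a k b\<close> is the coefficient of the \<open>k\<close>-th power of \<open>x\<^sub>0\<close> in
  \<open>Y\<^sub>\<alpha>(a(x),x\<^sub>0)b(x)\<close>.  It is meaningful for compatible pairs only, and then does not depend on
  the choice of the polynomial.
\<close>
definition Y_op ::
    "(complex \<Rightarrow> 'w \<Rightarrow> 'w) \<Rightarrow> complex \<Rightarrow> (int \<Rightarrow> 'w \<Rightarrow> 'w) \<Rightarrow> int \<Rightarrow> (int \<Rightarrow> 'w \<Rightarrow> 'w)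
      \<Rightarrow> (int \<Rightarrow> 'w \<Rightarrow> 'w::comm_monoid_add)"
  where "Y_op s \<alpha> a k b = (let f = SOME f. compatible_poly s a b f in
           (\<lambda>l w. fls2_mult s (inverse (poly2_shift \<alpha> f))
              (subst_shift s \<alpha> (\<lambda>m n. poly2_mult_fields s f a b m n w)) k l))"

definition nth_prod ::
    "(complex \<Rightarrow> 'w \<Rightarrow> 'w) \<Rightarrow> complex \<Rightarrow> int \<Rightarrow> (int \<Rightarrow> 'w \<Rightarrow> 'w) \<Rightarrow> (int \<Rightarrow> 'w \<Rightarrow> 'w)
      \<Rightarrow> (int \<Rightarrow> 'w \<Rightarrow> 'w::comm_monoid_add)"
  where "nth_prod s \<alpha> n a b = Y_op s \<alpha> a (- n - 1) b"

definition mult_subgroup :: "complex set \<Rightarrow> bool"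
  where "mult_subgroup \<Gamma> \<longleftrightarrow>
           0 \<notin> \<Gamma> \<and> 1 \<in> \<Gamma> \<and> (\<forall>\<alpha>\<in>\<Gamma>. \<forall>\<beta>\<in>\<Gamma>. \<alpha> * \<beta> \<in> \<Gamma>) \<and> (\<forall>\<alpha>\<in>\<Gamma>. inverse \<alpha> \<in> \<Gamma>)"

definition fields_subspace ::
    "(complex \<Rightarrow> 'w \<Rightarrow> 'w) \<Rightarrow> (int \<Rightarrow> 'w \<Rightarrow> 'w::ab_group_add) set \<Rightarrow> bool"
  where "fields_subspace s U \<longleftrightarrow> U \<subseteq> fields s \<and> module.subspace (field_scale s) U"

definition Y_closed ::
    "(complex \<Rightarrow> 'w \<Rightarrow> 'w) \<Rightarrow> complex set \<Rightarrow> (int \<Rightarrow> 'w \<Rightarrow> 'w::ab_group_add) set \<Rightarrow> bool"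
  where "Y_closed s \<Gamma> U \<longleftrightarrow> fields_subspace s U
           \<and> (\<forall>a\<in>U. \<forall>b\<in>U. compatible s a b)
           \<and> (\<forall>a\<in>U. \<forall>b\<in>U. \<forall>\<alpha>\<in>\<Gamma>. \<forall>n. nth_prod s \<alpha> n a b \<in> U)"

definition generated ::
    "(complex \<Rightarrow> 'w \<Rightarrow> 'w) \<Rightarrow> complex set \<Rightarrow> (int \<Rightarrow> 'w \<Rightarrow> 'w::ab_group_add) set
      \<Rightarrow> (int \<Rightarrow> 'w \<Rightarrow> 'w) set"
  where "generated s \<Gamma> S = (\<lambda>U. Y_closed s \<Gamma> U \<and> quasi_local s U \<and> id_field \<in> U) hull S"

section \<open>Delta functions and Jacobi identities\<close>

text \<open>
  Coefficient of \<open>y\<^sup>p z\<^sup>q\<close> in the \<open>n\<close>-th power of \<open>c y + d z\<close>, expanded in nonnegative powers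
  of \<open>z\<close>.
\<close>
definition binom_coeff :: "complex \<Rightarrow> complex \<Rightarrow> int \<Rightarrow> int \<Rightarrow> int \<Rightarrow> complex"
  where "binom_coeff c d n p q =
           (if 0 \<le> q \<and> p + q = n then (of_int n gchoose nat q) * c powi p * d ^ nat q else 0)"

text \<open>
  Coefficient of \<open>t\<^sup>r y\<^sup>p z\<^sup>q\<close> in \<open>1/t\<close> times the delta function of \<open>(c y + d z)/(e t)\<close>: only
  the \<open>(- r - 1)\<close>-th power of the argument contributes.
\<close>
definition delta_coeff ::
    "complex \<Rightarrow> complex \<Rightarrow> complex \<Rightarrow> int \<Rightarrow> int \<Rightarrow> int \<Rightarrow> complex"
  where "delta_coeff c d e r p q = e powi (r + 1) * binom_coeff c d (- r - 1) p q"

text \<open>Products of a scalar and a vector valued series in \<open>x\<^sub>0, x\<^sub>1, x\<^sub>2\<close> (in this order).\<close>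
definition series3_mult ::
    "(complex \<Rightarrow> 'v \<Rightarrow> 'v) \<Rightarrow> (int \<Rightarrow> int \<Rightarrow> int \<Rightarrow> complex) \<Rightarrow> (int \<Rightarrow> int \<Rightarrow> int \<Rightarrow> 'v)
      \<Rightarrow> int \<Rightarrow> int \<Rightarrow> int \<Rightarrow> 'v::comm_monoid_add"
  where "series3_mult s F g =
           (\<lambda>i j k. Sum_any (\<lambda>(p, q, r). s (F p q r) (g (i - p) (j - q) (k - r))))"

definition series3_mult_exists ::
    "(complex \<Rightarrow> 'v \<Rightarrow> 'v) \<Rightarrow> (int \<Rightarrow> int \<Rightarrow> int \<Rightarrow> complex) \<Rightarrow> (int \<Rightarrow> int \<Rightarrow> int \<Rightarrow> 'v::zero) \<Rightarrow> bool"
  where "series3_mult_exists s F g \<longleftrightarrow>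
           (\<forall>i j k. finite {(p, q, r). s (F p q r) (g (i - p) (j - q) (k - r)) \<noteq> 0})"

text \<open>\<open>A(x\<^sub>1)B(x\<^sub>2)c\<close>, \<open>B(x\<^sub>2)A(x\<^sub>1)c\<close> and \<open>Y(Y'(a,x\<^sub>0)b,x\<^sub>2)c\<close> as series in \<open>x\<^sub>0, x\<^sub>1, x\<^sub>2\<close>.\<close>
definition series_12 ::
    "(int \<Rightarrow> 'v \<Rightarrow> 'v) \<Rightarrow> (int \<Rightarrow> 'v \<Rightarrow> 'v) \<Rightarrow> 'v \<Rightarrow> int \<Rightarrow> int \<Rightarrow> int \<Rightarrow> 'v::zero"
  where "series_12 A B c = (\<lambda>i j k. if i = 0 then A j (B k c) else 0)"

definition series_21 ::
    "(int \<Rightarrow> 'v \<Rightarrow> 'v) \<Rightarrow> (int \<Rightarrow> 'v \<Rightarrow> 'v) \<Rightarrow> 'v \<Rightarrow> int \<Rightarrow> int \<Rightarrow> int \<Rightarrow> 'v::zero"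
  where "series_21 A B c = (\<lambda>i j k. if i = 0 then B k (A j c) else 0)"

definition series_iterate ::
    "('v \<Rightarrow> int \<Rightarrow> 'v \<Rightarrow> 'v) \<Rightarrow> ('v \<Rightarrow> int \<Rightarrow> 'v \<Rightarrow> 'v) \<Rightarrow> 'v \<Rightarrow> 'v \<Rightarrow> 'v
      \<Rightarrow> int \<Rightarrow> int \<Rightarrow> int \<Rightarrow> 'v::zero"
  where "series_iterate Y Y' a b c = (\<lambda>i j k. if j = 0 then Y (Y' a i b) k c else 0)"

text \<open>
  Vertex algebras on a subspace \<open>V\<close> of an ambient vector space; \<open>Y u n\<close> is the coefficient of
  the \<open>n\<close>-th power of \<open>x\<close> in \<open>Y(u,x)\<close>.  By truncation, all products in the Jacobi identity
  exist.
\<close>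
locale vertex_algebra = vector_space scale
  for scale :: "complex \<Rightarrow> 'v::ab_group_add \<Rightarrow> 'v" +
  fixes V :: "'v set" and Y :: "'v \<Rightarrow> int \<Rightarrow> 'v \<Rightarrow> 'v" and one :: 'v
  assumes subspace: "subspace V"
    and one_closed: "one \<in> V"
    and Y_in: "\<lbrakk>u \<in> V; v \<in> V\<rbrakk> \<Longrightarrow> Y u n v \<in> V"
    and Y_truncated: "\<lbrakk>u \<in> V; v \<in> V\<rbrakk> \<Longrightarrow> lower_truncated (\<lambda>n. Y u n v)"
    and Y_add_left: "\<lbrakk>u \<in> V; u' \<in> V; v \<in> V\<rbrakk> \<Longrightarrow> Y (u + u') n v = Y u n v + Y u' n v"
    and Y_scale_left: "\<lbrakk>u \<in> V; v \<in> V\<rbrakk> \<Longrightarrow> Y (scale c u) n v = scale c (Y u n v)"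
    and Y_add_right: "\<lbrakk>u \<in> V; v \<in> V; v' \<in> V\<rbrakk> \<Longrightarrow> Y u n (v + v') = Y u n v + Y u n v'"
    and Y_scale_right: "\<lbrakk>u \<in> V; v \<in> V\<rbrakk> \<Longrightarrow> Y u n (scale c v) = scale c (Y u n v)"
    and vacuum: "v \<in> V \<Longrightarrow> Y one n v = (if n = 0 then v else 0)"
    and creation_nonneg: "\<lbrakk>v \<in> V; n < 0\<rbrakk> \<Longrightarrow> Y v n one = 0"
    and creation_limit: "v \<in> V \<Longrightarrow> Y v 0 one = v"
    and Jacobi: "\<lbrakk>u \<in> V; v \<in> V; w \<in> V\<rbrakk> \<Longrightarrow>
      series3_mult scale (\<lambda>p q r. delta_coeff 1 (- 1) 1 p q r) (series_12 (Y u) (Y v) w) i j k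
      - series3_mult scale (\<lambda>p q r. delta_coeff 1 (- 1) (- 1) p r q) (series_21 (Y u) (Y v) w) i j k
      = series3_mult scale (\<lambda>p q r. delta_coeff 1 (- 1) 1 r q p) (series_iterate Y Y u v w) i j k"

text \<open>
  The Jacobi identity for \<open>a, b\<close> and \<open>\<alpha>, \<beta>\<close>, with \<open>\<gamma> = \<alpha>/\<beta>\<close>, applied to \<open>c\<close>; it
  includes that the three products exist.
\<close>
definition twisted_Jacobi ::
    "(complex \<Rightarrow> 'w \<Rightarrow> 'w) \<Rightarrow> complex \<Rightarrow> complex \<Rightarrow> (int \<Rightarrow> 'w \<Rightarrow> 'w) \<Rightarrow> (int \<Rightarrow> 'w \<Rightarrow> 'w)
      \<Rightarrow> (int \<Rightarrow> 'w \<Rightarrow> 'w::ab_group_add) \<Rightarrow> bool"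
  where "twisted_Jacobi s \<alpha> \<beta> a b c \<longleftrightarrow>
    (let \<gamma> = \<alpha> * inverse \<beta>;
         \<delta>1 = (\<lambda>p q r. delta_coeff 1 (- \<gamma>) 1 p q r);
         \<delta>2 = (\<lambda>p q r. delta_coeff (- \<gamma>) 1 1 p r q);
         \<delta>3 = (\<lambda>p q r. delta_coeff \<gamma> 1 1 q r p);
         g1 = series_12 (Y_op s \<alpha> a) (Y_op s \<beta> b) c;
         g2 = series_21 (Y_op s \<alpha> a) (Y_op s \<beta> b) c;
         g3 = series_iterate (Y_op s \<beta>) (Y_op s \<gamma>) a b c
     in series3_mult_exists (field_scale s) \<delta>1 g1
        \<and> series3_mult_exists (field_scale s) \<delta>2 g2
        \<and> series3_mult_exists (field_scale s) \<delta>3 g3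
        \<and> (\<forall>i j k. series3_mult (field_scale s) \<delta>1 g1 i j k
                   - series3_mult (field_scale s) \<delta>2 g2 i j k
                 = series3_mult (field_scale s) \<delta>3 g3 i j k))"

end

theory Submission
  imports Defs
begin

text \<open>
  Fix a vector \<open>w\<close> in \<open>W\<close> and apply everything to it, to work with \<open>W\<close>-valued series.  For a compatible pair,
  \<open>Y\<^sub>\<alpha>(a(x), x\<^sub>0)b(x)w\<close> is the result of the substitution \<open>x\<^sub>1 = \<alpha> x + x\<^sub>0\<close> in \<open>a(x\<^sub>1)b(x)w\<close>, a
  substitution that first has to be extended from \<open>W((x\<^sub>1, x))\<close> to the series that some nonzero
  polynomial brings into \<open>W((x\<^sub>1, x))\<close> (\<open>is_subst\<close>).  It is well defined because a nonzero
  polynomial acts injectively on \<open>W((x))((x\<^sub>0))\<close>, and it is linear over polynomials; uniqueness and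
  linearity give the vacuum and creation properties and the linearity of the operations.

  Quasi locality of \<open>c\<close> with \<open>a\<close> and \<open>b\<close> gives, with polynomials \<open>p\<close> and \<open>g\<close>, that
  \<open>p(y, \<alpha> x + x\<^sub>0)g(y, x)\<close> annihilates the commutator of \<open>c(y)\<close> with \<open>Y\<^sub>\<alpha>(a(x), x\<^sub>0)b(x)\<close>.  This
  commutator is truncated in \<open>x\<^sub>0\<close>, and the constant term \<open>p(y, \<alpha> x)\<close> in \<open>x\<^sub>0\<close> is nonzero, so that
  \<open>p(y, \<alpha> x)\<^sup>Ng(y, x)\<close> annihilates any given coefficient for large \<open>N\<close> (\<open>quasi_local_Y_op\<close>).  Hence
  a maximal quasi local set is a closed subspace, and the generated subspace exists by Zorn's lemma
  (\<open>generated_closed\<close>).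

  For the Jacobi identity let \<open>\<alpha> = \<gamma>\<beta>\<close>, and let \<open>f(y, z)\<close>, \<open>g(y, x)\<close>, \<open>h(z, x)\<close> witness the quasi
  locality of the pairs \<open>(a, b)\<close>, \<open>(a, c)\<close>, \<open>(b, c)\<close>.  Then \<open>U = f g h a(y)b(z)c(x)w\<close> lies in
  \<open>W((y, z, x))\<close>, does not depend on the order of \<open>a, b, c\<close>, and setting \<open>y = \<alpha> x + x\<^sub>1\<close>,
  \<open>z = \<beta> x + x\<^sub>2\<close> in \<open>U\<close> gives both products \<open>Y\<^sub>\<alpha>(a, x\<^sub>1)Y\<^sub>\<beta>(b, x\<^sub>2)c\<close> and \<open>Y\<^sub>\<beta>(b, x\<^sub>2)Y\<^sub>\<alpha>(a, x\<^sub>1)c\<close>, multiplied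
  by \<open>f(\<alpha> x + x\<^sub>1, \<beta> x + x\<^sub>2)g(\<alpha> x + x\<^sub>1, x)h(\<beta> x + x\<^sub>2, x)\<close>.  Write \<open>f = (y - \<gamma> z)\<^sup>nf\<^sub>1\<close> with
  \<open>f\<^sub>1(\<gamma> z, z)\<close> nonzero; since \<open>y - \<gamma> z\<close> becomes \<open>x\<^sub>1 - \<gamma> x\<^sub>2\<close>, and \<open>f\<^sub>1(\<alpha> x, \<beta> x)\<close> is nonzero, all
  factors other than \<open>(x\<^sub>1 - \<gamma> x\<^sub>2)\<^sup>n\<close> can be cancelled up to powers of \<open>x\<^sub>1\<close> and \<open>x\<^sub>2\<close>.  So both products
  multiplied by \<open>(x\<^sub>1 - \<gamma> x\<^sub>2)\<^sup>n\<close> are the same series \<open>P\<close>, truncated in \<open>x\<^sub>1\<close> and \<open>x\<^sub>2\<close>, and in the same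
  way \<open>x\<^sub>0\<^sup>n Y\<^sub>\<beta>(Y\<^sub>\<gamma>(a, x\<^sub>0)b, x\<^sub>2)c\<close> is \<open>P\<close> at \<open>x\<^sub>1 = \<gamma> x\<^sub>2 + x\<^sub>0\<close>
  (\<open>weak_commutativity_associativity\<close>).  From this the Jacobi identity follows with the three-term
  identity of delta functions, which amounts to an identity of binomial coefficients
  (\<open>expansion_Jacobi\<close>, \<open>Jacobi_from_weak\<close>).
\<close>

section \<open>Polynomials in commuting operators\<close>

text \<open>The action \<open>p(A)u\<close> of a polynomial in a linear operator \<open>A\<close> on a module over the
  coefficient ring.\<close>
definition poly_act ::
    "('r::comm_ring_1 \<Rightarrow> 'm \<Rightarrow> 'm::ab_group_add) \<Rightarrow> ('m \<Rightarrow> 'm) \<Rightarrow> 'r poly \<Rightarrow> 'm \<Rightarrow> 'm"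
  where "poly_act s A p u = (\<Sum>i\<le>degree p. s (coeff p i) ((A ^^ i) u))"

text \<open>The action \<open>f(A, B)u\<close> of a polynomial in two variables in commuting operators; the outer
  variable of \<open>f\<close> is replaced by \<open>A\<close>.\<close>
definition poly2_act ::
    "(complex \<Rightarrow> 'm \<Rightarrow> 'm::ab_group_add) \<Rightarrow> ('m \<Rightarrow> 'm) \<Rightarrow> ('m \<Rightarrow> 'm)
      \<Rightarrow> complex poly poly \<Rightarrow> 'm \<Rightarrow> 'm"
  where "poly2_act s A B = poly_act (poly_act s B) A"

text \<open>Almost every property of \<open>p(A)\<close> used below (linearity, commutation with other operators,
  compatibility with substitutions and with truncations) is an instance of the following
  parametricity principle.\<close>
lemma poly_act_rel:
  assumes "R u v" and "R 0 0"
    and "\<And>u v u' v'. R u v \<Longrightarrow> R u' v' \<Longrightarrow> R (u + u') (v + v')"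
    and "\<And>c u v. R u v \<Longrightarrow> R (s c u) (s' c v)"
    and "\<And>u v. R u v \<Longrightarrow> R (A u) (A' v)"
  shows "R (poly_act s A p u) (poly_act s' A' p v)"
proof -
  have pow: "R ((A ^^ i) u) ((A' ^^ i) v)" for i
    by (induction i) (use assms in auto)
  have "R (\<Sum>i\<in>I. s (coeff p i) ((A ^^ i) u)) (\<Sum>i\<in>I. s' (coeff p i) ((A' ^^ i) v))"
    if "finite I" for I
    using that by (induction I rule: finite_induct) (use assms pow in auto)
  then show ?thesis by (simp add: poly_act_def)
qed

lemma poly2_act_rel:
  assumes "R u v" and "R 0 0"
    and "\<And>u v u' v'. R u v \<Longrightarrow> R u' v' \<Longrightarrow> R (u + u') (v + v')"
    and "\<And>c u v. R u v \<Longrightarrow> R (s c u) (s' c v)"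
    and "\<And>u v. R u v \<Longrightarrow> R (A u) (A' v)" and "\<And>u v. R u v \<Longrightarrow> R (B u) (B' v)"
  shows "R (poly2_act s A B f u) (poly2_act s' A' B' f v)"
  unfolding poly2_act_def
  by (rule poly_act_rel[where R = R]; (rule poly_act_rel[where R = R])?) (use assms in auto)

lemma poly2_act_invariant:
  assumes "P u" and "P 0" and "\<And>u v. P u \<Longrightarrow> P v \<Longrightarrow> P (u + v)" and "\<And>c u. P u \<Longrightarrow> P (s c u)"
    and "\<And>u. P u \<Longrightarrow> P (A u)" and "\<And>u. P u \<Longrightarrow> P (B u)"
  shows "P (poly2_act s A B f u)"
  by (rule poly2_act_rel[where R = "\<lambda>u v. P u" and s' = s and A' = A and B' = B and v = u])
    (use assms in auto)

lemma module_hom_iff: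
  "module_hom s s A \<longleftrightarrow> module s \<and> (\<forall>u v. A (u + v) = A u + A v) \<and> (\<forall>c u. A (s c u) = s c (A u))"
  by (auto simp: module_hom_def module_hom_axioms_def)

lemma poly_act_comm:
  assumes "module_hom s s' C" and "\<And>u. C (A u) = A' (C u)"
  shows "C (poly_act s A p u) = poly_act s' A' p (C u)"
proof -
  interpret module_hom s s' C by fact
  show ?thesis
    by (rule poly_act_rel[where R = "\<lambda>u v. C u = v"]) (use assms(2) in \<open>auto simp: add scale\<close>)
qed

lemma poly2_act_comm:
  assumes "module_hom s s' C" and "\<And>u. C (A u) = A' (C u)" and "\<And>u. C (B u) = B' (C u)"
  shows "C (poly2_act s A B f u) = poly2_act s' A' B' f (C u)"
proof -
  interpret module_hom s s' C by fact
  show ?thesis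
    by (rule poly2_act_rel[where R = "\<lambda>u v. C u = v"]) (use assms(2,3) in \<open>auto simp: add scale\<close>)
qed

lemma poly_act_pCons:
  assumes "module_hom s s A"
  shows "poly_act s A (pCons c p) u = s c u + A (poly_act s A p u)"
proof -
  interpret module_hom s s A by fact
  have comm: "(\<Sum>i\<le>n. s (coeff p i) ((A ^^ Suc i) u)) = A (\<Sum>i\<le>n. s (coeff p i) ((A ^^ i) u))" for n
    by (induction n) (simp_all add: add scale)
  show ?thesis
  proof (cases "p = 0")
    case True
    then show ?thesis by (auto simp: poly_act_def degree_pCons_eq_if)
  next
    case False
    then show ?thesis
      unfolding poly_act_def degree_pCons_eq[OF False] sum.atMost_Suc_shift comm[symmetric]
      by simp
  qed
qed

lemma poly_act_0 [simp]: "module s \<Longrightarrow> poly_act s A 0 u = 0"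
  by (simp add: poly_act_def module.scale_zero_left)

lemma poly_act_add_poly:
  assumes A: "module_hom s s A"
  shows "poly_act s A (p + q) u = poly_act s A p u + poly_act s A q u"
proof (induction p arbitrary: q)
  case 0
  from A show ?case by (simp add: module_hom_iff)
next
  case (pCons c p)
  obtain d r where q: "q = pCons d r" by (cases q)
  interpret module_hom s s A by fact
  show ?case
    by (simp add: q poly_act_pCons[OF A] pCons.IH add m1.scale_left_distrib)
qed

lemma poly_act_smult:
  assumes A: "module_hom s s A"
  shows "poly_act s A (smult c p) u = s c (poly_act s A p u)"
proof (induction p)
  case 0
  from A show ?case by (simp add: module_hom_iff module.scale_zero_right)
next
  case (pCons d p)
  interpret module_hom s s A by fact
  show ?case
    by (simp add: poly_act_pCons[OF A] pCons.IH scale m1.scale_right_distrib)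
qed

lemma poly_act_mult:
  assumes A: "module_hom s s A"
  shows "poly_act s A (p * q) u = poly_act s A p (poly_act s A q u)"
proof (induction p)
  case 0
  from A show ?case by (simp add: module_hom_iff)
next
  case (pCons d p)
  interpret module_hom s s A by fact
  show ?case
    by (simp add: poly_act_pCons[OF A] poly_act_add_poly[OF A] poly_act_smult[OF A] pCons.IH)
qed

lemma module_hom_poly_act_self:
  assumes A: "module_hom s s A"
  shows "module_hom s s (poly_act s A p)"
proof -
  interpret module_hom s s A by fact
  have *: "poly_act s A p (u + v) = poly_act s A p u + poly_act s A p v \<and>
        poly_act s A p (s c u) = s c (poly_act s A p u)" for c u v
    by (induction p) (simp_all add: poly_act_0[OF m1.module_axioms] poly_act_pCons[OF A] add scale
        m1.scale_right_distrib mult.commute add_ac)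
  show ?thesis
    using * m1.module_axioms by (simp add: module_hom_iff)
qed

lemma module_poly_act:
  assumes A: "module_hom s s A"
  shows "module (poly_act s A)"
proof
  interpret module_hom s s A by fact
  interpret p: module_hom s s "poly_act s A p" for p by (rule module_hom_poly_act_self[OF A])
  fix p q :: "'a poly" and u v :: 'b
  show "poly_act s A p (u + v) = poly_act s A p u + poly_act s A p v" by (rule p.add)
  show "poly_act s A (p + q) u = poly_act s A p u + poly_act s A q u"
    by (rule poly_act_add_poly[OF A])
  show "poly_act s A p (poly_act s A q u) = poly_act s A (p * q) u"
    by (rule poly_act_mult[OF A, symmetric])
  show "poly_act s A 1 u = u" by (simp add: poly_act_def)
qed

lemma module_hom_poly_act:
  assumes "module_hom s s A" and "module_hom s s B" and "\<And>u. B (A u) = A (B u)"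
  shows "module_hom (poly_act s A) (poly_act s A) B"
  using module_poly_act[OF assms(1)] assms(2)
    poly_act_comm[OF assms(2), where A = A and A' = A, OF assms(3)]
  by (simp add: module_hom_iff)

lemma poly_act_pcompose:
  assumes "module_hom s s A"
  shows "poly_act s A (pcompose p q) u = poly_act s (poly_act s A q) p u"
proof (induction p)
  case 0
  from assms show ?case by (simp add: module_hom_iff)
next
  case (pCons c p)
  interpret module_hom s s A by fact
  show ?case
    by (simp add: pcompose_pCons poly_act_0[OF m1.module_axioms] poly_act_add_poly[OF assms] poly_act_mult[OF assms] pCons.IH
        poly_act_pCons[OF assms] poly_act_pCons[OF module_hom_poly_act_self[OF assms]])
qed

text \<open>Setting the outer variable to a polynomial in the inner one.\<close>
lemma poly_act_poly:
  assumes A: "module_hom s s A"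
  shows "poly_act (poly_act s A) (poly_act s A r) f u = poly_act s A (poly f r) u"
proof -
  have hom: "module_hom (poly_act s A) (poly_act s A) (poly_act s A r)"
  proof -
    interpret module "poly_act s A" by (rule module_poly_act[OF A])
    show ?thesis
      by (simp add: module_hom_iff module_axioms scale_right_distrib scale_left_commute mult.commute)
  qed
  show ?thesis
  proof (induction f)
    case 0
    show ?case using module_poly_act[OF A] A
      by (simp add: module_hom_iff[of s])
  next
    case (pCons c f)
    show ?case
      by (simp add: poly_act_pCons[OF hom] pCons.IH poly_act_add_poly[OF A] poly_act_mult[OF A])
  qed
qed

text \<open>Two commuting linear operators on a complex vector space.\<close>
locale commuting_pair =
  A: module_hom s s A + B: module_hom s s B
  for s :: "complex \<Rightarrow> 'm::ab_group_add \<Rightarrow> 'm" and A B +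
  assumes commute: "A (B u) = B (A u)"
begin

lemma hom_outer: "module_hom (poly_act s B) (poly_act s B) A"
  by (rule module_hom_poly_act) (unfold_locales, auto simp: commute)

lemma module2: "module (poly2_act s A B)"
  unfolding poly2_act_def by (rule module_poly_act[OF hom_outer])

lemma mult2: "poly2_act s A B (f * g) u = poly2_act s A B f (poly2_act s A B g u)"
  using module.scale_scale[OF module2] by metis

lemma hom2: "module_hom s s (poly2_act s A B f)"
proof -
  interpret module "poly2_act s A B" by (rule module2)
  have *: "poly2_act s A B f (s c u) = s c (poly2_act s A B f u)" for c u
    by (rule sym, rule poly2_act_comm)
      (simp_all add: module_hom_iff A.m1.module_axioms A.m1.scale_right_distrib
        mult.commute A.scale B.scale)
  show ?thesis
    by (simp add: module_hom_iff A.m1.module_axioms scale_right_distrib *)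
qed

lemma pCons2: "poly2_act s A B (pCons p f) u = poly_act s B p u + A (poly2_act s A B f u)"
  by (simp add: poly2_act_def poly_act_pCons[OF hom_outer])

lemma poly2_act_linear_factor:
  "poly2_act s A B [:- [:0, c:], 1:] u = A u - s c (B u)"
proof -
  have B: "module_hom s s B" by unfold_locales
  have zero: "poly_act s B 0 v = 0" "poly_act (poly_act s B) A 0 v = 0" for v
    by (simp_all add: poly_act_0[OF A.m1.module_axioms] poly_act_0[OF module_poly_act[OF B]])
  have "poly_act s B [:0, - c:] u = - s c (B u)" "poly_act s B [:1:] (A u) = A u"
    by (simp_all add: poly_act_pCons[OF B] zero B.neg B.scale)
  moreover have "poly_act (poly_act s B) A [:[:1:]:] u = poly_act s B [:1:] u"
    by (simp add: poly_act_pCons[OF hom_outer] zero)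
  ultimately show ?thesis
    by (simp add: pCons2 poly2_act_def one_pCons poly_act_pCons[OF hom_outer] zero
        poly_act_pCons[OF B])
qed

end

lemma commuting_pairI:
  assumes "module_hom s s A" "module_hom s s B" "\<And>u. A (B u) = B (A u)"
  shows "commuting_pair s A B"
  by (intro commuting_pair.intro commuting_pair_axioms.intro assms)

section \<open>Shift operators on formal series and iterated Laurent series\<close>

text \<open>Pointwise scalar multiplication.\<close>
definition fun_scale :: "('c \<Rightarrow> 'v \<Rightarrow> 'v) \<Rightarrow> 'c \<Rightarrow> ('i \<Rightarrow> 'v) \<Rightarrow> 'i \<Rightarrow> 'v"
  where "fun_scale s c u = (\<lambda>n. s c (u n))"

text \<open>Multiplication by the linear form \<open>c\<^sub>1 x\<^sub>1 + c\<^sub>0 x\<close> of a series in \<open>x\<^sub>1, x\<close>, and by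
  \<open>c\<^sub>1 x\<^sub>1 + c\<^sub>2 x\<^sub>2 + c\<^sub>0 x\<close> of a series in \<open>x\<^sub>1, x\<^sub>2, x\<close>.\<close>
definition linform2 ::
    "(complex \<Rightarrow> 'v \<Rightarrow> 'v) \<Rightarrow> complex \<Rightarrow> complex \<Rightarrow> (int \<Rightarrow> int \<Rightarrow> 'v) \<Rightarrow> int \<Rightarrow> int \<Rightarrow> 'v::plus"
  where "linform2 s c1 c0 u = (\<lambda>m n. s c1 (u (m - 1) n) + s c0 (u m (n - 1)))"

definition linform3 ::
    "(complex \<Rightarrow> 'v \<Rightarrow> 'v) \<Rightarrow> complex \<Rightarrow> complex \<Rightarrow> complex \<Rightarrow> (int \<Rightarrow> int \<Rightarrow> int \<Rightarrow> 'v)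
      \<Rightarrow> int \<Rightarrow> int \<Rightarrow> int \<Rightarrow> 'v::plus"
  where "linform3 s c1 c2 c0 u =
    (\<lambda>j k l. s c1 (u (j - 1) k l) + s c2 (u j (k - 1) l) + s c0 (u j k (l - 1)))"

text \<open>\<open>V((x))((x\<^sub>0))\<close> and \<open>V((x))((x\<^sub>2))((x\<^sub>1))\<close>; the first index belongs to the outermost
  variable.\<close>
definition iterated2 :: "(int \<Rightarrow> int \<Rightarrow> 'v::zero) \<Rightarrow> bool"
  where "iterated2 y \<longleftrightarrow> lower_truncated y \<and> (\<forall>k. lower_truncated (y k))"

definition iterated3 :: "(int \<Rightarrow> int \<Rightarrow> int \<Rightarrow> 'v::zero) \<Rightarrow> bool"
  where "iterated3 T \<longleftrightarrow> lower_truncated T \<and> (\<forall>i. iterated2 (T i))"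

lemma fun_scale_apply [simp]: "fun_scale s c u n = s c (u n)"
  by (simp add: fun_scale_def)

lemma module_fun_scale:
  assumes "module s" shows "module (fun_scale s)"
proof -
  interpret module s by fact
  show ?thesis
    by unfold_locales (auto simp: fun_eq_iff scale_right_distrib scale_left_distrib)
qed

lemma lower_truncated_0 [simp]: "lower_truncated 0" "lower_truncated (\<lambda>n. 0)"
  by (auto simp: lower_truncated_def)

lemma lower_truncated_comb:
  assumes "lower_truncated u" "lower_truncated v"
    and "\<And>n. u n = 0 \<Longrightarrow> v n = 0 \<Longrightarrow> w n = 0"
  shows "lower_truncated w"
proof -
  from assms(1,2) obtain M N where "\<forall>n<M. u n = 0" "\<forall>n<N. v n = 0"
    by (auto simp: lower_truncated_def)
  with assms(3) have "\<forall>n<min M N. w n = 0" by auto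
  then show ?thesis unfolding lower_truncated_def by blast
qed

lemma lower_truncated_shift: "lower_truncated u \<Longrightarrow> lower_truncated (\<lambda>n. u (n - d))" for d :: int
  unfolding lower_truncated_def by (metis diff_less_eq add.commute)

lemma lower_truncated2_comb:
  assumes "lower_truncated2 u" "lower_truncated2 v"
    and "\<And>m n. u m n = 0 \<Longrightarrow> v m n = 0 \<Longrightarrow> w m n = 0"
  shows "lower_truncated2 w"
proof -
  from assms(1,2) obtain M N where "\<forall>m n. m < M \<or> n < M \<longrightarrow> u m n = 0"
      "\<forall>m n. m < N \<or> n < N \<longrightarrow> v m n = 0"
    by (auto simp: lower_truncated2_def)
  with assms(3) have "\<forall>m n. m < min M N \<or> n < min M N \<longrightarrow> w m n = 0"
    by (metis min_less_iff_conj)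
  then show ?thesis unfolding lower_truncated2_def by blast
qed

lemma lower_truncated2_shift:
  assumes "lower_truncated2 u" shows "lower_truncated2 (\<lambda>m n. u (m - c) (n - d))"
proof -
  from assms obtain N where "\<forall>m n. m < N \<or> n < N \<longrightarrow> u m n = 0"
    by (auto simp: lower_truncated2_def)
  then have "\<forall>m n. m < N - \<bar>c\<bar> - \<bar>d\<bar> \<or> n < N - \<bar>c\<bar> - \<bar>d\<bar> \<longrightarrow> u (m - c) (n - d) = 0"
    by auto
  then show ?thesis unfolding lower_truncated2_def by blast
qed

lemma lower_truncated2_0 [simp]: "lower_truncated2 0" "lower_truncated2 (\<lambda>m n. 0)"
  by (auto simp: lower_truncated2_def)

lemma iterated2_comb:
  assumes "iterated2 u" "iterated2 v"
    and "\<And>m n. u m n = 0 \<Longrightarrow> v m n = 0 \<Longrightarrow> w m n = 0"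
  shows "iterated2 w"
proof -
  have "lower_truncated w"
    by (rule lower_truncated_comb[of u v]) (use assms in \<open>auto simp: iterated2_def fun_eq_iff\<close>)
  moreover have "lower_truncated (w k)" for k
    by (rule lower_truncated_comb[of "u k" "v k"]) (use assms in \<open>auto simp: iterated2_def\<close>)
  ultimately show ?thesis by (simp add: iterated2_def)
qed

lemma iterated2_shift: "iterated2 u \<Longrightarrow> iterated2 (\<lambda>m n. u (m - c) (n - d))"
proof -
  assume u: "iterated2 u"
  from u have "lower_truncated (\<lambda>m. u (m - c))" by (auto simp: iterated2_def lower_truncated_shift)
  then have "lower_truncated (\<lambda>m n. u (m - c) (n - d))"
    by (auto simp: lower_truncated_def fun_eq_iff)
  with u show ?thesis by (auto simp: iterated2_def lower_truncated_shift)
qed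

lemma iterated2_0 [simp]: "iterated2 0" "iterated2 (\<lambda>m n. 0)"
  by (auto simp: iterated2_def zero_fun_def[symmetric])

lemma iterated3_comb:
  assumes "iterated3 u" "iterated3 v"
    and "\<And>j k l. u j k l = 0 \<Longrightarrow> v j k l = 0 \<Longrightarrow> w j k l = 0"
  shows "iterated3 w"
proof -
  have "lower_truncated w"
    by (rule lower_truncated_comb[of u v]) (use assms in \<open>auto simp: iterated3_def fun_eq_iff\<close>)
  moreover have "iterated2 (w k)" for k
    by (rule iterated2_comb[of "u k" "v k"]) (use assms in \<open>auto simp: iterated3_def\<close>)
  ultimately show ?thesis by (simp add: iterated3_def)
qed

lemma iterated3_shift: "iterated3 u \<Longrightarrow> iterated3 (\<lambda>j k l. u (j - b) (k - c) (l - d))"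
proof -
  assume u: "iterated3 u"
  then have "lower_truncated (\<lambda>m. u (m - b))" by (auto simp: iterated3_def lower_truncated_shift)
  then have "lower_truncated (\<lambda>j k l. u (j - b) (k - c) (l - d))"
    by (auto simp: lower_truncated_def fun_eq_iff)
  with u show ?thesis by (auto simp: iterated3_def iterated2_shift)
qed

lemma iterated3_0 [simp]: "iterated3 0"
  by (auto simp: iterated3_def)

lemma lower_truncated_least:
  assumes "lower_truncated y" "y \<noteq> 0"
  obtains k where "y k \<noteq> 0" "\<And>i. i < k \<Longrightarrow> y i = 0"
proof -
  from assms obtain N where N: "\<forall>n<N. y n = 0" by (auto simp: lower_truncated_def)
  from assms obtain m where m: "y m \<noteq> 0" by (auto simp: fun_eq_iff)
  define n where "n = (LEAST n. y (N + int n) \<noteq> 0)"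
  have ex: "y (N + int (nat (m - N))) \<noteq> 0" using m N by (cases "m < N") auto
  show ?thesis
  proof
    show "y (N + int n) \<noteq> 0" unfolding n_def by (rule LeastI[where P = "\<lambda>n. y (N + int n) \<noteq> 0", OF ex])
    fix i assume i: "i < N + int n"
    show "y i = 0"
    proof (cases "i < N")
      case False
      with i have "nat (i - N) < n" by linarith
      from not_less_Least[OF this[unfolded n_def]] False show ?thesis by simp
    qed (use N in auto)
  qed
qed

text \<open>The complex vector space \<open>W\<close>; \<open>sc1\<close>, \<open>sc2\<close>, \<open>sc3\<close> are the scalar multiplications of the
  \<open>W\<close>-valued series in one, two and three variables.\<close>
locale complex_space = vector_space scale
  for scale :: "complex \<Rightarrow> 'w::ab_group_add \<Rightarrow> 'w"
begin

abbreviation sc1 :: "complex \<Rightarrow> (int \<Rightarrow> 'w) \<Rightarrow> int \<Rightarrow> 'w"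
  where "sc1 \<equiv> fun_scale scale"

abbreviation sc2 :: "complex \<Rightarrow> (int \<Rightarrow> int \<Rightarrow> 'w) \<Rightarrow> int \<Rightarrow> int \<Rightarrow> 'w"
  where "sc2 \<equiv> fun_scale sc1"

abbreviation sc3 :: "complex \<Rightarrow> (int \<Rightarrow> int \<Rightarrow> int \<Rightarrow> 'w) \<Rightarrow> int \<Rightarrow> int \<Rightarrow> int \<Rightarrow> 'w"
  where "sc3 \<equiv> fun_scale sc2"

abbreviation "lf2 \<equiv> linform2 scale"
abbreviation "lf3 \<equiv> linform3 scale"

text \<open>\<open>f(x\<^sub>1, x)u\<close>, and \<open>f(\<alpha> x + x\<^sub>0, x)y\<close> for a series \<open>y\<close> in \<open>x\<^sub>0, x\<close>.\<close>
abbreviation act :: "complex poly poly \<Rightarrow> (int \<Rightarrow> int \<Rightarrow> 'w) \<Rightarrow> int \<Rightarrow> int \<Rightarrow> 'w"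
  where "act \<equiv> poly2_act sc2 (lf2 1 0) (lf2 0 1)"

abbreviation shifted_act ::
    "complex \<Rightarrow> complex poly poly \<Rightarrow> (int \<Rightarrow> int \<Rightarrow> 'w) \<Rightarrow> int \<Rightarrow> int \<Rightarrow> 'w"
  where "shifted_act \<alpha> \<equiv> poly2_act sc2 (lf2 1 \<alpha>) (lf2 0 1)"

lemmas linform_simps = linform2_def linform3_def scale_right_distrib scale_left_distrib add_ac
  mult_ac

lemma module_sc [simp]: "module scale" "module sc1" "module sc2" "module sc3"
  by (intro module_fun_scale module_axioms)+

lemma hom_lf2: "module_hom sc2 sc2 (lf2 a b)"
  by (simp add: module_hom_iff fun_eq_iff linform_simps)

lemma hom_lf3: "module_hom sc3 sc3 (lf3 a b c)"
  by (simp add: module_hom_iff fun_eq_iff linform_simps)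

lemma lf2_comm: "lf2 a b (lf2 c d u) = lf2 c d (lf2 a b u)"
  by (simp add: fun_eq_iff linform_simps)

lemma lf3_comm: "lf3 a b c (lf3 a' b' c' u) = lf3 a' b' c' (lf3 a b c u)"
  by (simp add: fun_eq_iff linform_simps)

lemma pair2: "commuting_pair sc2 (lf2 a b) (lf2 c d)"
  by (intro commuting_pairI hom_lf2 lf2_comm)

lemma pair3: "commuting_pair sc3 (lf3 a b c) (lf3 a' b' c')"
  by (intro commuting_pairI hom_lf3 lf3_comm)

lemma act2_comm:
  "poly2_act sc2 (lf2 a b) (lf2 c d) f (poly2_act sc2 (lf2 a' b') (lf2 c' d') g u)
    = poly2_act sc2 (lf2 a' b') (lf2 c' d') g (poly2_act sc2 (lf2 a b) (lf2 c d) f u)"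
  by (rule poly2_act_comm[OF commuting_pair.hom2[OF pair2]];
      rule sym, rule poly2_act_comm[OF hom_lf2]; rule lf2_comm)

lemma act3_comm:
  "poly2_act sc3 (lf3 a b c) (lf3 d e h) f (poly2_act sc3 (lf3 a' b' c') (lf3 d' e' h') g u)
    = poly2_act sc3 (lf3 a' b' c') (lf3 d' e' h') g (poly2_act sc3 (lf3 a b c) (lf3 d e h) f u)"
  by (rule poly2_act_comm[OF commuting_pair.hom2[OF pair3]];
      rule sym, rule poly2_act_comm[OF hom_lf3]; rule lf3_comm)

lemma lf3_act_comm:
  "lf3 a b c (poly2_act sc3 (lf3 a' b' c') (lf3 d' e' h') g u)
    = poly2_act sc3 (lf3 a' b' c') (lf3 d' e' h') g (lf3 a b c u)"
  by (rule poly2_act_comm[OF hom_lf3]; rule lf3_comm)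

lemma act_0 [simp]: "poly2_act sc2 (lf2 a b) (lf2 c d) f 0 = 0"
    "poly2_act sc3 (lf3 a1 b1 c1) (lf3 a2 b2 c2) f 0 = 0"
  using module_hom.zero[OF commuting_pair.hom2[OF pair2]]
    module_hom.zero[OF commuting_pair.hom2[OF pair3]] by auto

lemma lower_truncated2_add:
  "lower_truncated2 u \<Longrightarrow> lower_truncated2 v \<Longrightarrow> lower_truncated2 (u + v)"
  for u v :: "int \<Rightarrow> int \<Rightarrow> 'w"
  by (rule lower_truncated2_comb[of u v]) auto

lemma lower_truncated2_scale: "lower_truncated2 u \<Longrightarrow> lower_truncated2 (sc2 c u)"
  by (rule lower_truncated2_comb[of u u]) auto

lemma iterated2_add: "iterated2 u \<Longrightarrow> iterated2 v \<Longrightarrow> iterated2 (u + v)"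
  for u v :: "int \<Rightarrow> int \<Rightarrow> 'w"
  by (rule iterated2_comb[of u v]) auto

lemma iterated2_scale: "iterated2 u \<Longrightarrow> iterated2 (sc2 c u)"
  by (rule iterated2_comb[of u u]) auto

lemma iterated3_add: "iterated3 u \<Longrightarrow> iterated3 v \<Longrightarrow> iterated3 (u + v)"
  for u v :: "int \<Rightarrow> int \<Rightarrow> int \<Rightarrow> 'w"
  by (rule iterated3_comb[of u v]) auto

lemma iterated3_scale: "iterated3 u \<Longrightarrow> iterated3 (sc3 c u)"
  by (rule iterated3_comb[of u u]) auto

lemma lower_truncated2_lf2: "lower_truncated2 u \<Longrightarrow> lower_truncated2 (lf2 a b u)"
  by (rule lower_truncated2_comb[of "\<lambda>m n. u (m - 1) (n - 0)" "\<lambda>m n. u (m - 0) (n - 1)"];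
      (rule lower_truncated2_shift)?) (auto simp: linform2_def)

lemma lower_truncated2_act:
  "lower_truncated2 u \<Longrightarrow> lower_truncated2 (poly2_act sc2 (lf2 a b) (lf2 c d) f u)"
  by (rule poly2_act_invariant[where P = lower_truncated2])
    (auto intro: lower_truncated2_lf2 lower_truncated2_add lower_truncated2_scale)

lemma iterated2_lf2: "iterated2 u \<Longrightarrow> iterated2 (lf2 a b u)"
  by (rule iterated2_comb[of "\<lambda>m n. u (m - 1) (n - 0)" "\<lambda>m n. u (m - 0) (n - 1)"];
      (rule iterated2_shift)?) (auto simp: linform2_def)

lemma iterated2_act:
  "iterated2 u \<Longrightarrow> iterated2 (poly2_act sc2 (lf2 a b) (lf2 c d) f u)"
  by (rule poly2_act_invariant[where P = iterated2]) (auto intro: iterated2_lf2 iterated2_add iterated2_scale)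

lemma iterated3_lf3: "iterated3 u \<Longrightarrow> iterated3 (lf3 a b c u)"
proof -
  assume u: "iterated3 u"
  have "iterated3 (lf3 0 b c u)"
    by (rule iterated3_comb[OF iterated3_shift[OF u, of 0 1 0] iterated3_shift[OF u, of 0 0 1]])
      (simp add: linform3_def)
  then show ?thesis
    by (rule iterated3_comb[OF iterated3_shift[OF u, of 1 0 0]]) (simp add: linform3_def)
qed

lemma iterated2_minus: "iterated2 u \<Longrightarrow> iterated2 v \<Longrightarrow> iterated2 (u - v)"
  for u v :: "int \<Rightarrow> int \<Rightarrow> 'w"
  by (rule iterated2_comb[of u v]) auto

lemma iterated3_minus: "iterated3 u \<Longrightarrow> iterated3 v \<Longrightarrow> iterated3 (u - v)"
  for u v :: "int \<Rightarrow> int \<Rightarrow> int \<Rightarrow> 'w"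
  by (rule iterated3_comb[of u v]) auto

lemma lf2_pow: "(lf2 0 1 ^^ j) ((lf2 1 0 ^^ i) u) m n = u (m - int i) (n - int j)"
proof -
  have "(lf2 0 1 ^^ j) v m n = v m (n - int j)" for v m n
    by (induction j arbitrary: n) (simp_all add: linform2_def algebra_simps)
  moreover have "(lf2 1 0 ^^ i) v m n = v (m - int i) n" for v m n
    by (induction i arbitrary: m) (simp_all add: linform2_def algebra_simps)
  ultimately show ?thesis by simp
qed

lemma sum_fun_apply: "(\<Sum>i\<in>I. F i) x = (\<Sum>i\<in>I. F i x)" for F :: "'i \<Rightarrow> 'x \<Rightarrow> 'y::comm_monoid_add"
  by (induction I rule: infinite_finite_induct) auto

lemma act_eq_poly2_mult: "act f u = poly2_mult scale f u"
  by (simp add: fun_eq_iff poly2_act_def poly_act_def poly2_mult_def sum_fun_apply lf2_pow)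

text \<open>Multiplication by a nonzero polynomial is injective on \<open>W((x))((x\<^sub>0))\<close>, by comparing the
  lowest coefficients.\<close>
lemma act_injective:
  assumes f: "f \<noteq> 0" and y: "iterated2 y" and zero: "act f y = 0"
  shows "y = 0"
proof (rule ccontr)
  assume "y \<noteq> 0"
  then obtain k where k: "y k \<noteq> 0" "\<And>i. i < k \<Longrightarrow> y i = 0"
    using y lower_truncated_least[of y] unfolding iterated2_def by blast
  then obtain l where l: "y k l \<noteq> 0" "\<And>i. i < l \<Longrightarrow> y k i = 0"
    using y lower_truncated_least[of "y k"] unfolding iterated2_def by blast
  define i0 where "i0 = (LEAST i. coeff f i \<noteq> 0)"
  have i0: "coeff f i0 \<noteq> 0" "\<And>i. i < i0 \<Longrightarrow> coeff f i = 0"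
    using LeastI[of "\<lambda>i. coeff f i \<noteq> 0" "degree f"] f not_less_Least unfolding i0_def by auto
  define j0 where "j0 = (LEAST j. coeff (coeff f i0) j \<noteq> 0)"
  have j0: "coeff (coeff f i0) j0 \<noteq> 0" "\<And>j. j < j0 \<Longrightarrow> coeff (coeff f i0) j = 0"
    using LeastI[of "\<lambda>j. coeff (coeff f i0) j \<noteq> 0" "degree (coeff f i0)"] i0 not_less_Least
    unfolding j0_def by auto
  have vanish: "scale (coeff (coeff f i) j) (y (k + int i0 - int i) (l + int j0 - int j)) = 0"
    if "(i, j) \<noteq> (i0, j0)" for i j
  proof (cases i i0 rule: linorder_cases)
    case less
    then show ?thesis by (simp add: i0)
  next
    case greater
    then have "k + int i0 - int i < k" by simp
    then show ?thesis by (simp add: k)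
  next
    case equal
    with that have "j < j0 \<or> l + int j0 - int j < l" by auto
    then show ?thesis using equal by (auto simp: j0 l)
  qed
  have "act f y (k + int i0) (l + int j0) = (\<Sum>i\<le>degree f. \<Sum>j\<le>degree (coeff f i).
      if i = i0 \<and> j = j0 then scale (coeff (coeff f i0) j0) (y k l) else 0)"
    unfolding act_eq_poly2_mult poly2_mult_def
    by (intro sum.cong refl) (use vanish in auto)
  also have "\<dots> = (\<Sum>i\<le>degree f. if i = i0 then scale (coeff (coeff f i0) j0) (y k l) else 0)"
    using j0(1) by (intro sum.cong refl) (auto simp: le_degree)
  also have "\<dots> = scale (coeff (coeff f i0) j0) (y k l)"
    using i0(1) by (simp add: le_degree)
  finally show False using zero j0(1) l(1) by simp
qed

lemma shifted_act_injective:
  assumes f: "f \<noteq> 0" and y: "iterated2 y" and d: "d \<noteq> 0"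
    and zero: "poly2_act sc2 (lf2 d \<alpha>) (lf2 0 1) f y = 0"
  shows "y = 0"
proof -
  let ?r = "[:[:0, \<alpha>:], [:d:]:]"
  note hom = commuting_pair.hom_outer[OF pair2]
  have zero': "poly_act sc2 (lf2 0 1) 0 u = 0" "poly2_act sc2 (lf2 1 0) (lf2 0 1) 0 u = 0" for u
    by (simp_all add: poly2_act_def poly_act_0[OF module_poly_act[OF hom_lf2]])
  have "poly_act (poly_act sc2 (lf2 0 1)) (lf2 1 0) ?r = lf2 d \<alpha>"
    by (rule ext) (simp add: fun_eq_iff poly_act_pCons[OF hom] poly_act_pCons[OF hom_lf2] zero'
        poly_act_0[OF module_poly_act[OF hom_lf2]] linform_simps)
  then have "act (pcompose f ?r) y = poly2_act sc2 (lf2 d \<alpha>) (lf2 0 1) f y"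
    by (simp add: poly2_act_def poly_act_pcompose[OF hom])
  moreover have "pcompose f ?r \<noteq> 0"
    using f d pcompose_eq_0[of f ?r] by auto
  ultimately show ?thesis
    using act_injective y zero by metis
qed

end

section \<open>Substitution of a linear form for a variable\<close>

text \<open>The coefficient of \<open>y\<^sup>M\<^sup>-\<^sup>r z\<^sup>r\<close> in \<open>(c y + d z)\<^sup>M\<close>, expanded in nonnegative
  powers of \<open>z\<close>.\<close>
definition form_coeff :: "complex \<Rightarrow> complex \<Rightarrow> int \<Rightarrow> int \<Rightarrow> complex"
  where "form_coeff c d M r =
    (if 0 \<le> r then (of_int M gchoose nat r) * c powi (M - r) * d ^ nat r else 0)"

lemma binom_coeff_eq_form_coeff: "p + r = M \<Longrightarrow> binom_coeff c d M p r = form_coeff c d M r"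
  by (auto simp: binom_coeff_def form_coeff_def)

lemma form_coeff_Pascal:
  assumes "c \<noteq> 0"
  shows "form_coeff c d (M + 1) r = c * form_coeff c d M r + d * form_coeff c d M (r - 1)"
proof (cases "r \<le> 0")
  case True
  then show ?thesis using assms by (auto simp: form_coeff_def power_int_add)
next
  case False
  define q where "q = nat (r - 1)"
  have r: "r = 1 + int q" "nat (1 + int q) = Suc q" using False by (auto simp: q_def)
  define X where "X = c powi (M - (1 + int q))"
  have gb: "(of_int (M + 1) gchoose Suc q :: complex) = (of_int M gchoose q) + (of_int M gchoose Suc q)"
    using gbinomial_Suc_Suc[of "of_int M :: complex" q] by simp
  have pow: "c powi (M - int q) = c * X"
    using assms by (simp add: X_def power_int_diff power_int_add)
  have "form_coeff c d (M + 1) r = (of_int (M + 1) gchoose Suc q) * c powi (M - int q) * d ^ Suc q"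
    by (simp add: form_coeff_def r)
  moreover have "form_coeff c d M r = (of_int M gchoose Suc q) * X * d ^ Suc q"
    by (simp add: form_coeff_def r X_def)
  moreover have "form_coeff c d M (r - 1) = (of_int M gchoose q) * c powi (M - int q) * d ^ q"
    by (simp add: form_coeff_def r)
  ultimately show ?thesis
    unfolding gb pow by (simp only: power_Suc distrib_left distrib_right mult_ac add_ac)
qed

text \<open>The coefficient of \<open>x\<^sup>m\<^sup>-\<^sup>k x\<^sub>0\<^sup>k\<close> in \<open>(\<alpha> x + x\<^sub>0)\<^sup>m\<close>, expanded in nonnegative powers of \<open>x\<^sub>0\<close>.\<close>
definition subst_coeff :: "complex \<Rightarrow> int \<Rightarrow> int \<Rightarrow> complex"
  where "subst_coeff \<alpha> m k = (if k < 0 then 0 else (of_int m gchoose nat k) * \<alpha> powi (m - k))"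

lemma subst_coeff_Pascal:
  assumes "\<alpha> \<noteq> 0"
  shows "subst_coeff \<alpha> (m + 1) k = \<alpha> * subst_coeff \<alpha> m k + subst_coeff \<alpha> m (k - 1)"
proof -
  have "subst_coeff \<alpha> m k = form_coeff \<alpha> 1 m k" for m k
    by (simp add: form_coeff_def subst_coeff_def)
  then show ?thesis by (simp add: form_coeff_Pascal[OF assms])
qed

lemma subst_coeff_eq_0:
  assumes "0 \<le> m" "m < k" shows "subst_coeff \<alpha> m k = 0"
proof -
  from assms obtain j i where "m = int j" "k = int i" "j < i"
    by (metis nonneg_int_cases order_le_less_trans order_less_imp_le of_nat_less_iff)
  then show ?thesis by (simp add: subst_coeff_def binomial_gbinomial[symmetric])
qed

lemma Sum_any_hom:
  assumes T: "T 0 = 0" "\<And>u v. T (u + v) = T u + T v" and fin: "finite {a. g a \<noteq> 0}"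
  shows "T (Sum_any g) = Sum_any (\<lambda>a. T (g a))"
proof -
  have "T (sum g A) = (\<Sum>a\<in>A. T (g a))" for A
    by (induction A rule: infinite_finite_induct) (simp_all add: T)
  moreover have "Sum_any (\<lambda>a. T (g a)) = (\<Sum>a | g a \<noteq> 0. T (g a))"
    by (rule Sum_any.expand_superset[OF fin]) (use T in auto)
  ultimately show ?thesis by (simp add: Sum_any.expand_set)
qed

context complex_space
begin

abbreviation "subst \<equiv> subst_shift scale"

lemma subst_eq_Sum_any:
  "subst \<alpha> g k l = Sum_any (\<lambda>m. scale (subst_coeff \<alpha> m k) (g m (l - m + k)))"
  by (simp add: subst_shift_def subst_coeff_def)

text \<open>For \<open>g\<close> truncated at \<open>N\<close> in both variables, a coefficient is a sum over an interval.\<close>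
lemma subst_eq_sum:
  assumes "\<And>m n. m < N \<or> n < N \<Longrightarrow> g m n = 0" and "finite I" and "{N..l + k - N} \<subseteq> I"
  shows "subst \<alpha> g k l = (\<Sum>m\<in>I. scale (subst_coeff \<alpha> m k) (g m (l - m + k)))"
  unfolding subst_eq_Sum_any
proof (rule Sum_any.expand_superset[OF assms(2)])
  show "{a. scale (subst_coeff \<alpha> a k) (g a (l - a + k)) \<noteq> 0} \<subseteq> I"
  proof
    fix m assume "m \<in> {a. scale (subst_coeff \<alpha> a k) (g a (l - a + k)) \<noteq> 0}"
    then have "g m (l - m + k) \<noteq> 0" by auto
    with assms(1)[of m "l - m + k"] have "\<not> (m < N \<or> l - m + k < N)" by blast
    then have "m \<in> {N..l + k - N}" by auto
    with assms(3) show "m \<in> I" by blast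
  qed
qed

lemma subst_neg: "k < 0 \<Longrightarrow> subst \<alpha> g k l = 0"
  by (simp add: subst_eq_Sum_any subst_coeff_def)

lemma subst_low:
  assumes "\<And>m n. m < N \<or> n < N \<Longrightarrow> g m n = 0" and "l + k < 2 * N"
  shows "subst \<alpha> g k l = 0"
  using subst_eq_sum[of N g "{}" l k \<alpha>] assms by auto

lemma iterated2_subst:
  assumes "lower_truncated2 g" shows "iterated2 (subst \<alpha> g)"
proof -
  from assms obtain N where N: "\<And>m n. m < N \<or> n < N \<Longrightarrow> g m n = 0"
    unfolding lower_truncated2_def by blast
  have "\<forall>k<0. subst \<alpha> g k = 0" by (simp add: fun_eq_iff subst_neg)
  moreover have "\<forall>l<2 * N - k. subst \<alpha> g k l = 0" for k
    using subst_low[of N g] N by auto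
  ultimately show ?thesis unfolding iterated2_def lower_truncated_def by blast
qed

lemma subst_add:
  assumes "lower_truncated2 g" "lower_truncated2 h"
  shows "subst \<alpha> (g + h) = subst \<alpha> g + subst \<alpha> h"
proof (intro ext)
  fix k l
  from assms obtain M N where MN: "\<And>m n. m < M \<or> n < M \<Longrightarrow> g m n = 0"
      "\<And>m n. m < N \<or> n < N \<Longrightarrow> h m n = 0"
    unfolding lower_truncated2_def by blast
  let ?K = "min M N" let ?I = "{?K..l + k - ?K}"
  have "subst \<alpha> (g + h) k l = (\<Sum>m\<in>?I. scale (subst_coeff \<alpha> m k) ((g + h) m (l - m + k)))"
    by (rule subst_eq_sum[of ?K]) (use MN in auto)
  moreover have "subst \<alpha> g k l = (\<Sum>m\<in>?I. scale (subst_coeff \<alpha> m k) (g m (l - m + k)))"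
    by (rule subst_eq_sum[of ?K]) (use MN in auto)
  moreover have "subst \<alpha> h k l = (\<Sum>m\<in>?I. scale (subst_coeff \<alpha> m k) (h m (l - m + k)))"
    by (rule subst_eq_sum[of ?K]) (use MN in auto)
  ultimately show "subst \<alpha> (g + h) k l = (subst \<alpha> g + subst \<alpha> h) k l"
    by (simp add: sum.distrib scale_right_distrib)
qed

lemma subst_linear:
  assumes "module_hom scale scale T" and "lower_truncated2 g"
  shows "T (subst \<alpha> g k l) = subst \<alpha> (\<lambda>m n. T (g m n)) k l"
proof -
  interpret T: module_hom scale scale T by fact
  from assms(2) obtain N where N: "\<And>m n. m < N \<or> n < N \<Longrightarrow> g m n = 0"
    unfolding lower_truncated2_def by blast
  have "subst \<alpha> g k l = (\<Sum>m\<in>{N..l + k - N}. scale (subst_coeff \<alpha> m k) (g m (l - m + k)))"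
    by (rule subst_eq_sum) (use N in auto)
  moreover have "subst \<alpha> (\<lambda>m n. T (g m n)) k l
      = (\<Sum>m\<in>{N..l + k - N}. scale (subst_coeff \<alpha> m k) (T (g m (l - m + k))))"
    by (rule subst_eq_sum) (use N in auto)
  ultimately show ?thesis by (simp add: T.sum T.scale)
qed

lemma hom_scale: "module_hom scale scale (scale c)"
  by (simp add: module_hom_iff module_axioms scale_right_distrib mult.commute)

lemma subst_scale: "lower_truncated2 g \<Longrightarrow> subst \<alpha> (sc2 c g) = sc2 c (subst \<alpha> g)"
  using subst_linear[OF hom_scale] by (simp add: fun_eq_iff fun_scale_def)

text \<open>Under the substitution \<open>x\<^sub>1 = \<alpha> x + x\<^sub>0\<close>, the form \<open>c\<^sub>1 x\<^sub>1 + c\<^sub>0 x\<close> becomes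
  \<open>c\<^sub>1 x\<^sub>0 + (c\<^sub>1 \<alpha> + c\<^sub>0) x\<close>.\<close>
lemma subst_lf2:
  assumes "lower_truncated2 g" and "\<alpha> \<noteq> 0"
  shows "subst \<alpha> (lf2 c1 c0 g) = lf2 c1 (c1 * \<alpha> + c0) (subst \<alpha> g)"
proof (intro ext)
  fix k l
  from assms obtain N where N: "\<And>m n. m < N \<or> n < N \<Longrightarrow> g m n = 0"
    unfolding lower_truncated2_def by blast
  let ?I = "{N - 1..l + k - N + 1}"
  have "subst \<alpha> (lf2 c1 c0 g) k l
      = (\<Sum>m\<in>?I. scale (subst_coeff \<alpha> m k) (lf2 c1 c0 g m (l - m + k)))"
    by (rule subst_eq_sum[of N]) (use N in \<open>auto simp: linform2_def\<close>)
  also have "\<dots> = (\<Sum>m\<in>?I. scale (c1 * subst_coeff \<alpha> m k) (g (m - 1) (l - m + k)))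
      + (\<Sum>m\<in>?I. scale (c0 * subst_coeff \<alpha> m k) (g m (l - 1 - m + k)))"
    by (simp add: linform2_def scale_right_distrib sum.distrib algebra_simps)
  also have "(\<Sum>m\<in>?I. scale (c0 * subst_coeff \<alpha> m k) (g m (l - 1 - m + k)))
      = scale c0 (subst \<alpha> g k (l - 1))"
    by (subst subst_eq_sum[where N = N and I = ?I]) (use N in \<open>auto simp: scale_sum_right\<close>)
  also have "(\<Sum>m\<in>?I. scale (c1 * subst_coeff \<alpha> m k) (g (m - 1) (l - m + k)))
      = (\<Sum>m\<in>{N - 2..l + k - N}. scale (c1 * subst_coeff \<alpha> (m + 1) k) (g m (l - 1 - m + k)))"
    by (rule sum.reindex_bij_witness[of _ "\<lambda>m. m + 1" "\<lambda>m. m - 1"]) (auto simp: algebra_simps)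
  also have "\<dots> = (\<Sum>m\<in>{N - 2..l + k - N}.
        scale (c1 * \<alpha>) (scale (subst_coeff \<alpha> m k) (g m (l - 1 - m + k))))
      + (\<Sum>m\<in>{N - 2..l + k - N}.
        scale c1 (scale (subst_coeff \<alpha> m (k - 1)) (g m (l - m + (k - 1)))))"
    unfolding sum.distrib[symmetric]
    by (intro sum.cong refl)
      (simp add: subst_coeff_Pascal assms(2) scale_left_distrib distrib_left mult_ac algebra_simps)
  also have "(\<Sum>m\<in>{N - 2..l + k - N}.
        scale (c1 * \<alpha>) (scale (subst_coeff \<alpha> m k) (g m (l - 1 - m + k))))
      = scale (c1 * \<alpha>) (subst \<alpha> g k (l - 1))"
    unfolding scale_sum_right[symmetric]
    by (subst subst_eq_sum[where N = N and I = "{N - 2..l + k - N}"]) (use N in auto)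
  also have "(\<Sum>m\<in>{N - 2..l + k - N}.
        scale c1 (scale (subst_coeff \<alpha> m (k - 1)) (g m (l - m + (k - 1)))))
      = scale c1 (subst \<alpha> g (k - 1) l)"
    unfolding scale_sum_right[symmetric]
    by (subst subst_eq_sum[where N = N and I = "{N - 2..l + k - N}"]) (use N in auto)
  finally show "subst \<alpha> (lf2 c1 c0 g) k l = lf2 c1 (c1 * \<alpha> + c0) (subst \<alpha> g) k l"
    by (simp add: linform2_def scale_left_distrib add_ac)
qed

lemma subst_0 [simp]: "subst \<alpha> 0 = 0" "subst \<alpha> (\<lambda>m n. 0) = 0"
  by (simp_all add: fun_eq_iff subst_eq_Sum_any)

lemma subst_act:
  assumes "lower_truncated2 u" and "\<alpha> \<noteq> 0"
  shows "subst \<alpha> (act q u) = shifted_act \<alpha> q (subst \<alpha> u)"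
proof -
  let ?R = "\<lambda>u y. lower_truncated2 u \<and> subst \<alpha> u = y"
  have "?R (act q u) (shifted_act \<alpha> q (subst \<alpha> u))"
    by (rule poly2_act_rel[where R = ?R])
      (use assms in \<open>auto simp: subst_add subst_scale subst_lf2 lower_truncated2_add
        lower_truncated2_scale lower_truncated2_lf2\<close>)
  then show ?thesis by simp
qed

text \<open>
  The substitution \<open>x\<^sub>1 = \<alpha> x + x\<^sub>0\<close> extended to the series \<open>u\<close> that some nonzero polynomial
  brings into \<open>W((x\<^sub>1, x))\<close>; the result \<open>y\<close> lies in \<open>W((x))((x\<^sub>0))\<close>.
\<close>
definition is_subst :: "complex \<Rightarrow> (int \<Rightarrow> int \<Rightarrow> 'w) \<Rightarrow> (int \<Rightarrow> int \<Rightarrow> 'w) \<Rightarrow> bool"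
  where "is_subst \<alpha> u y \<longleftrightarrow> \<alpha> \<noteq> 0 \<and> iterated2 y \<and>
    (\<exists>q. q \<noteq> 0 \<and> lower_truncated2 (act q u) \<and> shifted_act \<alpha> q y = subst \<alpha> (act q u))"

text \<open>Any polynomial that brings \<open>u\<close> into \<open>W((x\<^sub>1, x))\<close> may be used.\<close>
lemma is_subst_act:
  assumes "is_subst \<alpha> u y" and "lower_truncated2 (act q u)"
  shows "shifted_act \<alpha> q y = subst \<alpha> (act q u)"
proof -
  from assms(1) obtain p where a: "\<alpha> \<noteq> 0" and y: "iterated2 y" and p: "p \<noteq> 0"
      "lower_truncated2 (act p u)" "shifted_act \<alpha> p y = subst \<alpha> (act p u)"
    by (auto simp: is_subst_def)
  interpret P: module_hom sc2 sc2 "shifted_act \<alpha> p" by (rule commuting_pair.hom2[OF pair2])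
  have "shifted_act \<alpha> p (shifted_act \<alpha> q y) = shifted_act \<alpha> q (subst \<alpha> (act p u))"
    by (simp add: act2_comm[where f = p] p)
  also have "\<dots> = subst \<alpha> (act q (act p u))" by (simp add: subst_act p a)
  also have "act q (act p u) = act p (act q u)" by (rule act2_comm)
  also have "subst \<alpha> \<dots> = shifted_act \<alpha> p (subst \<alpha> (act q u))"
    by (simp add: subst_act assms(2) a)
  finally have "shifted_act \<alpha> p (shifted_act \<alpha> q y - subst \<alpha> (act q u)) = 0"
    unfolding P.diff right_minus_eq .
  then have "shifted_act \<alpha> q y - subst \<alpha> (act q u) = 0"
    by (rule shifted_act_injective[rotated -1])
      (auto simp: p(1) intro: p(2) iterated2_minus iterated2_act iterated2_subst y assms(2))
  then show ?thesis by simp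
qed

lemma act_1: "act 1 u = u"
  by (simp add: module.scale_one[OF commuting_pair.module2[OF pair2]])

lemma shifted_act_1: "shifted_act \<alpha> 1 u = u"
  by (simp add: module.scale_one[OF commuting_pair.module2[OF pair2]])

lemma is_subst_eq_subst:
  "is_subst \<alpha> u y \<Longrightarrow> lower_truncated2 u \<Longrightarrow> y = subst \<alpha> u"
  using is_subst_act[of \<alpha> u y 1] by (simp add: act_1 shifted_act_1)

lemma is_subst_subst:
  "lower_truncated2 u \<Longrightarrow> \<alpha> \<noteq> 0 \<Longrightarrow> is_subst \<alpha> u (subst \<alpha> u)"
  unfolding is_subst_def by (intro conjI exI[of _ 1]) (simp_all add: iterated2_subst act_1 shifted_act_1)

lemma is_subst_common:
  assumes "is_subst \<alpha> u y" "is_subst \<alpha> u' y'"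
  obtains q where "q \<noteq> 0" "lower_truncated2 (act q u)" "lower_truncated2 (act q u')"
proof -
  from assms obtain p q where pq: "p \<noteq> 0" "lower_truncated2 (act p u)"
      "q \<noteq> 0" "lower_truncated2 (act q u')"
    unfolding is_subst_def by blast
  have "lower_truncated2 (act (p * q) u)"
    by (simp add: mult.commute[of p] commuting_pair.mult2[OF pair2] lower_truncated2_act pq)
  moreover have "lower_truncated2 (act (p * q) u')"
    by (simp add: commuting_pair.mult2[OF pair2] lower_truncated2_act pq)
  ultimately show ?thesis using that[of "p * q"] pq by simp
qed

lemma is_subst_add:
  assumes "is_subst \<alpha> u y" "is_subst \<alpha> u' y'"
  shows "is_subst \<alpha> (u + u') (y + y')"
proof -
  obtain q where q: "q \<noteq> 0" "lower_truncated2 (act q u)" "lower_truncated2 (act q u')"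
    using assms by (rule is_subst_common)
  interpret Q: module_hom sc2 sc2 "shifted_act \<alpha> q" by (rule commuting_pair.hom2[OF pair2])
  interpret P: module_hom sc2 sc2 "act q" by (rule commuting_pair.hom2[OF pair2])
  show ?thesis
    using assms q is_subst_act[OF assms(1) q(2)] is_subst_act[OF assms(2) q(3)] unfolding is_subst_def
    by (auto intro!: exI[of _ q] iterated2_add simp: lower_truncated2_add P.add Q.add subst_add)
qed

lemma is_subst_scale:
  assumes "is_subst \<alpha> u y" shows "is_subst \<alpha> (sc2 c u) (sc2 c y)"
proof -
  from assms obtain q where q: "\<alpha> \<noteq> 0" "iterated2 y" "q \<noteq> 0"
      "lower_truncated2 (act q u)" "shifted_act \<alpha> q y = subst \<alpha> (act q u)"
    by (auto simp: is_subst_def)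
  interpret Q: module_hom sc2 sc2 "shifted_act \<alpha> q" by (rule commuting_pair.hom2[OF pair2])
  interpret P: module_hom sc2 sc2 "act q" by (rule commuting_pair.hom2[OF pair2])
  show ?thesis
    using q unfolding is_subst_def
    by (auto intro!: exI[of _ q] iterated2_scale simp: lower_truncated2_scale P.scale Q.scale subst_scale)
qed

lemma is_subst_lf2:
  assumes "is_subst \<alpha> u y" shows "is_subst \<alpha> (lf2 c1 c0 u) (lf2 c1 (c1 * \<alpha> + c0) y)"
proof -
  from assms obtain q where q: "\<alpha> \<noteq> 0" "iterated2 y" "q \<noteq> 0"
      "lower_truncated2 (act q u)" "shifted_act \<alpha> q y = subst \<alpha> (act q u)"
    by (auto simp: is_subst_def)
  have comm: "poly2_act sc2 (lf2 a b) (lf2 c d) q (lf2 c1 c0 v)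
      = lf2 c1 c0 (poly2_act sc2 (lf2 a b) (lf2 c d) q v)" for a b c d c1 c0 v
    by (rule sym, rule poly2_act_comm[OF hom_lf2]; rule lf2_comm)
  show ?thesis
    using q unfolding is_subst_def
    by (auto intro!: exI[of _ q] iterated2_lf2 simp: lower_truncated2_lf2 comm subst_lf2)
qed

lemma is_subst_0: "\<alpha> \<noteq> 0 \<Longrightarrow> is_subst \<alpha> 0 0"
  using is_subst_subst[of 0 \<alpha>] by simp

lemma act_linear:
  assumes "module_hom scale scale T"
  shows "poly2_act sc2 (lf2 a b) (lf2 c d) q (\<lambda>m n. T (v m n))
    = (\<lambda>m n. T (poly2_act sc2 (lf2 a b) (lf2 c d) q v m n))"
proof -
  interpret T: module_hom scale scale T by fact
  have hom: "module_hom sc2 sc2 (\<lambda>u m n. T (u m n))"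
    by (simp add: module_hom_iff fun_eq_iff T.add T.scale)
  show ?thesis
    by (rule sym, rule poly2_act_comm[OF hom]) (simp_all add: linform2_def T.add T.scale)
qed

lemma is_subst_linear:
  assumes T: "module_hom scale scale T" and "is_subst \<alpha> u y"
  shows "is_subst \<alpha> (\<lambda>m n. T (u m n)) (\<lambda>k l. T (y k l))"
proof -
  interpret T: module_hom scale scale T by fact
  from assms obtain q where q: "\<alpha> \<noteq> 0" "iterated2 y" "q \<noteq> 0"
      "lower_truncated2 (act q u)" "shifted_act \<alpha> q y = subst \<alpha> (act q u)"
    by (auto simp: is_subst_def)
  have "iterated2 (\<lambda>k l. T (y k l))"
    by (rule iterated2_comb[of y y]) (use q in auto)
  moreover have "lower_truncated2 (\<lambda>m n. T (act q u m n))"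
    by (rule lower_truncated2_comb[of "act q u" "act q u"]) (use q in auto)
  moreover have "shifted_act \<alpha> q (\<lambda>k l. T (y k l)) = subst \<alpha> (\<lambda>m n. T (act q u m n))"
    using subst_linear[OF T q(4)] by (simp add: act_linear[OF T] q fun_eq_iff)
  ultimately show ?thesis
    using q(1,3) unfolding is_subst_def by (intro conjI exI[of _ q]) (simp_all add: act_linear[OF T])
qed

lemma is_subst_diff:
  assumes "is_subst \<alpha> u y" "is_subst \<alpha> u' y'" shows "is_subst \<alpha> (u - u') (y - y')"
proof -
  have minus: "x + sc2 (- 1) x' = x - x'" for x x' :: "int \<Rightarrow> int \<Rightarrow> 'w" by (simp add: fun_eq_iff)
  show ?thesis using is_subst_add[OF assms(1) is_subst_scale[OF assms(2), of "- 1"]] by (simp only: minus)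
qed

lemma is_subst_unique:
  assumes "is_subst \<alpha> u y" "is_subst \<alpha> u y'" shows "y = y'"
  using is_subst_eq_subst[OF is_subst_diff[OF assms]] by simp

end

section \<open>The vertex operators as substitutions\<close>

text \<open>Multiplication by a scalar in the field \<open>C((x))((x\<^sub>0))\<close>.\<close>
definition fls_scale :: "complex \<Rightarrow> complex fls fls \<Rightarrow> complex fls fls"
  where "fls_scale c H = fls_const (fls_const c) * H"

lemma hom_fls_mult: "module_hom fls_scale fls_scale ((*) K)"
  by (simp add: module_hom_iff module_def fls_scale_def algebra_simps
      fls_const_mult_const[symmetric] fls_plus_const[symmetric] del: fls_const_mult_const fls_plus_const)

text \<open>In \<open>C((x))((x\<^sub>0))\<close>, the polynomial \<open>f\<close> evaluated at the operators of multiplication by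
  \<open>\<alpha> x + x\<^sub>0\<close> and \<open>x\<close> is the multiplication by \<open>f(\<alpha> x + x\<^sub>0, x)\<close>.\<close>
lemma poly2_act_fls:
  "poly2_act fls_scale ((*) (fls_X + fls_const (fls_const \<alpha> * fls_X))) ((*) (fls_const fls_X)) f H
    = poly2_shift \<alpha> f * H"
proof -
  let ?A = "(*) (fls_X + fls_const (fls_const \<alpha> * fls_X)) :: complex fls fls \<Rightarrow> _"
  let ?B = "(*) (fls_const fls_X) :: complex fls fls \<Rightarrow> _"
  let ?c = "\<lambda>p. fls_const (fps_to_fls (fps_of_poly p)) :: complex fls fls"
  interpret commuting_pair fls_scale ?A ?B
    by (intro commuting_pairI hom_fls_mult) (simp add: algebra_simps)
  have inner: "poly_act fls_scale ?B p K = ?c p * K" for p K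
  proof (induction p)
    case (pCons c p)
    have "?c (pCons c p) = fls_const (fls_const c) + ?c p * fls_const fls_X"
      by (simp add: fps_of_poly_pCons fls_times_fps_to_fls fls_plus_const[symmetric]
          fls_const_mult_const[symmetric] del: fls_plus_const fls_const_mult_const)
    then show ?case
      unfolding poly_act_pCons[OF hom_fls_mult] pCons.IH by (simp only: fls_scale_def distrib_right distrib_left mult_ac)
  qed (simp add: poly_act_0[OF A.m1.module_axioms])
  show ?thesis
  proof (induction f)
    case (pCons p f)
    have "poly2_shift \<alpha> (pCons p f)
        = ?c p + (fls_X + fls_const (fls_const \<alpha> * fls_X)) * poly2_shift \<alpha> f"
      unfolding poly2_shift_def
      by (subst map_poly_pCons) (use pCons.hyps in auto)
    then show ?case
      unfolding pCons2 pCons.IH inner by (simp only: distrib_right distrib_left mult_ac)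
  qed (simp add: poly2_shift_def module.scale_zero_left[OF module2])
qed

context complex_space
begin

text \<open>The product of an element of \<open>C((x))((x\<^sub>0))\<close> and a series in \<open>x\<^sub>0, x\<close>.\<close>
abbreviation "fls_act \<equiv> fls2_mult scale"

lemma fls_act_finite:
  assumes "iterated2 G"
  shows "finite {(i, j). scale (fls_nth (fls_nth H i) j) (G (k - i) (l - j)) \<noteq> 0}"
proof -
  from assms obtain K where K: "\<And>k. k < K \<Longrightarrow> G k = 0"
    by (auto simp: iterated2_def lower_truncated_def)
  from assms have "\<exists>N. \<forall>l<N. G k l = 0" for k
    by (auto simp: iterated2_def lower_truncated_def)
  then obtain L where L: "\<And>k l. l < L k \<Longrightarrow> G k l = 0" by metis
  have "{(i, j). scale (fls_nth (fls_nth H i) j) (G (k - i) (l - j)) \<noteq> 0}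
      \<subseteq> (SIGMA i : {fls_subdegree H..k - K}. {fls_subdegree (fls_nth H i)..l - L (k - i)})"
  proof clarify
    fix i j assume nz: "scale (fls_nth (fls_nth H i) j) (G (k - i) (l - j)) \<noteq> 0"
    then have "\<not> i < fls_subdegree H" "\<not> j < fls_subdegree (fls_nth H i)"
      by auto
    moreover from nz have "\<not> k - i < K" "\<not> l - j < L (k - i)" using K L by auto
    ultimately show "i \<in> {fls_subdegree H..k - K} \<and> j \<in> {fls_subdegree (fls_nth H i)..l - L (k - i)}"
      by auto
  qed
  then show ?thesis by (rule finite_subset) auto
qed

lemma fls_act_eq_0:
  assumes "\<And>i j. i \<ge> fls_subdegree H \<Longrightarrow> j \<ge> fls_subdegree (fls_nth H i) \<Longrightarrow> G (k - i) (l - j) = 0"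
  shows "fls_act H G k l = 0"
proof -
  have "(case p of (i, j) \<Rightarrow> scale (fls_nth (fls_nth H i) j) (G (k - i) (l - j))) = 0" for p
  proof (cases p)
    case (Pair i j)
    then show ?thesis
      using assms[of i j] by (cases "i < fls_subdegree H"; cases "j < fls_subdegree (fls_nth H i)") auto
  qed
  then show ?thesis by (simp add: fls2_mult_def)
qed

lemma iterated2_fls_act:
  assumes "iterated2 G" shows "iterated2 (fls_act H G)"
proof -
  from assms obtain K where K: "\<And>k. k < K \<Longrightarrow> G k = 0"
    by (auto simp: iterated2_def lower_truncated_def)
  from assms have "\<exists>N. \<forall>l<N. G k l = 0" for k
    by (auto simp: iterated2_def lower_truncated_def)
  then obtain L where L: "\<And>k l. l < L k \<Longrightarrow> G k l = 0" by metis
  have "fls_act H G k = 0" if "k < fls_subdegree H + K" for k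
    using that by (intro ext, simp, intro fls_act_eq_0) (simp add: K)
  moreover have "lower_truncated (fls_act H G k)" for k
  proof -
    let ?I = "{fls_subdegree H..k - K}"
    let ?d = "\<lambda>i. fls_subdegree (fls_nth H i) + L (k - i)"
    define M where "M = Min (insert 0 (?d ` ?I))"
    have M: "M \<le> ?d i" if "i \<in> ?I" for i
      unfolding M_def by (rule Min_le) (use that in auto)
    have "fls_act H G k l = 0" if l: "l < M" for l
    proof (rule fls_act_eq_0)
      fix i j assume ij: "i \<ge> fls_subdegree H" "j \<ge> fls_subdegree (fls_nth H i)"
      show "G (k - i) (l - j) = 0"
      proof (cases "k - i < K")
        case False
        with ij M[of i] l have "l - j < L (k - i)" by auto
        then show ?thesis by (rule L)
      qed (simp add: K)
    qed
    then show ?thesis unfolding lower_truncated_def by blast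
  qed
  ultimately show ?thesis unfolding iterated2_def lower_truncated_def by blast
qed

lemma fls_act_add:
  assumes "iterated2 G" shows "fls_act (H + H') G = fls_act H G + fls_act H' G"
proof (intro ext)
  fix k l
  have fin: "finite {p. (case p of (i, j) \<Rightarrow> scale (fls_nth (fls_nth H i) j) (G (k - i) (l - j))) \<noteq> 0}" for H
    using fls_act_finite[OF assms, of H k l] by (simp add: case_prod_unfold)
  show "fls_act (H + H') G k l = (fls_act H G + fls_act H' G) k l"
    unfolding fls2_mult_def plus_fun_apply Sum_any.distrib[OF fin fin, symmetric]
    by (rule Sum_any.cong) (auto simp: scale_left_distrib)
qed

lemma fls_act_scale:
  assumes "iterated2 G" shows "fls_act (fls_scale c H) G = sc2 c (fls_act H G)"
proof (intro ext)
  fix k l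
  have fin: "finite {p. (case p of (i, j) \<Rightarrow> scale (fls_nth (fls_nth H i) j) (G (k - i) (l - j))) \<noteq> 0}"
    using fls_act_finite[OF assms, of H k l] by (simp add: case_prod_unfold)
  show "fls_act (fls_scale c H) G k l = sc2 c (fls_act H G) k l"
    unfolding fls2_mult_def fun_scale_apply
    by (subst Sum_any_hom[of "scale c", OF _ _ fin])
      (auto simp: scale_right_distrib fls_scale_def intro!: Sum_any.cong)
qed

lemma fls_act_X0: "fls_act (fls_X * H) G = lf2 1 0 (fls_act H G)"
proof (intro ext)
  fix k l
  have "fls_act (fls_X * H) G k l
      = Sum_any (\<lambda>(i, j). scale (fls_nth (fls_nth H i) j) (G (k - 1 - i) (l - j)))"
    unfolding fls2_mult_def
  proof (rule Sum_any.reindex_cong[where l = "\<lambda>(i, j). (i + 1, j)"])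
    show "bij (\<lambda>(i, j). (i + 1, j) :: int \<times> int)"
      by (rule bij_betw_byWitness[where f' = "\<lambda>(i, j). (i - 1, j)"]) auto
  qed (auto simp: fls_X_times_conv_shift algebra_simps)
  then show "fls_act (fls_X * H) G k l = lf2 1 0 (fls_act H G) k l"
    by (simp add: linform2_def fls2_mult_def)
qed

lemma fls_act_X: "fls_act (fls_const fls_X * H) G = lf2 0 1 (fls_act H G)"
proof (intro ext)
  fix k l
  have "fls_act (fls_const fls_X * H) G k l
      = Sum_any (\<lambda>(i, j). scale (fls_nth (fls_nth H i) j) (G (k - i) (l - 1 - j)))"
    unfolding fls2_mult_def
  proof (rule Sum_any.reindex_cong[where l = "\<lambda>(i, j). (i, j + 1)"])
    show "bij (\<lambda>(i, j). (i, j + 1) :: int \<times> int)"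
      by (rule bij_betw_byWitness[where f' = "\<lambda>(i, j). (i, j - 1)"]) auto
  qed (auto simp: fls_X_times_conv_shift algebra_simps)
  then show "fls_act (fls_const fls_X * H) G k l = lf2 0 1 (fls_act H G) k l"
    by (simp add: linform2_def fls2_mult_def)
qed

lemma fls_act_1: "fls_act 1 G = G"
proof (intro ext)
  fix k l
  have "fls_act 1 G k l = Sum_any (\<lambda>p. if p = (0 :: int, 0 :: int) then G k l else 0)"
    unfolding fls2_mult_def by (rule Sum_any.cong) (auto split: if_splits)
  then show "fls_act 1 G k l = G k l" by simp
qed

lemma fls_act_0: "fls_act 0 G = 0"
  by (simp add: fun_eq_iff fls2_mult_def)

text \<open>Associativity of the action of \<open>C((x))((x\<^sub>0))\<close> on \<open>W((x))((x\<^sub>0))\<close>, when one factor is a polynomial: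
  it suffices to check multiplication by \<open>x\<^sub>0\<close> and by \<open>x\<close>.\<close>
lemma fls_act_poly2_shift:
  assumes G: "iterated2 G"
  shows "shifted_act \<alpha> f (fls_act H G) = fls_act (poly2_shift \<alpha> f * H) G"
proof -
  let ?A = "\<lambda>H. (fls_X + fls_const (fls_const \<alpha> * fls_X)) * H :: complex fls fls"
  have A: "fls_act (?A H) G = lf2 1 \<alpha> (fls_act H G)" for H
  proof -
    have "?A H = fls_X * H + fls_scale \<alpha> (fls_const fls_X * H)"
      by (simp add: fls_scale_def algebra_simps fls_const_mult_const[symmetric] del: fls_const_mult_const)
    then show ?thesis
      by (simp add: fls_act_add[OF G] fls_act_scale[OF G] fls_act_X0 fls_act_X fun_eq_iff
          linform2_def)
  qed
  have "(\<lambda>H y. fls_act H G = y)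
      (poly2_act fls_scale ?A ((*) (fls_const fls_X)) f H) (shifted_act \<alpha> f (fls_act H G))"
    by (rule poly2_act_rel[where R = "\<lambda>H y. fls_act H G = y"])
      (auto simp: A fls_act_X fls_act_add[OF G] fls_act_scale[OF G] fls_act_0)
  then show ?thesis by (simp add: poly2_act_fls)
qed

end

interpretation complex_scalars: complex_space "(*) :: complex \<Rightarrow> complex \<Rightarrow> complex"
  by unfold_locales (auto simp: algebra_simps)

text \<open>If \<open>f(\<alpha> x + x\<^sub>0, x)\<close> were zero, then \<open>f\<close>, with \<open>\<alpha> x + x\<^sub>0\<close> and \<open>x\<close> for its variables, would annihilate
  the series \<open>1\<close> in \<open>C((x))((x\<^sub>0))\<close>.\<close>
lemma poly2_shift_nonzero:
  assumes "f \<noteq> 0" shows "poly2_shift \<alpha> f \<noteq> 0"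
proof
  define G where "G = (\<lambda>(k::int) (l::int). if k = 0 \<and> l = 0 then 1 else 0 :: complex)"
  assume zero: "poly2_shift \<alpha> f = 0"
  have G: "iterated2 G"
    unfolding iterated2_def lower_truncated_def G_def by (auto simp: fun_eq_iff intro!: exI[of _ 0])
  have "complex_scalars.shifted_act \<alpha> f G = 0"
    using complex_scalars.fls_act_poly2_shift[OF G, of \<alpha> f 1]
    by (simp add: complex_scalars.fls_act_1 zero complex_scalars.fls_act_0)
  from complex_scalars.shifted_act_injective[OF assms G _ this] have "G = 0" by simp
  then have "G 0 0 = 0" by simp
  then show False by (simp add: G_def)
qed

context complex_space
begin

lemma poly2_mult_fields_eq:
  "poly2_mult_fields scale f a b m n w = act f (\<lambda>m n. a m (b n w)) m n"
  by (simp add: act_eq_poly2_mult poly2_mult_fields_def poly2_mult_def sum_fun_apply op_scale_def)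

lemma compatible_poly_iff:
  "compatible_poly scale a b f \<longleftrightarrow>
    f \<noteq> 0 \<and> (\<forall>w. lower_truncated2 (act f (\<lambda>m n. a m (b n w))))"
  unfolding compatible_poly_def poly2_mult_fields_eq by simp

text \<open>\<open>Y\<^sub>\<alpha>(a(x), x\<^sub>0)b(x)w\<close> is the result of setting \<open>x\<^sub>1 = \<alpha> x + x\<^sub>0\<close> in \<open>a(x\<^sub>1)b(x)w\<close>.\<close>
lemma is_subst_Y_op:
  assumes "compatible scale a b" and "\<alpha> \<noteq> 0"
  shows "is_subst \<alpha> (\<lambda>m n. a m (b n w)) (\<lambda>k l. Y_op scale \<alpha> a k b l w)"
proof -
  define f where "f = (SOME f. compatible_poly scale a b f)"
  have "compatible_poly scale a b f"
    using assms(1) unfolding f_def compatible_def by (rule someI_ex)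
  then have f: "f \<noteq> 0" and lt: "lower_truncated2 (act f (\<lambda>m n. a m (b n w)))"
    by (auto simp: compatible_poly_iff)
  let ?G = "subst \<alpha> (act f (\<lambda>m n. a m (b n w)))"
  have G: "iterated2 ?G" using lt by (rule iterated2_subst)
  have Y: "(\<lambda>k l. Y_op scale \<alpha> a k b l w) = fls_act (inverse (poly2_shift \<alpha> f)) ?G"
    by (simp add: Y_op_def Let_def f_def[symmetric] poly2_mult_fields_eq)
  have "shifted_act \<alpha> f (fls_act (inverse (poly2_shift \<alpha> f)) ?G) = ?G"
    using poly2_shift_nonzero[OF f, of \<alpha>] by (simp add: fls_act_poly2_shift[OF G] fls_act_1)
  then show ?thesis
    unfolding is_subst_def Y using f lt G assms(2) iterated2_fls_act by blast
qed

text \<open>The truncation in \<open>x\<^sub>0\<close> is uniform in \<open>w\<close>: it comes from the factor in \<open>C((x))((x\<^sub>0))\<close> only.\<close>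
lemma lower_truncated_Y_op: "lower_truncated (\<lambda>k. Y_op scale \<alpha> a k b)"
proof -
  define f where "f = (SOME f. compatible_poly scale a b f)"
  have "Y_op scale \<alpha> a k b = 0" if "k < fls_subdegree (inverse (poly2_shift \<alpha> f))" for k
    using that by (auto simp: fun_eq_iff Y_op_def Let_def f_def[symmetric] intro!: fls_act_eq_0 subst_neg)
  then show ?thesis unfolding lower_truncated_def by blast
qed

end

section \<open>Quasi locality is inherited by the products\<close>

text \<open>Exchanging the two variables of a polynomial.\<close>
definition swap_vars :: "complex poly poly \<Rightarrow> complex poly poly"
  where "swap_vars f = poly2_act (\<lambda>c. smult [:c:]) (smult [:0, 1:]) (pCons 0) f 1"

context commuting_pair
begin

lemma poly_act_swap_vars: "poly2_act s A B (swap_vars f) u = poly2_act s B A f u"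
proof -
  interpret P: module "poly2_act s A B" by (rule module2)
  have B: "module_hom s s B" by unfold_locales
  have smult: "poly2_act s A B (smult p h) u = poly_act s B p (poly2_act s A B h u)" for p h u
    unfolding poly2_act_def by (rule poly_act_smult[OF hom_outer])
  have "poly_act s B [:c:] u = s c u" "poly_act s B [:0, 1:] u = B u" for c u
    by (simp_all add: poly_act_pCons[OF B] poly_act_0[OF A.m1.module_axioms])
  moreover have "poly2_act s A B (pCons 0 h) u = A (poly2_act s A B h u)" for h u
    by (simp add: pCons2 poly_act_0[OF A.m1.module_axioms])
  ultimately show ?thesis
    unfolding swap_vars_def
    by (intro poly2_act_rel[where R = "\<lambda>h v. poly2_act s A B h u = v"])
      (simp_all add: smult P.scale_left_distrib)
qed

text \<open>Substituting \<open>q\<close> for the inner variable.\<close>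
lemma poly2_act_map_pcompose:
  "poly2_act s A B (map_poly (\<lambda>r. pcompose r q) f) u = poly2_act s A (poly_act s B q) f u"
proof (induction f)
  case 0
  show ?case using module.scale_zero_left[OF module2] by (simp add: poly2_act_def poly_act_def)
next
  case (pCons r f)
  have B: "module_hom s s B" by unfold_locales
  interpret Q: commuting_pair s A "poly_act s B q"
    by (rule commuting_pairI[OF _ module_hom_poly_act_self[OF B]])
      (unfold_locales, auto simp: poly_act_comm[OF A.module_hom_axioms, of B B] commute)
  show ?case
    using pCons.hyps
    by (simp add: map_poly_pCons pCons2 Q.pCons2 pCons.IH poly_act_pcompose[OF B])
qed

end

context complex_space
begin

lemma act_transpose:
  "poly2_act sc2 (lf2 a b) (lf2 c d) f (\<lambda>m n. u n m) = (\<lambda>m n. poly2_act sc2 (lf2 b a) (lf2 d c) f u n m)"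
proof -
  have "module_hom sc2 sc2 (\<lambda>u m n. u n m)"
    by (simp add: module_hom_iff fun_eq_iff)
  then show ?thesis
    by (rule poly2_act_comm[symmetric]) (simp_all add: linform2_def add_ac)
qed

end

text \<open>Otherwise \<open>f\<close> would annihilate the series \<open>1\<close>.\<close>
lemma swap_vars_nonzero:
  assumes "f \<noteq> 0" shows "swap_vars f \<noteq> 0"
proof
  define G where "G = (\<lambda>(k::int) (l::int). if k = 0 \<and> l = 0 then 1 else 0 :: complex)"
  assume zero: "swap_vars f = 0"
  have G: "iterated2 G"
    unfolding iterated2_def lower_truncated_def G_def by (auto simp: fun_eq_iff intro!: exI[of _ 0])
  have "complex_scalars.act (swap_vars f) G = 0"
    using module.scale_zero_left[OF commuting_pair.module2[OF complex_scalars.pair2]] by (simp add: zero)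
  then have "poly2_act complex_scalars.sc2 (complex_scalars.lf2 0 1) (complex_scalars.lf2 1 0) f G = 0"
    by (simp add: commuting_pair.poly_act_swap_vars[OF complex_scalars.pair2])
  moreover have "(\<lambda>k l. G l k) = G" by (auto simp: G_def fun_eq_iff)
  ultimately have "complex_scalars.act f G = 0"
    using complex_scalars.act_transpose[of 1 0 0 1 f G] by (simp add: fun_eq_iff)
  from complex_scalars.act_injective[OF assms G this] have "G 0 0 = 0" by simp
  then show False by (simp add: G_def)
qed

context complex_space
begin

text \<open>A polynomial \<open>f\<close> in two variables, evaluated at two linear forms in three variables.\<close>
abbreviation "act3 a b c a' b' c' \<equiv> poly2_act sc3 (lf3 a b c) (lf3 a' b' c')"

lemma linear_iff_hom: "Vector_Spaces.linear scale scale T \<longleftrightarrow> module_hom scale scale T"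
  by (simp add: Vector_Spaces.linear_def vector_space_axioms)

lemma fieldsD:
  assumes "a \<in> fields scale"
  shows "module_hom scale scale (a n)" "lower_truncated (\<lambda>n. a n w)" "a n 0 = 0"
    "a n (u + v) = a n u + a n v" "a n (u - v) = a n u - a n v" "a n (scale c u) = scale c (a n u)"
proof -
  show hom: "module_hom scale scale (a n)" "lower_truncated (\<lambda>n. a n w)"
    using assms by (auto simp: fields_def linear_iff_hom)
  interpret module_hom scale scale "a n" by (rule hom)
  show "a n 0 = 0" "a n (u + v) = a n u + a n v" "a n (u - v) = a n u - a n v"
      "a n (scale c u) = scale c (a n u)"
    by (rule zero add diff scale)+
qed

lemma quasi_local_iff:
  "mutually_quasi_local scale a b \<longleftrightarrow>
    (\<exists>f. f \<noteq> 0 \<and> (\<forall>w. act f (\<lambda>m n. a m (b n w)) = act f (\<lambda>m n. b n (a m w))))"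
proof -
  have "poly2_mult (op_scale scale) f U = poly2_mult (op_scale scale) f V \<longleftrightarrow>
      (\<forall>w. act f (\<lambda>m n. U m n w) = act f (\<lambda>m n. V m n w))" for f U V
    by (auto simp: fun_eq_iff act_eq_poly2_mult poly2_mult_def sum_fun_apply op_scale_def)
  then show ?thesis by (simp add: mutually_quasi_local_def)
qed

lemma act_low:
  assumes "\<And>m n. n < N \<Longrightarrow> u m n = 0" "n < N" shows "act f u m n = 0"
proof -
  have "\<forall>m n. n < N \<longrightarrow> act f u m n = 0"
    by (rule poly2_act_invariant[where P = "\<lambda>u. \<forall>m n. n < N \<longrightarrow> u m n = 0"])
      (use assms in \<open>auto simp: linform2_def\<close>)
  with assms show ?thesis by blast
qed

lemma act_low':
  assumes "\<And>m n. m < N \<Longrightarrow> u m n = 0" "m < N" shows "act f u m n = 0"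
proof -
  have "\<forall>m n. m < N \<longrightarrow> act f u m n = 0"
    by (rule poly2_act_invariant[where P = "\<lambda>u. \<forall>m n. m < N \<longrightarrow> u m n = 0"])
      (use assms in \<open>auto simp: linform2_def\<close>)
  with assms show ?thesis by blast
qed

text \<open>The product \<open>f(x\<^sub>1, x\<^sub>2)a(x\<^sub>1)b(x\<^sub>2)w\<close> is truncated in \<open>x\<^sub>2\<close>, and the one in the opposite order in
  \<open>x\<^sub>1\<close>.\<close>
lemma quasi_local_imp_compatible:
  assumes "mutually_quasi_local scale a b" and a: "a \<in> fields scale" and b: "b \<in> fields scale"
  shows "compatible scale a b"
proof -
  from assms(1) obtain f where f: "f \<noteq> 0"
    and eq: "\<And>w. act f (\<lambda>m n. a m (b n w)) = act f (\<lambda>m n. b n (a m w))"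
    unfolding quasi_local_iff by blast
  have "lower_truncated2 (act f (\<lambda>m n. a m (b n w)))" for w
  proof -
    from fieldsD(2)[OF a, of w] fieldsD(2)[OF b, of w] obtain M N
      where M: "\<And>m. m < M \<Longrightarrow> a m w = 0" and N: "\<And>n. n < N \<Longrightarrow> b n w = 0"
      unfolding lower_truncated_def by blast
    have "act f (\<lambda>m n. a m (b n w)) m n = 0" if "n < N" for m n
      by (rule act_low[OF _ that]) (simp add: N fieldsD(3)[OF a])
    moreover have "act f (\<lambda>m n. b n (a m w)) m n = 0" if "m < M" for m n
      by (rule act_low'[OF _ that]) (simp add: M fieldsD(3)[OF b])
    ultimately show ?thesis
      unfolding lower_truncated2_def eq[symmetric]
      by (intro exI[of _ "min M N"]) auto
  qed
  with f show ?thesis unfolding compatible_def compatible_poly_iff by blast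
qed

lemma quasi_local_sym:
  assumes "mutually_quasi_local scale a b" shows "mutually_quasi_local scale b a"
proof -
  from assms obtain f where f: "f \<noteq> 0"
    and eq: "\<And>w. act f (\<lambda>m n. a m (b n w)) = act f (\<lambda>m n. b n (a m w))"
    unfolding quasi_local_iff by blast
  have "act (swap_vars f) (\<lambda>m n. b m (a n w)) = act (swap_vars f) (\<lambda>m n. a n (b m w))" for w
    using eq[of w] act_transpose[of 0 1 1 0 f "\<lambda>n m. b m (a n w)"]
      act_transpose[of 0 1 1 0 f "\<lambda>n m. a n (b m w)"]
    by (simp add: commuting_pair.poly_act_swap_vars[OF pair2])
  with swap_vars_nonzero[OF f] show ?thesis unfolding quasi_local_iff by blast
qed

subsection \<open>Slices of series in three variables\<close>

lemma act3_slice1: "act3 0 b c 0 b' c' f u j = poly2_act sc2 (lf2 b c) (lf2 b' c') f (u j)"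
  by (rule poly2_act_comm[where C = "\<lambda>u. u j"])
    (auto simp: module_hom_def module_hom_axioms_def linform2_def linform3_def fun_eq_iff)

lemma act3_slice2:
  "act3 a 0 c a' 0 c' f u j k l = poly2_act sc2 (lf2 a c) (lf2 a' c') f (\<lambda>j l. u j k l) j l"
proof -
  have "module_hom sc3 sc2 (\<lambda>u j l. u j k l)"
    by (simp add: module_hom_iff module_hom_def module_hom_axioms_def fun_eq_iff)
  then have "(\<lambda>j l. act3 a 0 c a' 0 c' f u j k l) = poly2_act sc2 (lf2 a c) (lf2 a' c') f (\<lambda>j l. u j k l)"
    by (rule poly2_act_comm) (auto simp: linform2_def linform3_def)
  then show ?thesis by (simp add: fun_eq_iff)
qed

lemma act3_slice3:
  "act3 a b 0 a' b' 0 f u j k l = poly2_act sc2 (lf2 a b) (lf2 a' b') f (\<lambda>j k. u j k l) j k"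
proof -
  have "module_hom sc3 sc2 (\<lambda>u j k. u j k l)"
    by (simp add: module_hom_def module_hom_axioms_def fun_eq_iff)
  then have "(\<lambda>j k. act3 a b 0 a' b' 0 f u j k l) = poly2_act sc2 (lf2 a b) (lf2 a' b') f (\<lambda>j k. u j k l)"
    by (rule poly2_act_comm) (auto simp: linform2_def linform3_def)
  then show ?thesis by (simp add: fun_eq_iff)
qed

text \<open>Substitutions with an additional variable, in which polynomials may be multiplied as well.\<close>
lemma is_subst_act3:
  assumes "\<And>m. is_subst \<alpha> (u m) (v m)"
  shows "is_subst \<alpha> (act3 a b c a' b' c' f u m)
    (act3 a b (b * \<alpha> + c) a' b' (b' * \<alpha> + c') f v m)"
proof -
  have a: "\<alpha> \<noteq> 0" using assms by (auto simp: is_subst_def)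
  have slice: "lf3 a b c u m = sc2 a (u (m - 1)) + lf2 b c (u m)" for a b c m and u :: "int \<Rightarrow> int \<Rightarrow> int \<Rightarrow> 'w"
    by (simp add: fun_eq_iff linform2_def linform3_def add_ac)
  let ?R = "\<lambda>u v. \<forall>m. is_subst \<alpha> (u m) (v m)"
  have "?R (act3 a b c a' b' c' f u) (act3 a b (b * \<alpha> + c) a' b' (b' * \<alpha> + c') f v)"
    by (rule poly2_act_rel[where R = ?R])
      (use assms in \<open>auto simp: slice is_subst_0[OF a] intro: is_subst_add is_subst_scale is_subst_lf2\<close>)
  then show ?thesis by blast
qed

text \<open>Dong's lemma for quasi locality.\<close>
lemma quasi_local_Y_op:
  assumes a: "a \<in> fields scale" and b: "b \<in> fields scale" and c: "c \<in> fields scale"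
    and ca: "mutually_quasi_local scale c a" and cb: "mutually_quasi_local scale c b"
    and ab: "compatible scale a b" and \<alpha>: "\<alpha> \<noteq> 0"
  shows "mutually_quasi_local scale c (Y_op scale \<alpha> a k b)"
proof -
  from ca obtain p where p: "p \<noteq> 0"
    and p_eq: "\<And>w. act p (\<lambda>m n. c m (a n w)) = act p (\<lambda>m n. a n (c m w))"
    unfolding quasi_local_iff by blast
  from cb obtain g where g: "g \<noteq> 0"
    and g_eq: "\<And>w. act g (\<lambda>m n. c m (b n w)) = act g (\<lambda>m n. b n (c m w))"
    unfolding quasi_local_iff by blast
  from lower_truncated_Y_op obtain K where K: "\<And>k. k < K \<Longrightarrow> Y_op scale \<alpha> a k b = 0"
    unfolding lower_truncated_def by blast
  define N where "N = nat (k - K + 1)"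
  define p' where "p' = map_poly (\<lambda>r. pcompose r [:0, \<alpha>:]) p"
  have p': "p' \<noteq> 0"
  proof
    assume "p' = 0"
    then have "coeff p' (degree p) = 0" by simp
    then have "pcompose (lead_coeff p) [:0, \<alpha>:] = 0" by (simp add: p'_def coeff_map_poly)
    then show False using pcompose_eq_0[of "lead_coeff p" "[:0, \<alpha>:]"] \<alpha> p by auto
  qed
  have "act (p' ^ N * g) (\<lambda>m l. c m (Y_op scale \<alpha> a k b l w))
      = act (p' ^ N * g) (\<lambda>m l. Y_op scale \<alpha> a k b l (c m w))" for w
  proof -
    define u1 where "u1 = (\<lambda>m n l. c m (a n (b l w)))"
    define u2 where "u2 = (\<lambda>m n l. a n (b l (c m w)))"
    define u3 where "u3 = (\<lambda>m n l. a n (c m (b l w)))"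
    define v where "v = (\<lambda>m k l. c m (Y_op scale \<alpha> a k b l w) - Y_op scale \<alpha> a k b l (c m w))"
    interpret G: module_hom sc3 sc3 "act3 1 0 0 0 0 1 g" by (rule commuting_pair.hom2[OF pair3])
    interpret P: module_hom sc3 sc3 "act3 1 0 0 0 1 0 p" by (rule commuting_pair.hom2[OF pair3])
    have "act3 1 0 0 0 1 0 p u1 = act3 1 0 0 0 1 0 p u3"
      using p_eq by (simp add: fun_eq_iff act3_slice3 u1_def u3_def)
    moreover have "act3 1 0 0 0 0 1 g u3 = act3 1 0 0 0 0 1 g u2"
      using g_eq by (simp add: fun_eq_iff act3_slice2 u2_def u3_def act_linear[OF fieldsD(1)[OF a]])
    moreover have comm: "act3 1 0 0 0 1 0 p (act3 1 0 0 0 0 1 g U)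
        = act3 1 0 0 0 0 1 g (act3 1 0 0 0 1 0 p U)" for U
      by (rule act3_comm)
    ultimately have "act3 1 0 0 0 1 0 p (act3 1 0 0 0 0 1 g u1)
        = act3 1 0 0 0 1 0 p (act3 1 0 0 0 0 1 g u2)"
      by metis
    then have zero: "act3 1 0 0 0 1 0 p (act3 1 0 0 0 0 1 g (u1 - u2)) = 0"
      unfolding G.diff P.diff by simp
    define E where "E = act3 1 0 0 0 0 1 g v"
    have "is_subst \<alpha> ((u1 - u2) m) (v m)" for m
    proof -
      have "is_subst \<alpha> (u1 m) (\<lambda>k l. c m (Y_op scale \<alpha> a k b l w))"
        unfolding u1_def by (rule is_subst_linear[OF fieldsD(1)[OF c] is_subst_Y_op[OF ab \<alpha>]])
      moreover have "is_subst \<alpha> (u2 m) (\<lambda>k l. Y_op scale \<alpha> a k b l (c m w))"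
        unfolding u2_def by (rule is_subst_Y_op[OF ab \<alpha>])
      ultimately have "is_subst \<alpha> (u1 m - u2 m)
          ((\<lambda>k l. c m (Y_op scale \<alpha> a k b l w)) - (\<lambda>k l. Y_op scale \<alpha> a k b l (c m w)))"
        by (rule is_subst_diff)
      then show ?thesis by (simp add: v_def fun_diff_def)
    qed
    then have "is_subst \<alpha> (act3 1 0 0 0 1 0 p (act3 1 0 0 0 0 1 g (u1 - u2)) m)
        (act3 1 0 0 0 1 \<alpha> p E m)" for m
      unfolding E_def using is_subst_act3[where b = 0 and b' = 1 and c = 0 and c' = 0]
        is_subst_act3[where b = 0 and b' = 0 and c = 0 and c' = 1] by simp
    then have pE: "act3 1 0 0 0 1 \<alpha> p E = 0"
      unfolding zero using is_subst_eq_subst by (fastforce simp: fun_eq_iff)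
    have E_low: "E m k l = 0" if "k < K" for m k l
    proof -
      have "\<forall>k m l. k < K \<longrightarrow> E m k l = 0"
        unfolding E_def
        by (rule poly2_act_invariant[where P = "\<lambda>u. \<forall>k m l. k < K \<longrightarrow> u m k l = 0"])
          (auto simp: linform3_def v_def K fieldsD(3)[OF c])
      with that show ?thesis by blast
    qed
    \<comment> \<open>Each multiplication by \<open>p(y, \<alpha> x)\<close>, the constant term of \<open>p(y, \<alpha> x + x\<^sub>0)\<close>, kills the lowest
      coefficient in \<open>x\<^sub>0\<close>.\<close>
    define T where "T = (\<lambda>n. (act3 1 0 0 0 0 \<alpha> p ^^ n) E)"
    have pT: "act3 1 0 0 0 1 \<alpha> p (T n) = 0" for n
    proof (induction n)
      case 0
      show ?case unfolding T_def funpow.simps id_def by (rule pE)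
    next
      case (Suc n)
      have "act3 1 0 0 0 1 \<alpha> p (T (Suc n)) = act3 1 0 0 0 0 \<alpha> p (act3 1 0 0 0 1 \<alpha> p (T n))"
        unfolding T_def funpow.simps comp_def by (rule act3_comm)
      also have "\<dots> = 0" unfolding Suc by (rule act_0)
      finally show ?case .
    qed
    have T_low: "T n m k l = 0" if "k < K + int n" for n m k l
      using that
    proof (induction n arbitrary: m k l)
      case 0
      then show ?case by (simp add: T_def E_low)
    next
      case (Suc n)
      have slice: "T (Suc n) m k l = poly2_act sc2 (lf2 1 0) (lf2 0 \<alpha>) p (\<lambda>m l. T n m k l) m l"
        by (simp add: T_def act3_slice2)
      show ?case
      proof (cases "k < K + int n")
        case True
        then have "(\<lambda>m l. T n m k l) = 0" by (simp add: fun_eq_iff Suc.IH)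
        then show ?thesis by (simp add: slice)
      next
        case False
        with Suc.prems have k: "k = K + int n" by simp
        let ?R = "\<lambda>U t. (\<forall>j m l. j < k \<longrightarrow> U m j l = 0) \<and> (\<lambda>m l. U m k l) = t"
        have "?R (act3 1 0 0 0 1 \<alpha> p (T n)) (poly2_act sc2 (lf2 1 0) (lf2 0 \<alpha>) p (\<lambda>m l. T n m k l))"
          by (rule poly2_act_rel[where R = ?R])
            (auto simp: k Suc.IH linform3_def linform2_def fun_eq_iff)
        then show ?thesis unfolding slice pT by (auto simp: fun_eq_iff dest: sym)
      qed
    qed
    have "act (p' ^ N * g) (\<lambda>m l. v m k l) = 0"
    proof -
      have "act3 1 0 0 0 0 1 (p' ^ n * g) v = T n" for n
      proof (induction n)
        case 0
        show ?case unfolding power_0 mult_1 T_def funpow.simps id_def E_def ..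
      next
        case (Suc n)
        have "poly_act sc3 (lf3 0 0 1) [:0, \<alpha>:] = lf3 0 0 \<alpha>"
          by (rule ext) (simp add: poly_act_pCons[OF hom_lf3] poly_act_0 fun_eq_iff linform3_def)
        then have eq: "act3 1 0 0 0 0 1 p' U = act3 1 0 0 0 0 \<alpha> p U" for U
          unfolding p'_def commuting_pair.poly2_act_map_pcompose[OF pair3] by simp
        have "act3 1 0 0 0 0 1 (p' ^ Suc n * g) v = act3 1 0 0 0 0 1 p' (act3 1 0 0 0 0 1 (p' ^ n * g) v)"
          by (simp only: power_Suc mult.assoc commuting_pair.mult2[OF pair3])
        then show ?case unfolding eq Suc T_def funpow.simps comp_def .
      qed
      from this[of N] have "act (p' ^ N * g) (\<lambda>m l. v m k l) m l = T N m k l" for m l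
        by (simp add: act3_slice2[symmetric])
      moreover have "T N m k l = 0" for m l by (rule T_low) (auto simp: N_def)
      ultimately show ?thesis by (simp add: fun_eq_iff)
    qed
    moreover interpret Q: module_hom sc2 sc2 "act (p' ^ N * g)" by (rule commuting_pair.hom2[OF pair2])
    have "(\<lambda>m l. v m k l) = (\<lambda>m l. c m (Y_op scale \<alpha> a k b l w)) - (\<lambda>m l. Y_op scale \<alpha> a k b l (c m w))"
      by (simp add: v_def fun_diff_def)
    ultimately show ?thesis by (simp only: Q.diff right_minus_eq)
  qed
  moreover have "p' ^ N * g \<noteq> 0" using p' g by simp
  ultimately show ?thesis unfolding quasi_local_iff by blast
qed

section \<open>The algebra of fields\<close>

lemma field_scale_eq: "field_scale scale = fun_scale (fun_scale scale)"
  by (simp add: fun_eq_iff field_scale_def op_scale_def)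

lemma field_scale_apply [simp]: "field_scale scale c a n w = scale c (a n w)"
  by (simp add: field_scale_def op_scale_def)

lemma module_field_scale: "module (field_scale scale)"
  unfolding field_scale_eq by (intro module_fun_scale module_axioms)

lemma vector_space_field_scale: "vector_space (field_scale scale)"
  using module_field_scale by (simp add: module_iff_vector_space)

lemma fieldsI:
  assumes "\<And>n u v. a n (u + v) = a n u + a n v" "\<And>n c u. a n (scale c u) = scale c (a n u)"
    and "\<And>w. lower_truncated (\<lambda>n. a n w)"
  shows "a \<in> fields scale"
  using assms by (simp add: fields_def linear_iff_hom module_hom_iff module_axioms)

lemma id_field_fields: "id_field \<in> fields scale"
  by (rule fieldsI) (auto simp: id_field_def lower_truncated_def intro!: exI[of _ 0])

lemma add_fields:
  assumes "a \<in> fields scale" "b \<in> fields scale" shows "a + b \<in> fields scale"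
proof (rule fieldsI)
  fix w
  show "lower_truncated (\<lambda>n. (a + b) n w)"
    by (rule lower_truncated_comb[OF fieldsD(2)[OF assms(1), of w] fieldsD(2)[OF assms(2), of w]]) simp
qed (simp_all add: fieldsD(4,6)[OF assms(1)] fieldsD(4,6)[OF assms(2)] scale_right_distrib add_ac)

lemma scale_fields:
  assumes "a \<in> fields scale" shows "field_scale scale c a \<in> fields scale"
proof (rule fieldsI)
  fix w
  show "lower_truncated (\<lambda>n. field_scale scale c a n w)"
    by (rule lower_truncated_comb[OF fieldsD(2)[OF assms, of w] fieldsD(2)[OF assms, of w]]) simp
qed (simp_all add: fieldsD(4,6)[OF assms] scale_right_distrib mult.commute)

lemma zero_fields: "0 \<in> fields scale"
  by (rule fieldsI) simp_all

text \<open>Uniqueness of substitutions determines the operations.\<close>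
lemma Y_op_eqI:
  assumes "compatible scale a b" and "\<alpha> \<noteq> 0"
    and "\<And>w. is_subst \<alpha> (\<lambda>m n. a m (b n w)) (\<lambda>k l. y k l w)"
  shows "Y_op scale \<alpha> a k b = y k"
proof (intro ext)
  fix l w
  from is_subst_unique[OF is_subst_Y_op[OF assms(1,2)] assms(3)]
  show "Y_op scale \<alpha> a k b l w = y k l w" by meson
qed

lemma Y_op_apply_add:
  assumes a: "a \<in> fields scale" and b: "b \<in> fields scale" and ab: "compatible scale a b" and \<alpha>: "\<alpha> \<noteq> 0"
  shows "Y_op scale \<alpha> a k b l (v + w) = Y_op scale \<alpha> a k b l v + Y_op scale \<alpha> a k b l w"
proof -
  have "is_subst \<alpha> (\<lambda>m n. a m (b n (v + w)))
      ((\<lambda>k l. Y_op scale \<alpha> a k b l v) + (\<lambda>k l. Y_op scale \<alpha> a k b l w))"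
    using is_subst_add[OF is_subst_Y_op[OF ab \<alpha>, of v] is_subst_Y_op[OF ab \<alpha>, of w]]
    by (simp add: plus_fun_def fieldsD(4)[OF a] fieldsD(4)[OF b])
  from is_subst_unique[OF is_subst_Y_op[OF ab \<alpha>] this] show ?thesis
    by (simp add: fun_eq_iff)
qed

lemma Y_op_apply_scale:
  assumes a: "a \<in> fields scale" and b: "b \<in> fields scale" and ab: "compatible scale a b" and \<alpha>: "\<alpha> \<noteq> 0"
  shows "Y_op scale \<alpha> a k b l (scale c w) = scale c (Y_op scale \<alpha> a k b l w)"
proof -
  have "is_subst \<alpha> (\<lambda>m n. a m (b n (scale c w))) (sc2 c (\<lambda>k l. Y_op scale \<alpha> a k b l w))"
    using is_subst_scale[OF is_subst_Y_op[OF ab \<alpha>, of w], of c]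
    by (simp add: fun_scale_def fieldsD(6)[OF a] fieldsD(6)[OF b])
  from is_subst_unique[OF is_subst_Y_op[OF ab \<alpha>] this] show ?thesis
    by (simp add: fun_eq_iff)
qed

lemma Y_op_fields:
  assumes "a \<in> fields scale" "b \<in> fields scale" "compatible scale a b" "\<alpha> \<noteq> 0"
  shows "Y_op scale \<alpha> a k b \<in> fields scale"
proof (rule fieldsI)
  fix w
  have "iterated2 (\<lambda>k l. Y_op scale \<alpha> a k b l w)"
    using is_subst_Y_op[OF assms(3,4)] by (auto simp: is_subst_def)
  then show "lower_truncated (\<lambda>n. Y_op scale \<alpha> a k b n w)" by (auto simp: iterated2_def)
qed (simp_all add: Y_op_apply_add Y_op_apply_scale assms)

lemma Y_op_add_left:
  assumes "compatible scale a b" "compatible scale a' b" "compatible scale (a + a') b" "\<alpha> \<noteq> 0"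
  shows "Y_op scale \<alpha> (a + a') k b = Y_op scale \<alpha> a k b + Y_op scale \<alpha> a' k b"
proof (rule Y_op_eqI[OF assms(3,4)])
  fix w
  show "is_subst \<alpha> (\<lambda>m n. (a + a') m (b n w)) (\<lambda>k l. (Y_op scale \<alpha> a k b + Y_op scale \<alpha> a' k b) l w)"
    using is_subst_add[OF is_subst_Y_op[OF assms(1,4), of w] is_subst_Y_op[OF assms(2,4), of w]]
    by (simp add: plus_fun_def)
qed

lemma Y_op_scale_left:
  assumes "compatible scale a b" "compatible scale (field_scale scale c a) b" "\<alpha> \<noteq> 0"
  shows "Y_op scale \<alpha> (field_scale scale c a) k b = field_scale scale c (Y_op scale \<alpha> a k b)"
proof (rule Y_op_eqI[OF assms(2,3)])
  fix w
  show "is_subst \<alpha> (\<lambda>m n. field_scale scale c a m (b n w))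
      (\<lambda>k l. field_scale scale c (Y_op scale \<alpha> a k b) l w)"
    using is_subst_scale[OF is_subst_Y_op[OF assms(1,3), of w], of c] by (simp add: fun_scale_def)
qed

lemma Y_op_add_right:
  assumes "compatible scale a b" "compatible scale a b'" "compatible scale a (b + b')" "\<alpha> \<noteq> 0"
    and a: "a \<in> fields scale"
  shows "Y_op scale \<alpha> a k (b + b') = Y_op scale \<alpha> a k b + Y_op scale \<alpha> a k b'"
proof (rule Y_op_eqI[OF assms(3,4)])
  fix w
  show "is_subst \<alpha> (\<lambda>m n. a m ((b + b') n w)) (\<lambda>k l. (Y_op scale \<alpha> a k b + Y_op scale \<alpha> a k b') l w)"
    using is_subst_add[OF is_subst_Y_op[OF assms(1,4), of w] is_subst_Y_op[OF assms(2,4), of w]]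
    by (simp add: plus_fun_def fieldsD(4)[OF a])
qed

lemma Y_op_scale_right:
  assumes "compatible scale a b" "compatible scale a (field_scale scale c b)" "\<alpha> \<noteq> 0"
    and a: "a \<in> fields scale"
  shows "Y_op scale \<alpha> a k (field_scale scale c b) = field_scale scale c (Y_op scale \<alpha> a k b)"
proof (rule Y_op_eqI[OF assms(2,3)])
  fix w
  show "is_subst \<alpha> (\<lambda>m n. a m (field_scale scale c b n w))
      (\<lambda>k l. field_scale scale c (Y_op scale \<alpha> a k b) l w)"
    using is_subst_scale[OF is_subst_Y_op[OF assms(1,3), of w], of c]
    by (simp add: fun_scale_def fieldsD(6)[OF a])
qed

subsection \<open>Vacuum and creation\<close>

lemma Y_op_id_left:
  assumes a: "a \<in> fields scale" and "compatible scale id_field a" and \<alpha>: "\<alpha> \<noteq> 0"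
  shows "Y_op scale \<alpha> id_field k a = (if k = 0 then a else 0)"
proof (rule Y_op_eqI[OF assms(2,3)])
  fix w
  let ?u = "\<lambda>m n. id_field m (a n w)"
  from fieldsD(2)[OF a, of w] obtain N where "\<forall>n<N. a n w = 0" unfolding lower_truncated_def by blast
  then have lt: "lower_truncated2 ?u"
    unfolding lower_truncated2_def by (intro exI[of _ "min N 0"]) (auto simp: id_field_def)
  have "subst \<alpha> ?u k l = (if k = 0 then a else 0) l w" for k l
  proof -
    have "subst \<alpha> ?u k l = Sum_any (\<lambda>m. if m = (0 :: int) then scale (subst_coeff \<alpha> 0 k) (a (l + k) w) else 0)"
      unfolding subst_eq_Sum_any by (rule Sum_any.cong) (simp add: id_field_def)
    moreover have "subst_coeff \<alpha> 0 k = (if k = 0 then 1 else 0)"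
      by (auto simp: subst_coeff_def gbinomial_0_left)
    ultimately show ?thesis by simp
  qed
  then have "subst \<alpha> ?u = (\<lambda>k l. (if k = 0 then a else 0) l w)" by (intro ext)
  with is_subst_subst[OF lt \<alpha>] show "is_subst \<alpha> ?u (\<lambda>k l. (if k = 0 then a else 0) l w)" by simp
qed

lemma deriv_field_funpow:
  "(deriv_field scale ^^ k) b l w = scale (pochhammer (of_int (l + 1)) k) (b (l + int k) w)"
  by (induction k arbitrary: l)
    (simp_all add: deriv_field_def op_scale_def pochhammer_rec add_ac)

text \<open>By Taylor's formula, \<open>exp(\<alpha>\<^sup>-\<^sup>1 x\<^sub>0 D)\<close> applied to \<open>a(\<alpha> x)\<close> is \<open>a(\<alpha> x + x\<^sub>0)\<close>.\<close>
lemma exp_deriv_field_rescale: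
  assumes \<alpha>: "\<alpha> \<noteq> 0"
  shows "exp_deriv_field scale (inverse \<alpha>) (rescale_field scale \<alpha> a) k l w
    = scale (subst_coeff \<alpha> (l + k) k) (a (l + k) w)"
proof (cases "k < 0")
  case True
  then show ?thesis by (simp add: exp_deriv_field_def subst_coeff_def)
next
  case False
  then obtain j where k: "k = int j" by (metis nat_0_le not_less)
  have "(of_int (l + int j) gchoose j :: complex) = pochhammer (of_int (l + 1)) j / fact j"
    by (simp add: gbinomial_pochhammer')
  moreover have "inverse \<alpha> ^ j * \<alpha> powi (l + int j) = \<alpha> powi l"
    using \<alpha> by (simp add: power_int_add field_simps)
  ultimately show ?thesis
    by (simp add: exp_deriv_field_def deriv_field_funpow rescale_field_def op_scale_def
        subst_coeff_def k mult_ac)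
qed

lemma Y_op_id_right:
  assumes a: "a \<in> fields scale" and "compatible scale a id_field" and \<alpha>: "\<alpha> \<noteq> 0"
  shows "Y_op scale \<alpha> a k id_field = exp_deriv_field scale (inverse \<alpha>) (rescale_field scale \<alpha> a) k"
proof (rule Y_op_eqI[OF assms(2,3)])
  fix w
  let ?u = "\<lambda>m n. a m (id_field n w)"
  let ?e = "exp_deriv_field scale (inverse \<alpha>) (rescale_field scale \<alpha> a)"
  from fieldsD(2)[OF a, of w] obtain N where "\<forall>n<N. a n w = 0" unfolding lower_truncated_def by blast
  then have lt: "lower_truncated2 ?u"
    unfolding lower_truncated2_def
    by (intro exI[of _ "min N 0"]) (auto simp: id_field_def fieldsD(3)[OF a])
  have "subst \<alpha> ?u k l = ?e k l w" for k l
  proof -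
    have "subst \<alpha> ?u k l
        = Sum_any (\<lambda>m. if m = l + k then scale (subst_coeff \<alpha> (l + k) k) (a (l + k) w) else 0)"
      unfolding subst_eq_Sum_any by (rule Sum_any.cong) (auto simp: id_field_def fieldsD(3)[OF a])
    then show ?thesis by (simp add: exp_deriv_field_rescale[OF \<alpha>])
  qed
  then have "subst \<alpha> ?u = (\<lambda>k l. ?e k l w)" by (intro ext)
  with is_subst_subst[OF lt \<alpha>] show "is_subst \<alpha> ?u (\<lambda>k l. ?e k l w)" by simp
qed

subsection \<open>Maximal quasi local subspaces are closed\<close>

lemma quasi_local_zero: "mutually_quasi_local scale c 0"
  if "c \<in> fields scale"
  unfolding quasi_local_iff by (intro exI[of _ 1]) (simp add: fieldsD(3)[OF that])

lemma quasi_local_id: "mutually_quasi_local scale c id_field"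
  if "c \<in> fields scale"
  unfolding quasi_local_iff
  by (intro exI[of _ 1]) (simp add: fieldsD(3)[OF that] id_field_def if_distrib cong: if_cong)

lemma quasi_local_scale:
  assumes "c \<in> fields scale" "mutually_quasi_local scale c a"
  shows "mutually_quasi_local scale c (field_scale scale r a)"
proof -
  from assms(2) obtain f where f: "f \<noteq> 0"
    and eq: "\<And>w. act f (\<lambda>m n. c m (a n w)) = act f (\<lambda>m n. a n (c m w))"
    unfolding quasi_local_iff by blast
  have "act f (\<lambda>m n. c m (field_scale scale r a n w)) = act f (\<lambda>m n. field_scale scale r a n (c m w))" for w
    using eq[of w] by (simp add: fieldsD(6)[OF assms(1)] act_linear[OF hom_scale] fun_eq_iff)
  with f show ?thesis unfolding quasi_local_iff by blast
qed

lemma quasi_local_add: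
  assumes "c \<in> fields scale" "mutually_quasi_local scale c a" "mutually_quasi_local scale c b"
  shows "mutually_quasi_local scale c (a + b)"
proof -
  from assms(2) obtain f where f: "f \<noteq> 0"
    and f_eq: "\<And>w. act f (\<lambda>m n. c m (a n w)) = act f (\<lambda>m n. a n (c m w))"
    unfolding quasi_local_iff by blast
  from assms(3) obtain g where g: "g \<noteq> 0"
    and g_eq: "\<And>w. act g (\<lambda>m n. c m (b n w)) = act g (\<lambda>m n. b n (c m w))"
    unfolding quasi_local_iff by blast
  have "act (f * g) (\<lambda>m n. c m ((a + b) n w)) = act (f * g) (\<lambda>m n. (a + b) n (c m w))" for w
  proof -
    interpret FG: module_hom sc2 sc2 "act (f * g)" by (rule commuting_pair.hom2[OF pair2])
    have "act (f * g) (\<lambda>m n. c m (a n w)) = act (f * g) (\<lambda>m n. a n (c m w))"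
      unfolding mult.commute[of f] commuting_pair.mult2[OF pair2] f_eq ..
    moreover have "act (f * g) (\<lambda>m n. c m (b n w)) = act (f * g) (\<lambda>m n. b n (c m w))"
      unfolding commuting_pair.mult2[OF pair2] g_eq ..
    moreover have "(\<lambda>m n. c m ((a + b) n w)) = (\<lambda>m n. c m (a n w)) + (\<lambda>m n. c m (b n w))"
        "(\<lambda>m n. (a + b) n (c m w)) = (\<lambda>m n. a n (c m w)) + (\<lambda>m n. b n (c m w))"
      by (simp_all add: fun_eq_iff fieldsD(4)[OF assms(1)])
    ultimately show ?thesis by (simp only: FG.add)
  qed
  with f g show ?thesis unfolding quasi_local_iff by (intro exI[of _ "f * g"]) auto
qed

lemma subspace_field_scale:
  "module.subspace (field_scale scale) U \<longleftrightarrow>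
    0 \<in> U \<and> (\<forall>a\<in>U. \<forall>b\<in>U. a + b \<in> U) \<and> (\<forall>c. \<forall>a\<in>U. field_scale scale c a \<in> U)"
  unfolding module.subspace_def[OF module_field_scale] by auto

text \<open>
  Let \<open>M\<close> be a maximal quasi local set containing \<open>S\<close>.  If a field \<open>d\<close> is quasi local with every field
  that is quasi local with all of \<open>M\<close>, then \<open>d\<close> is quasi local with \<open>M\<close>, hence with itself, and lies
  in \<open>M\<close> by maximality.
\<close>
lemma quasi_local_closed_superset:
  assumes S: "quasi_local scale S" and \<Gamma>: "mult_subgroup \<Gamma>"
  obtains M where "Y_closed scale \<Gamma> M" "quasi_local scale M" "id_field \<in> M" "S \<subseteq> M"
proof -
  let ?A = "{M. quasi_local scale M \<and> S \<subseteq> M}"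
  have "\<exists>M\<in>?A. \<forall>X\<in>?A. M \<subseteq> X \<longrightarrow> X = M"
  proof (rule subset_Zorn_nonempty)
    show "?A \<noteq> {}" using S by blast
  next
    fix C assume C: "C \<noteq> {}" "subset.chain ?A C"
    then have sub: "C \<subseteq> ?A" and chain: "\<And>X Y. X \<in> C \<Longrightarrow> Y \<in> C \<Longrightarrow> X \<subseteq> Y \<or> Y \<subseteq> X"
      by (auto simp: subset_chain_def)
    have "mutually_quasi_local scale a b" if "a \<in> X" "X \<in> C" "b \<in> Y" "Y \<in> C" for a b X Y
    proof -
      from chain[OF that(2,4)] that obtain Z where "a \<in> Z" "b \<in> Z" "Z \<in> C" by blast
      with sub show ?thesis unfolding quasi_local_def by blast
    qed
    moreover have "\<Union> C \<subseteq> fields scale" using sub unfolding quasi_local_def by blast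
    ultimately have "quasi_local scale (\<Union> C)" unfolding quasi_local_def by (meson UnionE)
    moreover have "S \<subseteq> \<Union> C" using C(1) sub by auto
    ultimately show "\<Union> C \<in> ?A" by blast
  qed
  then obtain M where M: "quasi_local scale M" "S \<subseteq> M"
    and max: "\<And>X. quasi_local scale X \<Longrightarrow> M \<subseteq> X \<Longrightarrow> X = M"
    by auto
  have M_fields: "M \<subseteq> fields scale" and M_ql: "\<And>a b. a \<in> M \<Longrightarrow> b \<in> M \<Longrightarrow> mutually_quasi_local scale a b"
    using M(1) by (auto simp: quasi_local_def)
  have mem: "d \<in> M" if d: "d \<in> fields scale"
    and ql: "\<And>c. c \<in> fields scale \<Longrightarrow> (\<And>e. e \<in> M \<Longrightarrow> mutually_quasi_local scale c e)
      \<Longrightarrow> mutually_quasi_local scale c d" for d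
  proof -
    have Md: "mutually_quasi_local scale e d" if "e \<in> M" for e
      using that M_fields M_ql by (intro ql) auto
    then have dM: "mutually_quasi_local scale d e" if "e \<in> M" for e
      using that quasi_local_sym by blast
    then have "mutually_quasi_local scale d d" using ql[OF d] by blast
    with Md dM d M_fields M_ql have "quasi_local scale (insert d M)"
      unfolding quasi_local_def by (simp add: ball_simps)
    from max[OF this] show ?thesis by blast
  qed
  have compat: "compatible scale a b" if "a \<in> M" "b \<in> M" for a b
    using that M_fields M_ql by (intro quasi_local_imp_compatible) auto
  have "0 \<in> M" by (rule mem) (auto simp: zero_fields quasi_local_zero)
  moreover have "a + b \<in> M" if "a \<in> M" "b \<in> M" for a b
    by (rule mem) (use that M_fields in \<open>auto intro: add_fields quasi_local_add\<close>)
  moreover have "field_scale scale c a \<in> M" if "a \<in> M" for a c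
    by (rule mem) (use that M_fields in \<open>auto intro: scale_fields quasi_local_scale\<close>)
  moreover have "nth_prod scale \<alpha> n a b \<in> M" if "a \<in> M" "b \<in> M" "\<alpha> \<in> \<Gamma>" for a b \<alpha> n
  proof -
    from that(3) \<Gamma> have \<alpha>: "\<alpha> \<noteq> 0" by (auto simp: mult_subgroup_def)
    have ab: "a \<in> fields scale" "b \<in> fields scale" using that M_fields by auto
    show ?thesis
      unfolding nth_prod_def
      using compat[OF that(1,2)] that
      by (intro mem) (auto intro!: Y_op_fields quasi_local_Y_op ab \<alpha>)
  qed
  ultimately have "Y_closed scale \<Gamma> M"
    using M_fields compat unfolding Y_closed_def fields_subspace_def subspace_field_scale by blast
  moreover have "id_field \<in> M" by (rule mem) (auto simp: id_field_fields quasi_local_id)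
  ultimately show ?thesis using that M by blast
qed

lemma generated_closed:
  assumes S: "quasi_local scale S" and \<Gamma>: "mult_subgroup \<Gamma>"
  shows "Y_closed scale \<Gamma> (generated scale \<Gamma> S)" "quasi_local scale (generated scale \<Gamma> S)"
    "id_field \<in> generated scale \<Gamma> S"
proof -
  let ?P = "\<lambda>U. Y_closed scale \<Gamma> U \<and> quasi_local scale U \<and> id_field \<in> U"
  obtain M where M: "Y_closed scale \<Gamma> M" "quasi_local scale M" "id_field \<in> M" "S \<subseteq> M"
    using assms by (rule quasi_local_closed_superset)
  let ?G = "generated scale \<Gamma> S"
  have G: "?G = \<Inter>{U. ?P U \<and> S \<subseteq> U}" by (simp add: generated_def hull_def)
  have sub: "?G \<subseteq> M" unfolding G using M by blast
  show "quasi_local scale ?G" using M(2) sub unfolding quasi_local_def by blast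
  show "id_field \<in> ?G" unfolding G by blast
  have "module.subspace (field_scale scale) ?G"
    unfolding subspace_field_scale G
    by (auto simp: Y_closed_def fields_subspace_def subspace_field_scale)
  moreover have "nth_prod scale \<alpha> n a b \<in> ?G" if "a \<in> ?G" "b \<in> ?G" "\<alpha> \<in> \<Gamma>" for a b \<alpha> n
    using that unfolding G by (auto simp: Y_closed_def)
  ultimately show "Y_closed scale \<Gamma> ?G"
    using M(1) sub unfolding Y_closed_def fields_subspace_def by blast
qed

section \<open>Substitutions in three variables\<close>

text \<open>Multiplication by \<open>c x\<close> of a series in \<open>x\<close>.\<close>
abbreviation "lf1 \<equiv> (\<lambda>c (t :: int \<Rightarrow> 'w) l. scale c (t (l - 1)))"

text \<open>Membership in \<open>W((y, z, x))\<close>.\<close>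
definition lower_truncated3 :: "(int \<Rightarrow> int \<Rightarrow> int \<Rightarrow> 'w) \<Rightarrow> bool"
  where "lower_truncated3 u \<longleftrightarrow> (\<exists>N. \<forall>m n l. m < N \<or> n < N \<or> l < N \<longrightarrow> u m n l = 0)"

text \<open>The series \<open>T(x\<^sub>1, x\<^sub>2, x)\<close> results from \<open>u(y, z, x)\<close> by setting \<open>z = \<beta> x + x\<^sub>2\<close> and then
  \<open>y = \<alpha> x + x\<^sub>1\<close>.\<close>
definition subst_pair ::
    "complex \<Rightarrow> complex \<Rightarrow> (int \<Rightarrow> int \<Rightarrow> int \<Rightarrow> 'w) \<Rightarrow> (int \<Rightarrow> int \<Rightarrow> int \<Rightarrow> 'w) \<Rightarrow> bool"
  where "subst_pair \<alpha> \<beta> u T \<longleftrightarrow> (\<exists>v. (\<forall>m. is_subst \<beta> (u m) (v m)) \<and>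
    (\<forall>k. is_subst \<alpha> (\<lambda>m l. v m k l) (\<lambda>j l. T j k l)))"

abbreviation double_subst ::
    "complex \<Rightarrow> complex \<Rightarrow> (int \<Rightarrow> int \<Rightarrow> int \<Rightarrow> 'w) \<Rightarrow> int \<Rightarrow> int \<Rightarrow> int \<Rightarrow> 'w"
  where "double_subst \<alpha> \<beta> u \<equiv> (\<lambda>j k l. subst \<alpha> (\<lambda>m l. subst \<beta> (u m) k l) j l)"

lemma act3_transpose:
  "act3 a b c a' b' c' f (\<lambda>m n. u n m) = (\<lambda>m n. act3 b a c b' a' c' f u n m)"
proof -
  have "module_hom sc3 sc3 (\<lambda>u m n. u n m)"
    by (simp add: module_hom_iff fun_eq_iff)
  then show ?thesis
    by (rule poly2_act_comm[symmetric]) (simp_all add: linform3_def add_ac)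
qed

lemma is_subst_act3_mid:
  assumes "\<And>k. is_subst \<alpha> (\<lambda>m l. u m k l) (\<lambda>j l. v j k l)"
  shows "is_subst \<alpha> (\<lambda>m l. act3 a b c a' b' c' f u m k l)
    (\<lambda>j l. act3 a b (a * \<alpha> + c) a' b' (a' * \<alpha> + c') f v j k l)"
  using is_subst_act3[of \<alpha> "\<lambda>k m. u m k" "\<lambda>k j. v j k", OF assms, where a = b and b = a and c = c and a' = b' and b' = a' and c' = c' and f = f and m = k]
  unfolding act3_transpose[where u = u] act3_transpose[where u = v] .

lemma is_subst_act3_last:
  assumes "\<And>l. is_subst \<gamma> (\<lambda>m n. u m n l) (\<lambda>i n. v i n l)"
  shows "is_subst \<gamma> (\<lambda>m n. act3 a b c a' b' c' f u m n l)
    (\<lambda>i n. act3 a (a * \<gamma> + b) c a' (a' * \<gamma> + b') c' f v i n l)"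
proof -
  have \<gamma>: "\<gamma> \<noteq> 0" using assms by (auto simp: is_subst_def)
  have slice: "(\<lambda>m n. lf3 a b c u m n l) = lf2 a b (\<lambda>m n. u m n l) + sc2 c (\<lambda>m n. u m n (l - 1))"
    for a b c l and u :: "int \<Rightarrow> int \<Rightarrow> int \<Rightarrow> 'w"
    by (simp add: fun_eq_iff linform2_def linform3_def add_ac)
  let ?R = "\<lambda>u v. \<forall>l. is_subst \<gamma> (\<lambda>m n. u m n l) (\<lambda>i n. v i n l)"
  have "?R (act3 a b c a' b' c' f u) (act3 a (a * \<gamma> + b) c a' (a' * \<gamma> + b') c' f v)"
  proof (rule poly2_act_rel[where R = ?R])
    show "?R u v" using assms by blast
    show "?R 0 0" using is_subst_0[OF \<gamma>] by (simp add: zero_fun_def)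
    show "?R (u + u') (v + v')" if "?R u v" "?R u' v'" for u v u' v'
      using is_subst_add[OF that(1)[rule_format] that(2)[rule_format]] by (simp add: plus_fun_def)
    show "?R (sc3 c u) (sc3 c v)" if "?R u v" for c u v
      using is_subst_scale[OF that[rule_format]] by (simp add: fun_scale_def)
    show "?R (lf3 a b c u) (lf3 a (a * \<gamma> + b) c v)" if "?R u v" for u v
      using that unfolding slice by (intro allI is_subst_add is_subst_scale is_subst_lf2) auto
    show "?R (lf3 a' b' c' u) (lf3 a' (a' * \<gamma> + b') c' v)" if "?R u v" for u v
      using that unfolding slice by (intro allI is_subst_add is_subst_scale is_subst_lf2) auto
  qed
  then show ?thesis by blast
qed

lemma subst_pair_act3:
  assumes "subst_pair \<alpha> \<beta> u T"
  shows "subst_pair \<alpha> \<beta> (act3 a b c a' b' c' f u)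
    (act3 a b (a * \<alpha> + (b * \<beta> + c)) a' b' (a' * \<alpha> + (b' * \<beta> + c')) f T)"
proof -
  from assms obtain v where v: "\<And>m. is_subst \<beta> (u m) (v m)"
      "\<And>k. is_subst \<alpha> (\<lambda>m l. v m k l) (\<lambda>j l. T j k l)"
    unfolding subst_pair_def by blast
  show ?thesis
    unfolding subst_pair_def
    by (intro exI conjI allI) (rule is_subst_act3[OF v(1)], rule is_subst_act3_mid[OF v(2)])
qed

text \<open>On \<open>W((y, z, x))\<close> the extended substitutions are given by the coefficient formula.\<close>
lemma subst_pair_eq:
  assumes "subst_pair \<alpha> \<beta> u T" and "lower_truncated3 u"
  shows "T = double_subst \<alpha> \<beta> u"
proof (intro ext)
  fix j k l
  from assms(1) obtain v where v: "\<And>m. is_subst \<beta> (u m) (v m)"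
      "\<And>k. is_subst \<alpha> (\<lambda>m l. v m k l) (\<lambda>j l. T j k l)"
    unfolding subst_pair_def by blast
  from assms(2) obtain N where N: "\<And>m n l. m < N \<or> n < N \<or> l < N \<Longrightarrow> u m n l = 0"
    unfolding lower_truncated3_def by blast
  have "lower_truncated2 (u m)" for m
    unfolding lower_truncated2_def using N by (intro exI[of _ N]) auto
  then have v_eq: "v m = subst \<beta> (u m)" for m
    by (rule is_subst_eq_subst[OF v(1)])
  have "u m = 0" if "m < N" for m using that N by (simp add: fun_eq_iff)
  then have "subst \<beta> (u m) k l = 0" if "m < N" for m l using that by simp
  moreover have "subst \<beta> (u m) k l = 0" if "l < 2 * N - k" for m l
    by (rule subst_low[of N]) (use N that in auto)
  ultimately have "lower_truncated2 (\<lambda>m l. subst \<beta> (u m) k l)"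
    unfolding lower_truncated2_def by (intro exI[of _ "min N (2 * N - k)"]) auto
  then have "(\<lambda>j l. T j k l) = subst \<alpha> (\<lambda>m l. subst \<beta> (u m) k l)"
    using is_subst_eq_subst[OF v(2)[of k]] unfolding v_eq by blast
  from fun_cong[OF this, of j] show "T j k l = double_subst \<alpha> \<beta> u j k l" by simp
qed

lemma double_subst_eq_sum:
  assumes N: "\<And>m n l. m < N \<or> n < N \<or> l < N \<Longrightarrow> u m n l = 0"
    and I: "finite I" "{N..l + j + k - 2 * N} \<subseteq> I"
  shows "double_subst \<alpha> \<beta> u j k l
    = (\<Sum>m\<in>I. \<Sum>n\<in>I. scale (subst_coeff \<alpha> m j * subst_coeff \<beta> n k) (u m n (l - m + j - n + k)))"
proof -
  have inner: "subst \<beta> (u m) k (l - m + j)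
      = (\<Sum>n\<in>I. scale (subst_coeff \<beta> n k) (u m n (l - m + j - n + k)))" if "m \<ge> N" for m
    by (rule subst_eq_sum[of N]) (use N I that in auto)
  have low: "u m = 0" if "m < N" for m using that N by (simp add: fun_eq_iff)
  have "double_subst \<alpha> \<beta> u j k l
      = (\<Sum>m\<in>I. scale (subst_coeff \<alpha> m j) (subst \<beta> (u m) k (l - m + j)))"
    unfolding subst_eq_Sum_any[of \<alpha>]
  proof (rule Sum_any.expand_superset[OF I(1)])
    show "{m. scale (subst_coeff \<alpha> m j) (subst \<beta> (u m) k (l - m + j)) \<noteq> 0} \<subseteq> I"
    proof
      fix m assume "m \<in> {m. scale (subst_coeff \<alpha> m j) (subst \<beta> (u m) k (l - m + j)) \<noteq> 0}"
      then have nz: "subst \<beta> (u m) k (l - m + j) \<noteq> 0" by auto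
      have "\<not> m < N" using nz low by auto
      moreover have "\<not> l - m + j + k < 2 * N"
        using nz subst_low[of N "u m" "l - m + j" k \<beta>] N by auto
      ultimately show "m \<in> I" using I(2) by auto
    qed
  qed
  also have "\<dots> = (\<Sum>m\<in>I. \<Sum>n\<in>I. scale (subst_coeff \<alpha> m j * subst_coeff \<beta> n k)
      (u m n (l - m + j - n + k)))"
  proof (rule sum.cong[OF refl])
    fix m
    show "scale (subst_coeff \<alpha> m j) (subst \<beta> (u m) k (l - m + j))
      = (\<Sum>n\<in>I. scale (subst_coeff \<alpha> m j * subst_coeff \<beta> n k) (u m n (l - m + j - n + k)))"
      by (cases "m < N") (simp_all add: low inner scale_sum_right)
  qed
  finally show ?thesis .
qed

text \<open>The substitutions for \<open>y\<close> and for \<open>z\<close> commute.\<close>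
lemma double_subst_commute:
  assumes "lower_truncated3 u"
  shows "double_subst \<beta> \<alpha> (\<lambda>n m. u m n) k j l = double_subst \<alpha> \<beta> u j k l"
proof -
  from assms obtain N where N: "\<And>m n l. m < N \<or> n < N \<or> l < N \<Longrightarrow> u m n l = 0"
    unfolding lower_truncated3_def by blast
  let ?I = "{N..l + j + k - 2 * N}"
  have "double_subst \<beta> \<alpha> (\<lambda>n m. u m n) k j l = (\<Sum>n\<in>?I. \<Sum>m\<in>?I.
      scale (subst_coeff \<beta> n k * subst_coeff \<alpha> m j) (u m n (l - n + k - m + j)))"
    by (rule double_subst_eq_sum) (use N in auto)
  also have "\<dots> = (\<Sum>m\<in>?I. \<Sum>n\<in>?I.
      scale (subst_coeff \<alpha> m j * subst_coeff \<beta> n k) (u m n (l - m + j - n + k)))"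
    by (subst sum.swap) (intro sum.cong refl, simp add: mult.commute algebra_simps)
  also have "\<dots> = double_subst \<alpha> \<beta> u j k l"
    by (rule double_subst_eq_sum[symmetric]) (use N in auto)
  finally show ?thesis .
qed

lemma subst_coeff_Vandermonde:
  assumes "\<beta> \<noteq> 0" "\<gamma> \<noteq> 0" and ik: "0 \<le> i" "0 \<le> k" and J: "finite J" "{i..i + k} \<subseteq> J"
  shows "(\<Sum>j\<in>J. subst_coeff \<gamma> j i * (subst_coeff (\<gamma> * \<beta>) m j * subst_coeff \<beta> n (k - j + i)))
    = subst_coeff \<gamma> m i * subst_coeff \<beta> (n + m - i) k"
proof -
  define i' k' where "i' = nat i" and "k' = nat k"
  have i: "i = int i'" and k: "k = int k'" using ik by (simp_all add: i'_def k'_def)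
  let ?F = "\<lambda>j. subst_coeff \<gamma> j i * (subst_coeff (\<gamma> * \<beta>) m j * subst_coeff \<beta> n (k - j + i))"
  have zero: "?F j = 0" if "j \<notin> {i..i + k}" for j
    using that subst_coeff_eq_0[of j i] by (cases "0 \<le> j \<and> j < i") (auto simp: subst_coeff_def)
  have "sum ?F J = sum ?F {i..i + k}"
    by (rule sum.mono_neutral_right) (use J zero in auto)
  also have "\<dots> = (\<Sum>q\<in>{0..k'}. ?F (i + int q))"
    by (rule sum.reindex_bij_witness[of _ "\<lambda>q. i + int q" "\<lambda>j. nat (j - i)"]) (auto simp: k)
  also have "\<dots> = (\<Sum>q\<in>{0..k'}. (of_int m gchoose i') * \<gamma> powi (m - i) * \<beta> powi (n + m - i - k)
      * ((of_int m - of_nat i' gchoose q) * (of_int n gchoose (k' - q))))"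
  proof (intro sum.cong refl)
    fix q assume q: "q \<in> {0..k'}"
    have nat: "nat (i + int q) = i' + q" "nat (k - (i + int q) + i) = k' - q"
      using q by (auto simp: i k)
    have e1: "(of_int m gchoose (i' + q)) * (of_int (i + int q) gchoose i')
        = (of_int m gchoose i') * (of_int m - of_nat i' gchoose q :: complex)"
      using gbinomial_trinomial_revision[of i' "i' + q" "of_int m :: complex"] by (simp add: i)
    have e2: "\<gamma> powi (i + int q - i) * ((\<gamma> * \<beta>) powi (m - (i + int q)) * \<beta> powi (n - (k - (i + int q) + i)))
        = \<gamma> powi (m - i) * \<beta> powi (n + m - i - k)"
    proof -
      have "\<gamma> powi (i + int q - i) * \<gamma> powi (m - (i + int q)) = \<gamma> powi (m - i)"
        using assms(2) by (subst power_int_add[symmetric]) (auto intro!: arg_cong[of _ _ "(powi) \<gamma>"])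
      moreover have "\<beta> powi (m - (i + int q)) * \<beta> powi (n - (k - (i + int q) + i)) = \<beta> powi (n + m - i - k)"
        using assms(1) by (subst power_int_add[symmetric]) (auto intro!: arg_cong[of _ _ "(powi) \<beta>"])
      moreover have "\<gamma> powi (i + int q - i) * ((\<gamma> * \<beta>) powi (m - (i + int q)) * \<beta> powi (n - (k - (i + int q) + i)))
          = (\<gamma> powi (i + int q - i) * \<gamma> powi (m - (i + int q)))
            * (\<beta> powi (m - (i + int q)) * \<beta> powi (n - (k - (i + int q) + i)))"
        by (simp only: power_int_mult_distrib mult_ac)
      ultimately show ?thesis by simp
    qed
    have e3: "?F (i + int q) = ((of_int m gchoose (i' + q)) * (of_int (i + int q) gchoose i'))
        * (of_int n gchoose (k' - q)) * (\<gamma> powi (i + int q - i) * ((\<gamma> * \<beta>) powi (m - (i + int q))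
          * \<beta> powi (n - (k - (i + int q) + i))))"
      using q ik by (simp only: subst_coeff_def nat) (simp add: i'_def[symmetric] k)
    show "?F (i + int q) = (of_int m gchoose i') * \<gamma> powi (m - i) * \<beta> powi (n + m - i - k)
      * ((of_int m - of_nat i' gchoose q) * (of_int n gchoose (k' - q)))"
      unfolding e3 e1 e2 by (simp only: mult_ac)
  qed
  also have "\<dots> = (of_int m gchoose i') * \<gamma> powi (m - i) * \<beta> powi (n + m - i - k)
      * (of_int (n + m - i) gchoose k')"
  proof -
    have "of_int m - of_nat i' + of_int n = (of_int (n + m - i) :: complex)" by (simp add: i)
    then show ?thesis unfolding sum_distrib_left[symmetric] gbinomial_Vandermonde by (simp only:)
  qed
  also have "\<dots> = subst_coeff \<gamma> m i * subst_coeff \<beta> (n + m - i) k"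
    by (simp add: subst_coeff_def i k)
  finally show ?thesis .
qed

text \<open>Setting \<open>y = \<gamma> z + x\<^sub>0\<close> and then \<open>z = \<beta> x + x\<^sub>2\<close> amounts to setting \<open>y = \<gamma> \<beta> x + x\<^sub>1\<close>,
  \<open>z = \<beta> x + x\<^sub>2\<close> and then \<open>x\<^sub>1 = \<gamma> x\<^sub>2 + x\<^sub>0\<close>.\<close>
lemma iterated_subst:
  assumes u: "lower_truncated3 u" and nz: "\<beta> \<noteq> 0" "\<gamma> \<noteq> 0"
  shows "subst \<beta> (\<lambda>n l. subst \<gamma> (\<lambda>m n. u m n l) i n) k l
    = subst \<gamma> (\<lambda>j k. double_subst (\<gamma> * \<beta>) \<beta> u j k l) i k"
proof (cases "0 \<le> i \<and> 0 \<le> k")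
  case False
  then consider "i < 0" | "k < 0" "i \<ge> 0" by linarith
  then show ?thesis
  proof cases
    case 1
    then show ?thesis by (simp add: subst_neg)
  next
    case 2
    have "scale (subst_coeff \<gamma> j i) (double_subst (\<gamma> * \<beta>) \<beta> u j (k - j + i) l) = 0" for j
      using 2 subst_coeff_eq_0[of j i] by (cases "j < i"; cases "j < 0") (simp_all add: subst_neg)
    then show ?thesis
      unfolding subst_eq_Sum_any[of \<gamma> _ i k] by (simp only: Sum_any.neutral subst_neg[OF 2(1)])
  qed
next
  case True
  from u obtain N where N: "\<And>m n l. m < N \<or> n < N \<or> l < N \<Longrightarrow> u m n l = 0"
    unfolding lower_truncated3_def by blast
  define M where "M = l + i + k - 2 * N"
  let ?I = "{N..M}" let ?J = "{i..i + k}"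
  let ?K = "{2 * N - i..M + M - i + \<bar>N\<bar> + \<bar>M\<bar>}"
  have sum_coeff: "(\<Sum>m\<in>?I. \<Sum>n\<in>?I. scale (subst_coeff \<gamma> m i * subst_coeff \<beta> (n + m - i) k)
      (u m n (l - m - n + k + i))) = subst \<gamma> (\<lambda>j k. double_subst (\<gamma> * \<beta>) \<beta> u j k l) i k"
  proof -
    have "subst \<gamma> (\<lambda>j k. double_subst (\<gamma> * \<beta>) \<beta> u j k l) i k
        = (\<Sum>j\<in>?J. scale (subst_coeff \<gamma> j i) (double_subst (\<gamma> * \<beta>) \<beta> u j (k - j + i) l))"
      unfolding subst_eq_Sum_any[of \<gamma>]
    proof (rule Sum_any.expand_superset, simp, rule subsetI)
      fix j assume "j \<in> {j. scale (subst_coeff \<gamma> j i) (double_subst (\<gamma> * \<beta>) \<beta> u j (k - j + i) l) \<noteq> 0}"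
      then have nz: "subst_coeff \<gamma> j i \<noteq> 0" "double_subst (\<gamma> * \<beta>) \<beta> u j (k - j + i) l \<noteq> 0" by auto
      have "\<not> j < 0" "\<not> k - j + i < 0" using nz(2) by (auto simp: subst_neg)
      moreover from this have "\<not> j < i" using nz(1) subst_coeff_eq_0[of j i] by auto
      ultimately show "j \<in> ?J" by auto
    qed
    also have "\<dots> = (\<Sum>j\<in>?J. \<Sum>m\<in>?I. \<Sum>n\<in>?I. scale (subst_coeff \<gamma> j i *
        (subst_coeff (\<gamma> * \<beta>) m j * subst_coeff \<beta> n (k - j + i))) (u m n (l - m - n + k + i)))"
    proof (intro sum.cong refl)
      fix j
      have "double_subst (\<gamma> * \<beta>) \<beta> u j (k - j + i) l = (\<Sum>m\<in>?I. \<Sum>n\<in>?I.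
          scale (subst_coeff (\<gamma> * \<beta>) m j * subst_coeff \<beta> n (k - j + i))
            (u m n (l - m + j - n + (k - j + i))))"
        by (rule double_subst_eq_sum) (use N in \<open>auto simp: M_def\<close>)
      moreover have "l - m + j - n + (k - j + i) = l - m - n + k + i" for m n by simp
      ultimately show "scale (subst_coeff \<gamma> j i) (double_subst (\<gamma> * \<beta>) \<beta> u j (k - j + i) l)
        = (\<Sum>m\<in>?I. \<Sum>n\<in>?I. scale (subst_coeff \<gamma> j i *
        (subst_coeff (\<gamma> * \<beta>) m j * subst_coeff \<beta> n (k - j + i))) (u m n (l - m - n + k + i)))"
        by (simp only: scale_sum_right scale_scale)
    qed
    also have "\<dots> = (\<Sum>m\<in>?I. \<Sum>j\<in>?J. \<Sum>n\<in>?I. scale (subst_coeff \<gamma> j i *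
        (subst_coeff (\<gamma> * \<beta>) m j * subst_coeff \<beta> n (k - j + i))) (u m n (l - m - n + k + i)))"
      by (rule sum.swap)
    also have "\<dots> = (\<Sum>m\<in>?I. \<Sum>n\<in>?I. \<Sum>j\<in>?J. scale (subst_coeff \<gamma> j i *
        (subst_coeff (\<gamma> * \<beta>) m j * subst_coeff \<beta> n (k - j + i))) (u m n (l - m - n + k + i)))"
      by (intro sum.cong[OF refl] sum.swap)
    also have "\<dots> = (\<Sum>m\<in>?I. \<Sum>n\<in>?I. scale (subst_coeff \<gamma> m i * subst_coeff \<beta> (n + m - i) k)
      (u m n (l - m - n + k + i)))"
      unfolding scale_sum_left[symmetric]
      by (intro sum.cong refl) (subst subst_coeff_Vandermonde, use nz True in auto)
    finally show ?thesis by simp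
  qed
  have "subst \<beta> (\<lambda>n l. subst \<gamma> (\<lambda>m n. u m n l) i n) k l
      = (\<Sum>n\<in>?K. scale (subst_coeff \<beta> n k) (subst \<gamma> (\<lambda>m n'. u m n' (l - n + k)) i n))"
    unfolding subst_eq_Sum_any[of \<beta>]
  proof (rule Sum_any.expand_superset, simp, rule subsetI)
    fix n assume "n \<in> {n. scale (subst_coeff \<beta> n k) (subst \<gamma> (\<lambda>m n'. u m n' (l - n + k)) i n) \<noteq> 0}"
    then have nz: "subst \<gamma> (\<lambda>m n'. u m n' (l - n + k)) i n \<noteq> 0" by auto
    have "\<not> n + i < 2 * N"
    proof
      assume "n + i < 2 * N"
      then have "subst \<gamma> (\<lambda>m n'. u m n' (l - n + k)) i n = 0"
        using N by (intro subst_low[of N]) auto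
      with nz show False by simp
    qed
    moreover have "\<not> l - n + k < N"
    proof
      assume "l - n + k < N"
      then have "(\<lambda>m n'. u m n' (l - n + k)) = (\<lambda>m n'. 0)" using N by (simp add: fun_eq_iff)
      with nz show False by simp
    qed
    ultimately show "n \<in> ?K" by (auto simp: M_def)
  qed
  also have "\<dots> = (\<Sum>n\<in>?K. \<Sum>m\<in>?I. scale (subst_coeff \<gamma> m i * subst_coeff \<beta> n k)
      (u m (n - m + i) (l - n + k)))"
  proof (intro sum.cong refl)
    fix n
    show "scale (subst_coeff \<beta> n k) (subst \<gamma> (\<lambda>m n'. u m n' (l - n + k)) i n)
      = (\<Sum>m\<in>?I. scale (subst_coeff \<gamma> m i * subst_coeff \<beta> n k) (u m (n - m + i) (l - n + k)))"
    proof (cases "l - n + k < N")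
      case True
      then have "(\<lambda>m n'. u m n' (l - n + k)) = (\<lambda>m n'. 0)" using N by (simp add: fun_eq_iff)
      moreover have "u m (n - m + i) (l - n + k) = 0" for m using N True by simp
      ultimately show ?thesis by simp
    next
      case False
      then have "subst \<gamma> (\<lambda>m n'. u m n' (l - n + k)) i n
          = (\<Sum>m\<in>?I. scale (subst_coeff \<gamma> m i) (u m (n - m + i) (l - n + k)))"
        by (intro subst_eq_sum[of N]) (use N in \<open>auto simp: M_def\<close>)
      then show ?thesis by (simp add: scale_sum_right mult.commute)
    qed
  qed
  also have "\<dots> = (\<Sum>m\<in>?I. \<Sum>n\<in>?K. scale (subst_coeff \<gamma> m i * subst_coeff \<beta> n k)
      (u m (n - m + i) (l - n + k)))"
    by (rule sum.swap)
  also have "\<dots> = (\<Sum>m\<in>?I. \<Sum>n\<in>?I. scale (subst_coeff \<gamma> m i * subst_coeff \<beta> (n + m - i) k)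
      (u m n (l - m - n + k + i)))"
  proof (rule sum.cong[OF refl])
    fix m assume m: "m \<in> ?I"
    have "(\<Sum>n\<in>?I. scale (subst_coeff \<gamma> m i * subst_coeff \<beta> (n + m - i) k) (u m n (l - m - n + k + i)))
      = (\<Sum>n\<in>{N + m - i..M + m - i}. scale (subst_coeff \<gamma> m i * subst_coeff \<beta> n k)
          (u m (n - m + i) (l - n + k)))"
      by (rule sum.reindex_bij_witness[of _ "\<lambda>n. n - m + i" "\<lambda>n. n + m - i"]) (auto simp: algebra_simps)
    also have "\<dots> = (\<Sum>n\<in>?K. scale (subst_coeff \<gamma> m i * subst_coeff \<beta> n k)
          (u m (n - m + i) (l - n + k)))"
    proof (rule sum.mono_neutral_left)
      show "{N + m - i..M + m - i} \<subseteq> ?K" using m by auto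
      show "\<forall>n\<in>?K - {N + m - i..M + m - i}. scale (subst_coeff \<gamma> m i * subst_coeff \<beta> n k)
          (u m (n - m + i) (l - n + k)) = 0"
      proof
        fix n assume "n \<in> ?K - {N + m - i..M + m - i}"
        then have "n - m + i < N \<or> l - n + k < N" using m by (auto simp: M_def)
        then have "u m (n - m + i) (l - n + k) = 0" using N by blast
        then show "scale (subst_coeff \<gamma> m i * subst_coeff \<beta> n k) (u m (n - m + i) (l - n + k)) = 0" by simp
      qed
    qed simp
    finally show "(\<Sum>n\<in>?K. scale (subst_coeff \<gamma> m i * subst_coeff \<beta> n k) (u m (n - m + i) (l - n + k)))
      = (\<Sum>n\<in>?I. scale (subst_coeff \<gamma> m i * subst_coeff \<beta> (n + m - i) k) (u m n (l - m - n + k + i)))"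
      by simp
  qed
  finally show ?thesis using sum_coeff by simp
qed

end

section \<open>Weak commutativity and weak associativity\<close>

lemma funpow_comm:
  assumes "\<And>u. X (F u) = F (X u)" shows "(X ^^ n) (F u) = F ((X ^^ n) u)"
  by (induction n) (simp_all add: assms)

context commuting_pair
begin

lemma poly2_act_power:
  "poly2_act s A B (q ^ n * r) u = (poly2_act s A B q ^^ n) (poly2_act s A B r u)"
  by (induction n) (simp_all add: mult.assoc mult2)

text \<open>Dividing \<open>g(A + \<alpha> B, B)\<close> by the highest possible power of \<open>A\<close>.\<close>
lemma poly2_act_split_outer:
  assumes "g \<noteq> 0" and C: "\<And>u. C u = A u + s \<alpha> (B u)"
  obtains n g1 where "coeff g1 0 \<noteq> 0"
    and "\<And>u. poly2_act s C B g u = (A ^^ n) (poly2_act s A B g1 u)"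
proof -
  let ?r = "[:[:0, \<alpha>:], 1:]"
  let ?g = "pcompose g ?r"
  have B: "module_hom s s B" by unfold_locales
  have zero: "poly_act s B 0 u = 0" "poly2_act s A B 0 u = 0" for u
    by (simp_all add: poly_act_0[OF A.m1.module_axioms] module.scale_zero_left[OF module2])
  have r: "poly_act (poly_act s B) A ?r = C"
  proof
    fix u
    have "poly2_act s A B ?r u = C u"
      by (simp add: pCons2 zero poly_act_pCons[OF B] one_pCons C B.scale add_ac)
    then show "poly_act (poly_act s B) A ?r u = C u" by (simp add: poly2_act_def)
  qed
  have g: "poly2_act s C B g u = poly2_act s A B ?g u" for u
    unfolding poly2_act_def poly_act_pcompose[OF hom_outer] r ..
  have "?g \<noteq> 0" using assms(1) pcompose_eq_0[of g ?r] by auto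
  from order_decomp[OF this, of 0] obtain g1
    where g1: "?g = [:- 0, 1:] ^ order 0 ?g * g1" "\<not> [:- 0, 1:] dvd g1"
    by blast
  have "poly g1 0 \<noteq> 0" using g1(2) unfolding poly_eq_0_iff_dvd .
  then have "coeff g1 0 \<noteq> 0" by (simp add: poly_0_coeff_0)
  moreover have "poly2_act s A B [:- 0, 1:] = A"
    by (rule ext) (simp add: pCons2 zero poly_act_pCons[OF B] one_pCons)
  then have "poly2_act s C B g u = (A ^^ order 0 ?g) (poly2_act s A B g1 u)" for u
    unfolding g by (subst g1(1)) (simp only: poly2_act_power)
  ultimately show ?thesis by (rule that)
qed

end

text \<open>Dividing \<open>f(y, z)\<close> by the highest possible power of \<open>y - c z\<close>.\<close>
lemma split_linear_factor:
  fixes f :: "complex poly poly"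
  assumes "f \<noteq> 0"
  obtains n f1 where "f = [:- [:0, c:], 1:] ^ n * f1" "poly f1 [:0, c:] \<noteq> 0"
  using order_decomp[OF assms, of "[:0, c:]"] that unfolding poly_eq_0_iff_dvd by blast

text \<open>Suppose that \<open>D\<close> vanishes at each point of the down-closed set \<open>B\<close> below which it vanishes.  Then it
  vanishes on \<open>B\<close>: in either order of the variables, iterated truncation provides a minimal point of
  the support in \<open>B\<close>.\<close>
lemma minimal_support_vanish:
  fixes D :: "int \<Rightarrow> int \<Rightarrow> 'v::zero"
  assumes trunc: "iterated2 D \<or> iterated2 (\<lambda>k j. D j k)"
    and closed: "\<And>j k j' k'. B j k \<Longrightarrow> j' \<le> j \<Longrightarrow> k' \<le> k \<Longrightarrow> B j' k'"
    and step: "\<And>j k. B j k \<Longrightarrow>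
      (\<And>j' k'. j' \<le> j \<Longrightarrow> k' \<le> k \<Longrightarrow> (j', k') \<noteq> (j, k) \<Longrightarrow> D j' k' = 0) \<Longrightarrow> D j k = 0"
    and "B j k"
  shows "D j k = 0"
proof -
  have main: "D k j = 0"
    if D: "iterated2 D" and closed: "\<And>j k j' k'. B k j \<Longrightarrow> j' \<le> j \<Longrightarrow> k' \<le> k \<Longrightarrow> B k' j'"
      and step: "\<And>j k. B k j \<Longrightarrow>
        (\<And>j' k'. j' \<le> j \<Longrightarrow> k' \<le> k \<Longrightarrow> (j', k') \<noteq> (j, k) \<Longrightarrow> D k' j' = 0) \<Longrightarrow> D k j = 0"
      and "B k j" for D :: "int \<Rightarrow> int \<Rightarrow> 'v" and B j k
  proof (rule ccontr)
    assume nz: "D k j \<noteq> 0"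
    define E where "E = (\<lambda>k j. if B k j then D k j else 0)"
    have E: "iterated2 E"
      by (rule iterated2_comb[OF D D]) (simp add: E_def)
    have "E \<noteq> 0" using nz \<open>B k j\<close> by (auto simp: E_def fun_eq_iff)
    with E obtain k0 where k0: "E k0 \<noteq> 0" "\<And>k. k < k0 \<Longrightarrow> E k = 0"
      using lower_truncated_least[of E] unfolding iterated2_def by blast
    with E obtain j0 where j0: "E k0 j0 \<noteq> 0" "\<And>j. j < j0 \<Longrightarrow> E k0 j = 0"
      using lower_truncated_least[of "E k0"] unfolding iterated2_def by blast
    from j0(1) have B: "B k0 j0" by (auto simp: E_def split: if_splits)
    have "D k0 j0 = 0"
    proof (rule step[OF B])
      fix j' k' assume *: "j' \<le> j0" "k' \<le> k0" "(j', k') \<noteq> (j0, k0)"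
      then have "E k' j' = 0" using k0(2)[of k'] j0(2)[of j'] by (cases "k' = k0") auto
      moreover have "B k' j'" using closed[OF B] * by blast
      ultimately show "D k' j' = 0" by (simp add: E_def)
    qed
    with j0(1) B show False by (simp add: E_def)
  qed
  from trunc show ?thesis
  proof
    assume "iterated2 D"
    then show ?thesis
      by (rule main[of D B]) (use closed step assms(4) in blast)+
  next
    assume "iterated2 (\<lambda>k j. D j k)"
    then show ?thesis
      by (rule main[of "\<lambda>k j. D j k" "\<lambda>k j. B j k"]) (use closed step assms(4) in blast)+
  qed
qed

context complex_space
begin

lemma hom_lf1: "module_hom sc1 sc1 (lf1 c)"
  by (simp add: module_hom_iff fun_eq_iff scale_right_distrib mult.commute)

lemma pair1: "commuting_pair sc1 (lf1 c) (lf1 d)"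
  by (intro commuting_pairI hom_lf1) (simp add: mult.commute)

lemma lower_truncated_lf1: "lower_truncated t \<Longrightarrow> lower_truncated (lf1 c t)"
  by (rule lower_truncated_comb[of "\<lambda>l. t (l - 1)" "\<lambda>l. t (l - 1)"]; (rule lower_truncated_shift)?) auto

lemma lower_truncated_act1:
  assumes "lower_truncated t" shows "lower_truncated (poly2_act sc1 (lf1 c) (lf1 d) f t)"
proof (rule poly2_act_invariant[where P = lower_truncated])
  show "lower_truncated (u + v)" if "lower_truncated u" "lower_truncated v" for u v :: "int \<Rightarrow> 'w"
    by (rule lower_truncated_comb[OF that]) simp
  show "lower_truncated (sc1 c u)" if "lower_truncated u" for c u
    by (rule lower_truncated_comb[OF that that]) simp
qed (use assms lower_truncated_lf1 in auto)

text \<open>Multiplication by a nonzero polynomial is injective on \<open>W((x))\<close>.\<close>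
lemma act1_injective:
  assumes p: "p \<noteq> 0" and t: "lower_truncated t" and zero: "poly_act sc1 (lf1 1) p t = 0"
  shows "t = 0"
proof -
  let ?C = "\<lambda>t (m::int) (n::int). if m = 0 then t n else (0 :: 'w)"
  have "module_hom sc1 sc2 ?C"
    by (auto simp: module_hom_def module_hom_axioms_def fun_eq_iff)
  then have "?C (poly_act sc1 (lf1 1) p t) = poly_act sc2 (lf2 0 1) p (?C t)"
    by (rule poly_act_comm) (auto simp: linform2_def fun_eq_iff)
  moreover have "act [:p:] (?C t) = poly_act sc2 (lf2 0 1) p (?C t)"
    using commuting_pair.pCons2[OF pair2, of 1 0 0 1 p 0]
    by (simp add: module.scale_zero_left[OF commuting_pair.module2[OF pair2]] module_hom.zero[OF hom_lf2])
  ultimately have "act [:p:] (?C t) = ?C (poly_act sc1 (lf1 1) p t)" by (simp only:)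
  then have "act [:p:] (?C t) = 0" unfolding zero by (simp add: fun_eq_iff)
  moreover have "iterated2 (?C t)"
    using t unfolding iterated2_def by (auto simp: lower_truncated_def fun_eq_iff intro!: exI[of _ 0])
  ultimately have "?C t = 0" using act_injective[of "[:p:]"] p by simp
  then have "t n = 0" for n using fun_cong[OF fun_cong[of "?C t" 0 0], of n] by simp
  then show ?thesis by (simp add: fun_eq_iff)
qed

lemma act1_outer_zero:
  "poly2_act sc1 (lf1 0) (lf1 1) g t = poly_act sc1 (lf1 1) (coeff g 0) t"
  by (cases g) (simp only: commuting_pair.pCons2[OF pair1] coeff_pCons_0, simp add: fun_eq_iff)

text \<open>If \<open>e(z) = f(\<gamma> z, z)\<close> is not zero, then \<open>f(\<gamma> \<beta> x, \<beta> x) = e(\<beta> x)\<close> acts injectively on \<open>W((x))\<close>, and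
  \<open>f(\<gamma> (\<beta> x + x\<^sub>2), \<beta> x + x\<^sub>2) = e(\<beta> x + x\<^sub>2)\<close> acts injectively on \<open>W((x))((x\<^sub>2))\<close>.\<close>
lemma act1_diagonal_injective:
  assumes e: "poly f [:0, \<gamma>:] \<noteq> 0" and \<beta>: "\<beta> \<noteq> 0" and t: "lower_truncated t"
    and zero: "poly2_act sc1 (lf1 (\<gamma> * \<beta>)) (lf1 \<beta>) f t = 0"
  shows "t = 0"
proof -
  have inner: "poly_act sc1 (lf1 c) [:0, d:] = lf1 (d * c)" for c d
    by (rule ext) (simp add: poly_act_pCons[OF hom_lf1] poly_act_0 fun_eq_iff mult.commute)
  have "poly2_act sc1 (lf1 (\<gamma> * \<beta>)) (lf1 \<beta>) f t = poly_act sc1 (lf1 \<beta>) (poly f [:0, \<gamma>:]) t"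
    unfolding poly2_act_def inner[symmetric] by (rule poly_act_poly[OF hom_lf1])
  also have "\<dots> = poly_act sc1 (lf1 1) (pcompose (poly f [:0, \<gamma>:]) [:0, \<beta>:]) t"
    unfolding poly_act_pcompose[OF hom_lf1] inner by simp
  finally have "poly_act sc1 (lf1 1) (pcompose (poly f [:0, \<gamma>:]) [:0, \<beta>:]) t = 0" using zero by simp
  moreover have "pcompose (poly f [:0, \<gamma>:]) [:0, \<beta>:] \<noteq> 0"
    using pcompose_eq_0[of "poly f [:0, \<gamma>:]" "[:0, \<beta>:]"] e \<beta> by auto
  ultimately show ?thesis using act1_injective t by blast
qed

lemma act2_diagonal_injective:
  assumes e: "poly f [:0, \<gamma>:] \<noteq> 0" and y: "iterated2 y"
    and zero: "poly2_act sc2 (lf2 \<gamma> (\<gamma> * \<beta>)) (lf2 1 \<beta>) f y = 0"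
  shows "y = 0"
proof -
  let ?B = "lf2 1 \<beta>" let ?e = "poly f [:0, \<gamma>:]"
  have inner: "poly_act sc2 ?B [:0, \<gamma>:] = lf2 \<gamma> (\<gamma> * \<beta>)"
    by (rule ext) (simp add: poly_act_pCons[OF hom_lf2] poly_act_0 fun_eq_iff linform_simps)
  have "poly2_act sc2 (lf2 \<gamma> (\<gamma> * \<beta>)) ?B f y = poly_act sc2 ?B ?e y"
    unfolding poly2_act_def inner[symmetric] by (rule poly_act_poly[OF hom_lf2])
  moreover have "poly2_act sc2 ?B (lf2 0 1) (map_poly (\<lambda>c. [:c:]) p) u = poly_act sc2 ?B p u" for p u
  proof (induction p)
    case 0
    show ?case
      unfolding map_poly_0 module.scale_zero_left[OF commuting_pair.module2[OF pair2]]
        poly_act_0[OF module_sc(3)] ..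
  next
    case (pCons c p)
    have "poly_act sc2 (lf2 0 1) [:c:] u = sc2 c u"
      by (simp add: poly_act_def)
    then show ?case
      using pCons.hyps
      by (simp only: map_poly_pCons[where f = "\<lambda>c. [:c:]", OF pCons_0_0] pCons.IH
          commuting_pair.pCons2[OF pair2] poly_act_pCons[OF hom_lf2])
  qed
  ultimately have "poly2_act sc2 ?B (lf2 0 1) (map_poly (\<lambda>c. [:c:]) ?e) y = 0" using zero by simp
  moreover have "map_poly (\<lambda>c. [:c:]) ?e \<noteq> 0"
  proof
    assume "map_poly (\<lambda>c. [:c:]) ?e = 0"
    then have "coeff (map_poly (\<lambda>c. [:c:]) ?e) (degree ?e) = 0" by simp
    with e show False by (simp add: coeff_map_poly)
  qed
  ultimately show ?thesis using shifted_act_injective[OF _ y, of _ 1] by simp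
qed

text \<open>Where the series \<open>V\<close> has no lower terms, multiplication by a polynomial in two linear forms amounts to
  setting \<open>x\<^sub>1 = x\<^sub>2 = 0\<close> in these forms.\<close>
lemma act3_leading:
  assumes "\<And>j' k'. j' \<le> j \<Longrightarrow> k' \<le> k \<Longrightarrow> (j', k') \<noteq> (j, k) \<Longrightarrow> V j' k' = 0"
  shows "act3 a b c a' b' c' f V j k = poly2_act sc1 (lf1 c) (lf1 c') f (V j k)"
    and "\<And>j' k'. j' \<le> j \<Longrightarrow> k' \<le> k \<Longrightarrow> (j', k') \<noteq> (j, k) \<Longrightarrow> act3 a b c a' b' c' f V j' k' = 0"
proof -
  let ?R = "\<lambda>V t. V j k = t \<and> (\<forall>j' k'. j' \<le> j \<longrightarrow> k' \<le> k \<longrightarrow> (j', k') \<noteq> (j, k) \<longrightarrow> V j' k' = 0)"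
  have "?R (act3 a b c a' b' c' f V) (poly2_act sc1 (lf1 c) (lf1 c') f (V j k))"
    by (rule poly2_act_rel[where R = ?R]) (use assms in \<open>auto simp: linform3_def fun_eq_iff\<close>)
  then show "act3 a b c a' b' c' f V j k = poly2_act sc1 (lf1 c) (lf1 c') f (V j k)"
    and "\<And>j' k'. j' \<le> j \<Longrightarrow> k' \<le> k \<Longrightarrow> (j', k') \<noteq> (j, k) \<Longrightarrow> act3 a b c a' b' c' f V j' k' = 0"
    by blast+
qed

text \<open>Injectivity may be checked after setting the outermost variable to zero in the linear forms.\<close>
lemma act3_injective:
  assumes inj: "\<And>y. iterated2 y \<Longrightarrow> poly2_act sc2 (lf2 b c) (lf2 b' c') f y = 0 \<Longrightarrow> y = 0"
    and W: "iterated3 W" and zero: "act3 a b c a' b' c' f W = 0"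
  shows "W = 0"
proof (rule ccontr)
  assume "W \<noteq> 0"
  then obtain i where i: "W i \<noteq> 0" "\<And>j. j < i \<Longrightarrow> W j = 0"
    using W lower_truncated_least[of W] unfolding iterated3_def by blast
  let ?R = "\<lambda>V y. V i = y \<and> (\<forall>j<i. V j = 0)"
  have "?R (act3 a b c a' b' c' f W) (poly2_act sc2 (lf2 b c) (lf2 b' c') f (W i))"
    by (rule poly2_act_rel[where R = ?R]) (use i in \<open>auto simp: linform3_def linform2_def fun_eq_iff\<close>)
  then have "poly2_act sc2 (lf2 b c) (lf2 b' c') f (W i) = 0" by (simp add: zero)
  with inj W i(1) show False unfolding iterated3_def by blast
qed

lemma iterated3_act3: "iterated3 u \<Longrightarrow> iterated3 (act3 a b c a' b' c' f u)"
  by (rule poly2_act_invariant[where P = iterated3])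
    (auto intro: iterated3_lf3 iterated3_add iterated3_scale)

lemma iterated3_funpow: "iterated3 u \<Longrightarrow> iterated3 ((lf3 a b c ^^ n) u)"
  by (induction n) (simp_all add: iterated3_lf3)

lemma subst_pair_act3_transpose:
  assumes "subst_pair \<beta> \<alpha> (\<lambda>n m. u m n) (\<lambda>k j. T j k)"
  shows "subst_pair \<beta> \<alpha> (\<lambda>n m. act3 a b c a' b' c' f u m n)
    (\<lambda>k j. act3 a b (a * \<alpha> + (b * \<beta> + c)) a' b' (a' * \<alpha> + (b' * \<beta> + c')) f T j k)"
  using subst_pair_act3[OF assms, of b a c b' a' c' f]
  unfolding act3_transpose[where u = u] act3_transpose[where u = T] add.left_commute[of "_ * \<beta>"] .

text \<open>The substitution \<open>x\<^sub>1 = \<gamma> x\<^sub>2 + x\<^sub>0\<close> and polynomials in linear forms.\<close>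
lemma subst_act3:
  assumes low: "\<And>j k. j < N \<or> k < N \<Longrightarrow> V j k = 0" and \<gamma>: "\<gamma> \<noteq> 0"
  shows "(\<lambda>i k l. subst \<gamma> (\<lambda>j k. act3 a b c a' b' c' f V j k l) i k)
    = act3 a (a * \<gamma> + b) c a' (a' * \<gamma> + b') c' f (\<lambda>i k l. subst \<gamma> (\<lambda>j k. V j k l) i k)"
proof -
  have slice: "(\<lambda>j k. lf3 a b c u j k l) = lf2 a b (\<lambda>j k. u j k l) + sc2 c (\<lambda>j k. u j k (l - 1))"
    for a b c l and u :: "int \<Rightarrow> int \<Rightarrow> int \<Rightarrow> 'w"
    by (simp add: fun_eq_iff linform2_def linform3_def add_ac)
  let ?L = "\<lambda>V. \<forall>l. lower_truncated2 (\<lambda>j k. V j k l :: 'w)"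
  let ?S = "\<lambda>V i k l. subst \<gamma> (\<lambda>j k. V j k l) i k"
  let ?R = "\<lambda>V V'. ?L V \<and> ?S V = V'"
  have lf3: "?R (lf3 a b c u) (lf3 a (a * \<gamma> + b) c (?S u))" if u: "?L u" for a b c u
  proof
    show "?L (lf3 a b c u)"
      unfolding slice using u
      by (intro allI lower_truncated2_add lower_truncated2_lf2 lower_truncated2_scale) auto
    have "subst \<gamma> (\<lambda>j k. lf3 a b c u j k l) = lf2 a (a * \<gamma> + b) (subst \<gamma> (\<lambda>j k. u j k l))
        + sc2 c (subst \<gamma> (\<lambda>j k. u j k (l - 1)))" for l
      unfolding slice using u
      by (subst subst_add) (auto intro!: lower_truncated2_lf2 lower_truncated2_scale
          simp: subst_lf2[OF _ \<gamma>] subst_scale)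
    then show "?S (lf3 a b c u) = lf3 a (a * \<gamma> + b) c (?S u)"
      by (simp add: fun_eq_iff linform2_def linform3_def add_ac)
  qed
  have "?R (act3 a b c a' b' c' f V) (act3 a (a * \<gamma> + b) c a' (a' * \<gamma> + b') c' f (?S V))"
  proof (rule poly2_act_rel[where R = ?R])
    show "?R V (?S V)"
      unfolding lower_truncated2_def using low by (auto intro!: exI[of _ N])
    show "?R 0 0" by (simp add: zero_fun_def)
    show "?R (u + u') (v + v')" if "?R u v" "?R u' v'" for u v u' v'
    proof
      show "?L (u + u')" using that lower_truncated2_add by (auto simp: plus_fun_def)
      have "subst \<gamma> (\<lambda>j k. (u + u') j k l) = subst \<gamma> (\<lambda>j k. u j k l) + subst \<gamma> (\<lambda>j k. u' j k l)" for l
        using subst_add[of "\<lambda>j k. u j k l" "\<lambda>j k. u' j k l"] that by (simp add: plus_fun_def)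
      then show "?S (u + u') = v + v'" using that by (auto simp: fun_eq_iff)
    qed
    show "?R (sc3 c u) (sc3 c v)" if "?R u v" for c u v
    proof
      show "?L (sc3 c u)" using that lower_truncated2_scale by (auto simp: fun_scale_def)
      have "subst \<gamma> (\<lambda>j k. sc3 c u j k l) = sc2 c (subst \<gamma> (\<lambda>j k. u j k l))" for l
        using subst_scale[of "\<lambda>j k. u j k l"] that by (simp add: fun_scale_def)
      then show "?S (sc3 c u) = sc3 c v" using that by (auto simp: fun_eq_iff)
    qed
    show "?R (lf3 a b c u) (lf3 a (a * \<gamma> + b) c v)" if "?R u v" for u v
      using lf3[of u] that by blast
    show "?R (lf3 a' b' c' u) (lf3 a' (a' * \<gamma> + b') c' v)" if "?R u v" for u v
      using lf3[of u] that by blast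
  qed
  then show ?thesis by simp
qed

lemma lf3_pow_outer: "(lf3 1 0 0 ^^ n) V j k l = V (j - int n) k l"
  by (induction n arbitrary: j) (simp_all add: linform3_def algebra_simps)

lemma lf3_pow_middle: "(lf3 0 1 0 ^^ n) V j k l = V j (k - int n) l"
  by (induction n arbitrary: k) (simp_all add: linform3_def algebra_simps)

lemma lf3_pow_act_comm:
  "(lf3 a b c ^^ n) (act3 a1 b1 c1 a2 b2 c2 f u) = act3 a1 b1 c1 a2 b2 c2 f ((lf3 a b c ^^ n) u)"
  by (rule funpow_comm) (rule lf3_act_comm)

lemma lf3_pow_comm: "(lf3 a b c ^^ n) ((lf3 a' b' c' ^^ m) u) = (lf3 a' b' c' ^^ m) ((lf3 a b c ^^ n) u)"
  by (rule funpow_comm) (rule sym, rule funpow_comm, rule lf3_comm)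

lemma act3_split_linear:
  assumes "a' - \<gamma> * a = a''" "b' - \<gamma> * b = b''" "c' - \<gamma> * c = c''"
  shows "act3 a' b' c' a b c ([:- [:0, \<gamma>:], 1:] ^ n * f) u
    = (lf3 a'' b'' c'' ^^ n) (act3 a' b' c' a b c f u)"
proof -
  have "lf3 a' b' c' u - sc3 \<gamma> (lf3 a b c u) = lf3 a'' b'' c'' u" for u
    by (simp add: fun_eq_iff linform3_def assms[symmetric] scale_left_diff_distrib
        scale_right_distrib)
  then have "act3 a' b' c' a b c [:- [:0, \<gamma>:], 1:] = lf3 a'' b'' c''"
    using commuting_pair.poly2_act_linear_factor[OF pair3] by (intro ext) (simp only:)
  then show ?thesis
    by (simp only: commuting_pair.poly2_act_power[OF pair3])
qed

lemma lower_truncated_sum: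
  assumes "\<And>i. i \<in> I \<Longrightarrow> lower_truncated (F i :: int \<Rightarrow> 'w)"
  shows "lower_truncated (\<lambda>l. \<Sum>i\<in>I. F i l)"
  using assms
proof (induction I rule: infinite_finite_induct)
  case (insert i I)
  then have "lower_truncated (F i)" "lower_truncated (\<lambda>l. \<Sum>i\<in>I. F i l)" by auto
  then show ?case
    by (rule lower_truncated_comb) (use insert.hyps in simp)
qed auto

lemma iterated3_subst:
  assumes low: "\<And>j k. j < N \<or> k < N \<Longrightarrow> V j k = 0" and V: "\<And>j k. lower_truncated (V j k)"
  shows "iterated3 (\<lambda>i k l. subst \<gamma> (\<lambda>j k. V j k l) i k)"
proof -
  let ?S = "\<lambda>i k l. subst \<gamma> (\<lambda>j k. V j k l) i k"
  have "\<forall>i<0. ?S i = 0" by (simp add: fun_eq_iff subst_neg)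
  then have "lower_truncated ?S" unfolding lower_truncated_def by blast
  moreover have "iterated2 (?S i)" for i
    unfolding iterated2_def
  proof
    have "\<forall>k<2 * N - i. ?S i k = 0"
    proof (intro allI impI ext)
      fix k l assume "k < 2 * N - i"
      then show "?S i k l = 0 l" by (simp, intro subst_low[of N]) (auto simp: low)
    qed
    then show "lower_truncated (?S i)" unfolding lower_truncated_def by blast
    show "\<forall>k. lower_truncated (?S i k)"
    proof
      fix k
      have "?S i k = (\<lambda>l. \<Sum>m\<in>{N..k + i - N}. scale (subst_coeff \<gamma> m i) (V m (k - m + i) l))"
        by (rule ext, rule subst_eq_sum) (auto simp: low)
      moreover have "lower_truncated (\<lambda>l. \<Sum>m\<in>{N..k + i - N}. scale (subst_coeff \<gamma> m i) (V m (k - m + i) l))"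
      proof (rule lower_truncated_sum)
        fix m
        show "lower_truncated (\<lambda>l. scale (subst_coeff \<gamma> m i) (V m (k - m + i) l))"
          by (rule lower_truncated_comb[OF V[of m "k - m + i"] V[of m "k - m + i"]]) simp
      qed
      ultimately show "lower_truncated (?S i k)" by simp
    qed
  qed
  ultimately show ?thesis unfolding iterated3_def by blast
qed

lemma Y_op_0:
  "compatible scale 0 b \<Longrightarrow> \<alpha> \<noteq> 0 \<Longrightarrow> Y_op scale \<alpha> 0 k b = 0"
  "compatible scale a 0 \<Longrightarrow> \<alpha> \<noteq> 0 \<Longrightarrow> a \<in> fields scale \<Longrightarrow> Y_op scale \<alpha> a k 0 = 0"
proof -
  show "Y_op scale \<alpha> 0 k b = 0" if "compatible scale 0 b" "\<alpha> \<noteq> 0"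
    using Y_op_eqI[OF that, of "\<lambda>k. 0"] is_subst_0[OF that(2)] by (simp add: zero_fun_def)
  show "Y_op scale \<alpha> a k 0 = 0" if "compatible scale a 0" "\<alpha> \<noteq> 0" "a \<in> fields scale"
    using Y_op_eqI[OF that(1,2), of "\<lambda>k. 0"] is_subst_0[OF that(2)]
    by (simp add: zero_fun_def fieldsD(3)[OF that(3), unfolded zero_fun_def])
qed

lemma iterated3_Y_op_Y_op:
  assumes "\<And>k. compatible scale a (Y_op scale \<beta> b k c)" and "\<alpha> \<noteq> 0" "a \<in> fields scale"
  shows "iterated3 (\<lambda>k j l. Y_op scale \<alpha> a j (Y_op scale \<beta> b k c) l w)"
proof -
  from lower_truncated_Y_op obtain K where K: "\<And>k. k < K \<Longrightarrow> Y_op scale \<beta> b k c = 0"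
    unfolding lower_truncated_def by blast
  have "Y_op scale \<alpha> a j (Y_op scale \<beta> b k c) = 0" if "k < K" for j k
    using assms(1)[of k] Y_op_0(2) assms(2,3) by (simp add: K[OF that])
  then have "\<forall>k<K. (\<lambda>j l. Y_op scale \<alpha> a j (Y_op scale \<beta> b k c) l w) = 0"
    by (simp add: fun_eq_iff)
  moreover have "iterated2 (\<lambda>j l. Y_op scale \<alpha> a j (Y_op scale \<beta> b k c) l w)" for k
    using is_subst_Y_op[OF assms(1,2)] unfolding is_subst_def by blast
  ultimately show ?thesis unfolding iterated3_def lower_truncated_def by blast
qed

lemma iterated3_Y_op_iterate:
  assumes "\<And>i. compatible scale (Y_op scale \<gamma> a i b) c" and "\<beta> \<noteq> 0"
  shows "iterated3 (\<lambda>i k l. Y_op scale \<beta> (Y_op scale \<gamma> a i b) k c l w)"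
proof -
  from lower_truncated_Y_op obtain K where K: "\<And>i. i < K \<Longrightarrow> Y_op scale \<gamma> a i b = 0"
    unfolding lower_truncated_def by blast
  have "Y_op scale \<beta> (Y_op scale \<gamma> a i b) k c = 0" if "i < K" for i k
    using assms(1)[of i] Y_op_0(1) assms(2) by (simp add: K[OF that])
  then have "\<forall>i<K. (\<lambda>k l. Y_op scale \<beta> (Y_op scale \<gamma> a i b) k c l w) = 0"
    by (simp add: fun_eq_iff)
  moreover have "iterated2 (\<lambda>k l. Y_op scale \<beta> (Y_op scale \<gamma> a i b) k c l w)" for i
    using is_subst_Y_op[OF assms(1,2)] unfolding is_subst_def by blast
  ultimately show ?thesis unfolding iterated3_def lower_truncated_def by blast
qed

text \<open>
  \<open>P\<close> is the common value of \<open>(x\<^sub>1 - \<gamma> x\<^sub>2)\<^sup>n Y\<^sub>\<alpha>(a, x\<^sub>1)Y\<^sub>\<beta>(b, x\<^sub>2)c(x)w\<close> and of the product in the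
  opposite order, and setting \<open>x\<^sub>1 = \<gamma> x\<^sub>2 + x\<^sub>0\<close> in it gives the iterate multiplied by \<open>x\<^sub>0\<^sup>n\<close>.
\<close>
lemma weak_commutativity_associativity:
  assumes a: "a \<in> fields scale" and b: "b \<in> fields scale" and c: "c \<in> fields scale"
    and ql: "mutually_quasi_local scale a b" "mutually_quasi_local scale a c"
      "mutually_quasi_local scale b c"
    and compat: "compatible scale a b" "compatible scale a c" "compatible scale b c"
    and compat_a: "\<And>k. compatible scale a (Y_op scale \<beta> b k c)"
    and compat_b: "\<And>j. compatible scale b (Y_op scale \<alpha> a j c)"
    and compat_c: "\<And>i. compatible scale (Y_op scale \<gamma> a i b) c"
    and nz: "\<beta> \<noteq> 0" "\<gamma> \<noteq> 0" and \<alpha>: "\<alpha> = \<gamma> * \<beta>"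
  obtains n N P where "\<And>j k. j < N \<or> k < N \<Longrightarrow> P j k = 0"
    and "(lf3 1 (- \<gamma>) 0 ^^ n) (\<lambda>j k l. Y_op scale \<alpha> a j (Y_op scale \<beta> b k c) l w) = P"
    and "(lf3 1 (- \<gamma>) 0 ^^ n) (\<lambda>j k l. Y_op scale \<beta> b k (Y_op scale \<alpha> a j c) l w) = P"
    and "(lf3 1 0 0 ^^ n) (\<lambda>i k l. Y_op scale \<beta> (Y_op scale \<gamma> a i b) k c l w)
      = (\<lambda>i k l. subst \<gamma> (\<lambda>j k. P j k l) i k)"
proof -
  have \<alpha>0: "\<alpha> \<noteq> 0" using nz \<alpha> by simp
  from ql(1) obtain f where f: "f \<noteq> 0"
    and f_eq: "\<And>w. act f (\<lambda>m n. a m (b n w)) = act f (\<lambda>m n. b n (a m w))"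
    unfolding quasi_local_iff by blast
  from ql(2) obtain g where g: "g \<noteq> 0"
    and g_eq: "\<And>w. act g (\<lambda>m n. a m (c n w)) = act g (\<lambda>m n. c n (a m w))"
    unfolding quasi_local_iff by blast
  from ql(3) obtain h where h: "h \<noteq> 0"
    and h_eq: "\<And>w. act h (\<lambda>m n. b m (c n w)) = act h (\<lambda>m n. c n (b m w))"
    unfolding quasi_local_iff by blast
  let ?F = "act3 1 0 0 0 1 0 f" let ?G = "act3 1 0 0 0 0 1 g" let ?H = "act3 0 1 0 0 0 1 h"
  define u where "u = (\<lambda>m n l. a m (b n (c l w)))"
  define u' where "u' = (\<lambda>m n l. b n (a m (c l w)))"
  define T12 where "T12 = (\<lambda>j k l. Y_op scale \<alpha> a j (Y_op scale \<beta> b k c) l w)"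
  define T21 where "T21 = (\<lambda>j k l. Y_op scale \<beta> b k (Y_op scale \<alpha> a j c) l w)"
  define T0 where "T0 = (\<lambda>i k l. Y_op scale \<beta> (Y_op scale \<gamma> a i b) k c l w)"
  define U where "U = ?F (?G (?H u))"
  have FG: "?F (?G v) = ?G (?F v)" and FH: "?F (?H v) = ?H (?F v)" and GH: "?G (?H v) = ?H (?G v)" for v
    by (rule act3_comm)+
  have Fu: "?F u = ?F u'"
    using f_eq by (simp add: fun_eq_iff act3_slice3 u_def u'_def)
  have U': "U = ?F (?G (?H u'))"
    unfolding U_def FG FH Fu ..
  \<comment> \<open>Moving \<open>a\<close>, \<open>b\<close> or \<open>c\<close> to the right shows that \<open>U\<close> is truncated in \<open>y\<close>, \<open>z\<close> or \<open>x\<close>.\<close>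
  have U_low: "lower_truncated3 U"
  proof -
    from fieldsD(2)[OF a, of w] fieldsD(2)[OF b, of w] fieldsD(2)[OF c, of w] obtain Na Nb Nc
      where Na: "\<And>m. m < Na \<Longrightarrow> a m w = 0" and Nb: "\<And>m. m < Nb \<Longrightarrow> b m w = 0"
        and Nc: "\<And>m. m < Nc \<Longrightarrow> c m w = 0"
      unfolding lower_truncated_def by blast
    let ?Ra = "\<lambda>u. \<forall>m n l. m < Na \<longrightarrow> u m n l = (0 :: 'w)"
    let ?Rb = "\<lambda>u. \<forall>m n l. n < Nb \<longrightarrow> u m n l = (0 :: 'w)"
    let ?Rc = "\<lambda>u. \<forall>m n l. l < Nc \<longrightarrow> u m n l = (0 :: 'w)"
    have inv: "?Ra u \<Longrightarrow> ?Ra (act3 a1 b1 c1 a2 b2 c2 p u)" "?Rb u \<Longrightarrow> ?Rb (act3 a1 b1 c1 a2 b2 c2 p u)"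
      "?Rc u \<Longrightarrow> ?Rc (act3 a1 b1 c1 a2 b2 c2 p u)" for a1 b1 c1 a2 b2 c2 p u
      by (rule poly2_act_invariant[where P = ?Ra] poly2_act_invariant[where P = ?Rb]
          poly2_act_invariant[where P = ?Rc]; auto simp: linform3_def)+
    have Gu': "?G u' = ?G (\<lambda>m n l. b n (c l (a m w)))"
      unfolding u'_def using g_eq by (simp add: fun_eq_iff act3_slice2 act_linear[OF fieldsD(1)[OF b]])
    have Hu: "?H u = ?H (\<lambda>m n l. a m (c l (b n w)))"
      unfolding u_def using h_eq by (simp add: fun_eq_iff act3_slice1 act_linear[OF fieldsD(1)[OF a]])
    have "?Ra U"
      unfolding U' GH Gu' by (intro inv) (simp add: Na fieldsD(3)[OF b] fieldsD(3)[OF c])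
    moreover have "?Rb U"
      unfolding U_def Hu by (intro inv) (simp add: Nb fieldsD(3)[OF a] fieldsD(3)[OF c])
    moreover have "?Rc U"
      unfolding U_def by (intro inv) (simp add: u_def Nc fieldsD(3)[OF a] fieldsD(3)[OF b])
    ultimately show ?thesis
      unfolding lower_truncated3_def by (intro exI[of _ "min Na (min Nb Nc)"]) auto
  qed
  \<comment> \<open>Both products, multiplied by the polynomials, are \<open>U\<close> at \<open>y = \<alpha> x + x\<^sub>1\<close>, \<open>z = \<beta> x + x\<^sub>2\<close>.\<close>
  let ?S = "double_subst \<alpha> \<beta> U"
  let ?Fs = "\<lambda>T. act3 1 0 \<alpha> 0 1 \<beta> f (act3 1 0 \<alpha> 0 0 1 g (act3 0 1 \<beta> 0 0 1 h T))"
  have S12: "?Fs T12 = ?S"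
  proof -
    have "subst_pair \<alpha> \<beta> u T12"
      unfolding subst_pair_def u_def T12_def
      by (intro exI[of _ "\<lambda>m k l. a m (Y_op scale \<beta> b k c l w)"] conjI allI
          is_subst_linear[OF fieldsD(1)[OF a] is_subst_Y_op[OF compat(3) nz(1)]]
          is_subst_Y_op[OF compat_a \<alpha>0])
    then have "subst_pair \<alpha> \<beta> (?H u) (act3 0 1 \<beta> 0 0 1 h T12)"
      using subst_pair_act3[of \<alpha> \<beta> u T12 0 1 0 0 0 1 h] by simp
    then have "subst_pair \<alpha> \<beta> (?G (?H u)) (act3 1 0 \<alpha> 0 0 1 g (act3 0 1 \<beta> 0 0 1 h T12))"
      using subst_pair_act3[of \<alpha> \<beta> "?H u" _ 1 0 0 0 0 1 g] by simp
    then have "subst_pair \<alpha> \<beta> U (?Fs T12)"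
      using subst_pair_act3[of \<alpha> \<beta> "?G (?H u)" _ 1 0 0 0 1 0 f] by (simp add: U_def)
    then show ?thesis using U_low by (rule subst_pair_eq)
  qed
  have S21: "?Fs T21 = ?S"
  proof -
    have "subst_pair \<beta> \<alpha> (\<lambda>n m. u' m n) (\<lambda>k j. T21 j k)"
      unfolding subst_pair_def u'_def T21_def
      by (intro exI[of _ "\<lambda>n j l. b n (Y_op scale \<alpha> a j c l w)"] conjI allI
          is_subst_linear[OF fieldsD(1)[OF b] is_subst_Y_op[OF compat(2) \<alpha>0]]
          is_subst_Y_op[OF compat_b nz(1)])
    then have "subst_pair \<beta> \<alpha> (\<lambda>n m. ?H u' m n) (\<lambda>k j. act3 0 1 \<beta> 0 0 1 h T21 j k)"
      using subst_pair_act3_transpose[of \<beta> \<alpha> u' T21 0 1 0 0 0 1 h] by simp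
    then have "subst_pair \<beta> \<alpha> (\<lambda>n m. ?G (?H u') m n)
        (\<lambda>k j. act3 1 0 \<alpha> 0 0 1 g (act3 0 1 \<beta> 0 0 1 h T21) j k)"
      using subst_pair_act3_transpose[of \<beta> \<alpha> "?H u'" _ 1 0 0 0 0 1 g] by simp
    then have "subst_pair \<beta> \<alpha> (\<lambda>n m. U m n) (\<lambda>k j. ?Fs T21 j k)"
      using subst_pair_act3_transpose[of \<beta> \<alpha> "?G (?H u')" _ 1 0 0 0 1 0 f] by (simp add: U')
    moreover have "lower_truncated3 (\<lambda>n m. U m n)"
      using U_low unfolding lower_truncated3_def by blast
    ultimately have "(\<lambda>k j. ?Fs T21 j k) = double_subst \<beta> \<alpha> (\<lambda>n m. U m n)"
      by (rule subst_pair_eq)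
    then have "?Fs T21 j k l = double_subst \<beta> \<alpha> (\<lambda>n m. U m n) k j l" for j k l
      using fun_cong[OF fun_cong[OF fun_cong, of _ _ k j], of _ _ l] by blast
    then show ?thesis
      by (intro ext) (simp only: double_subst_commute[OF U_low])
  qed
  obtain n f1 where f1: "f = [:- [:0, \<gamma>:], 1:] ^ n * f1" "poly f1 [:0, \<gamma>:] \<noteq> 0"
    using f by (rule split_linear_factor)
  have "lf3 1 0 \<alpha> V = lf3 1 0 0 V + sc3 \<alpha> (lf3 0 0 1 V)" for V
    by (simp add: fun_eq_iff linform3_def)
  from commuting_pair.poly2_act_split_outer[OF pair3[where a = 1 and b = 0 and c = 0 and a' = 0 and b' = 0 and c' = 1] g, of "lf3 1 0 \<alpha>" \<alpha>, OF this]
  obtain s g1 where g1: "coeff g1 0 \<noteq> 0"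
    "\<And>u. act3 1 0 \<alpha> 0 0 1 g u = (lf3 1 0 0 ^^ s) (act3 1 0 0 0 0 1 g1 u)"
    by blast
  have "lf3 0 1 \<beta> V = lf3 0 1 0 V + sc3 \<beta> (lf3 0 0 1 V)" for V
    by (simp add: fun_eq_iff linform3_def)
  from commuting_pair.poly2_act_split_outer[OF pair3[where a = 0 and b = 1 and c = 0 and a' = 0 and b' = 0 and c' = 1] h, of "lf3 0 1 \<beta>" \<beta>, OF this]
  obtain t h1 where h1: "coeff h1 0 \<noteq> 0"
    "\<And>u. act3 0 1 \<beta> 0 0 1 h u = (lf3 0 1 0 ^^ t) (act3 0 1 0 0 0 1 h1 u)"
    by blast
  let ?L = "lf3 1 (- \<gamma>) 0 ^^ n"
  \<comment> \<open>\<open>?U\<close> is the part of the polynomial factor that remains nonzero at \<open>x\<^sub>1 = x\<^sub>2 = 0\<close>.\<close>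
  let ?U = "\<lambda>V. act3 1 0 \<alpha> 0 1 \<beta> f1 (act3 1 0 0 0 0 1 g1 (act3 0 1 0 0 0 1 h1 V))"
  have f_split: "act3 1 0 \<alpha> 0 1 \<beta> f V = ?L (act3 1 0 \<alpha> 0 1 \<beta> f1 V)" for V
    unfolding f1(1) by (rule act3_split_linear) (simp_all add: \<alpha>)
  have Fs: "?Fs T = (lf3 1 0 0 ^^ s) ((lf3 0 1 0 ^^ t) (?U (?L T)))" for T
    unfolding f_split g1(2) h1(2) by (simp only: lf3_pow_act_comm lf3_pow_comm[where a = 1 and b = "- \<gamma>" and c = 0 and n = n])
  have U_shift: "?U (?L T) j k = ?S (j + int s) (k + int t)" if "?Fs T = ?S" for T j k
  proof
    fix l
    have "?S (j + int s) (k + int t) l = (lf3 1 0 0 ^^ s) ((lf3 0 1 0 ^^ t) (?U (?L T))) (j + int s) (k + int t) l"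
      unfolding Fs[symmetric] that ..
    also have "\<dots> = ?U (?L T) j k l" by (simp only: lf3_pow_outer lf3_pow_middle) simp
    finally show "?U (?L T) j k l = ?S (j + int s) (k + int t) l" by simp
  qed
  let ?B = "\<lambda>j k. j < - int s \<or> k < - int t"
  have S_low: "?S (j + int s) (k + int t) = 0" if "?B j k" for j k
  proof -
    have "subst c v i = (\<lambda>l. 0)" if "i < 0" for c v i using that by (simp add: fun_eq_iff subst_neg)
    with that show ?thesis by (auto simp: zero_fun_def)
  qed
  have lead: "D j k = 0"
    if zero: "?U D j k = 0" and D: "lower_truncated (D j k)"
      and low: "\<And>j' k'. j' \<le> j \<Longrightarrow> k' \<le> k \<Longrightarrow> (j', k') \<noteq> (j, k) \<Longrightarrow> D j' k' = 0" for D j k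
  proof -
    let ?D1 = "act3 0 1 0 0 0 1 h1 D" let ?D2 = "act3 1 0 0 0 0 1 g1 ?D1"
    note leading = act3_leading[where j = j and k = k]
    have D1: "?D1 j k = poly_act sc1 (lf1 1) (coeff h1 0) (D j k)"
      by (rule trans[OF leading(1) act1_outer_zero]) (rule low)
    have low1: "?D1 j' k' = 0" if "j' \<le> j" "k' \<le> k" "(j', k') \<noteq> (j, k)" for j' k'
      by (rule leading(2)[OF low that])
    have D2: "?D2 j k = poly_act sc1 (lf1 1) (coeff g1 0) (?D1 j k)"
      by (rule trans[OF leading(1) act1_outer_zero]) (rule low1)
    have low2: "?D2 j' k' = 0" if "j' \<le> j" "k' \<le> k" "(j', k') \<noteq> (j, k)" for j' k'
      by (rule leading(2)[OF low1 that])
    have D3: "?U D j k = poly2_act sc1 (lf1 \<alpha>) (lf1 \<beta>) f1 (?D2 j k)"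
      by (rule leading(1)) (rule low2)
    have lt1: "lower_truncated (?D1 j k)"
      unfolding D1 act1_outer_zero[symmetric] by (rule lower_truncated_act1[OF D])
    have lt2: "lower_truncated (?D2 j k)"
      unfolding D2 act1_outer_zero[symmetric] by (rule lower_truncated_act1[OF lt1])
    have "?D2 j k = 0"
      by (rule act1_diagonal_injective[OF f1(2) nz(1) lt2]) (use D3 zero in \<open>simp add: \<alpha>\<close>)
    then have "?D1 j k = 0" using act1_injective[OF g1(1) lt1] D2 by simp
    then show "D j k = 0" using act1_injective[OF h1(1) D] D1 by simp
  qed
  have L12: "iterated3 (\<lambda>k j. ?L T12 j k)"
  proof -
    have "iterated3 ((lf3 (- \<gamma>) 1 0 ^^ n) (\<lambda>k j. T12 j k))"
      unfolding T12_def by (intro iterated3_funpow iterated3_Y_op_Y_op compat_a \<alpha>0 a)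
    moreover have "(lf3 (- \<gamma>) 1 0 ^^ n) (\<lambda>k j. T j k) = (\<lambda>k j. ?L T j k)" for T
      by (induction n) (simp_all add: fun_eq_iff linform3_def add_ac)
    ultimately show ?thesis by simp
  qed
  have L21: "iterated3 (?L T21)"
    unfolding T21_def by (intro iterated3_funpow iterated3_Y_op_Y_op compat_b nz b)
  have iter12: "iterated2 (\<lambda>k j. ?L T12 j k)" and iter21: "iterated2 (?L T21)"
    and lt: "lower_truncated (?L T12 j k)" "lower_truncated (?L T21 j k)" for j k
    using L12 L21 unfolding iterated3_def iterated2_def by blast+
  have low: "?L T j k = 0"
    if "?B j k" and S: "?Fs T = ?S" and lt: "\<And>j k. lower_truncated (?L T j k)"
      and "iterated2 (?L T) \<or> iterated2 (\<lambda>k j. ?L T j k)" for T j k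
  proof (rule minimal_support_vanish[where D = "?L T" and B = ?B])
    fix j k assume B: "?B j k"
      and *: "\<And>j' k'. j' \<le> j \<Longrightarrow> k' \<le> k \<Longrightarrow> (j', k') \<noteq> (j, k) \<Longrightarrow> ?L T j' k' = 0"
    show "?L T j k = 0"
    proof (rule lead[OF _ lt *])
      show "?U (?L T) j k = 0" unfolding U_shift[OF S] by (rule S_low[OF B])
    qed
  qed (use that in auto)
  have low12: "?L T12 j k = 0" and low21: "?L T21 j k = 0" if "?B j k" for j k
    using low[OF that S12 lt(1)] low[OF that S21 lt(2)] iter12 iter21 by blast+
  have comm: "?L T21 = ?L T12"
  proof -
    define D where "D = ?L T21 - ?L T12"
    interpret U1: module_hom sc3 sc3 "act3 1 0 \<alpha> 0 1 \<beta> f1" by (rule commuting_pair.hom2[OF pair3])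
    interpret U2: module_hom sc3 sc3 "act3 1 0 0 0 0 1 g1" by (rule commuting_pair.hom2[OF pair3])
    interpret U3: module_hom sc3 sc3 "act3 0 1 0 0 0 1 h1" by (rule commuting_pair.hom2[OF pair3])
    have UD: "?U D j k = 0" for j k
    proof -
      have "?U D = ?U (?L T21) - ?U (?L T12)" unfolding D_def U3.diff U2.diff U1.diff ..
      then have "?U D j k = ?U (?L T21) j k - ?U (?L T12) j k" by (simp only: minus_apply)
      then show ?thesis unfolding U_shift[OF S12] U_shift[OF S21] by (simp only: diff_self)
    qed
    have "D j k = 0" for j k
    proof (rule minimal_support_vanish[where D = D and B = "\<lambda>j k. True"])
      have "\<forall>j<(- int s). D j = 0" "\<forall>k<(- int t). D j k = 0" for j
        by (simp_all add: D_def fun_eq_iff low12 low21)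
      then show "iterated2 D \<or> iterated2 (\<lambda>k j. D j k)"
        unfolding iterated2_def lower_truncated_def by blast
      show "D j k = 0"
        if "\<And>j' k'. j' \<le> j \<Longrightarrow> k' \<le> k \<Longrightarrow> (j', k') \<noteq> (j, k) \<Longrightarrow> D j' k' = 0" for j k
      proof (rule lead[OF UD _ that])
        show "lower_truncated (D j k)"
          by (rule lower_truncated_comb[OF lt[of j k]]) (simp add: D_def)
      qed
    qed simp_all
    then have "D = 0" by (simp add: fun_eq_iff)
    then show ?thesis by (simp add: D_def)
  qed
  define P where "P = ?L T12"
  define N where "N = min (- int s) (- int t)"
  have P_low: "P j k = 0" if "j < N \<or> k < N" for j k
    using low12[of j k] that by (auto simp: P_def N_def)
  let ?P0 = "\<lambda>i k l. subst \<gamma> (\<lambda>j k. P j k l) i k"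
  \<comment> \<open>\<open>x\<^sub>0\<^sup>n\<close> times the iterate and \<open>P\<close> at \<open>x\<^sub>1 = \<gamma> x\<^sub>2 + x\<^sub>0\<close> have the same image under the injective operator \<open>?A\<close>.\<close>
  let ?A = "\<lambda>V. act3 1 \<gamma> \<alpha> 0 1 \<beta> f1 (act3 1 \<gamma> \<alpha> 0 0 1 g (act3 0 1 \<beta> 0 0 1 h V))"
  have iter: "(lf3 1 0 0 ^^ n) T0 = ?P0"
  proof -
    have "?A ((lf3 1 0 0 ^^ n) T0) = (\<lambda>i k l. subst \<gamma> (\<lambda>j k. ?S j k l) i k)"
    proof -
      define v where "v = (\<lambda>i m l. Y_op scale \<gamma> a i b m (c l w))"
      let ?v = "act3 1 \<gamma> 0 0 1 0 f (act3 1 \<gamma> 0 0 0 1 g (act3 0 1 0 0 0 1 h v))"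
      let ?T = "act3 1 \<gamma> \<alpha> 0 1 \<beta> f (act3 1 \<gamma> \<alpha> 0 0 1 g (act3 0 1 \<beta> 0 0 1 h T0))"
      have "is_subst \<gamma> (\<lambda>m n. u m n l) (\<lambda>i n. v i n l)" for l
        unfolding u_def v_def by (rule is_subst_Y_op[OF compat(1) nz(2)])
      then have "is_subst \<gamma> (\<lambda>m n. ?H u m n l) (\<lambda>i n. act3 0 1 0 0 0 1 h v i n l)" for l
        using is_subst_act3_last[of \<gamma> u v 0 1 0 0 0 1 h] by simp
      then have "is_subst \<gamma> (\<lambda>m n. ?G (?H u) m n l)
          (\<lambda>i n. act3 1 \<gamma> 0 0 0 1 g (act3 0 1 0 0 0 1 h v) i n l)" for l
        using is_subst_act3_last[of \<gamma> "?H u" _ 1 0 0 0 0 1 g] by simp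
      then have "is_subst \<gamma> (\<lambda>m n. U m n l) (\<lambda>i n. ?v i n l)" for l
        using is_subst_act3_last[of \<gamma> "?G (?H u)" _ 1 0 0 0 1 0 f] by (simp add: U_def)
      moreover have "lower_truncated2 (\<lambda>m n. U m n l)" for l
        using U_low unfolding lower_truncated3_def lower_truncated2_def by blast
      ultimately have v_eq: "(\<lambda>i n. ?v i n l) = subst \<gamma> (\<lambda>m n. U m n l)" for l
        by (rule is_subst_eq_subst)
      have "is_subst \<beta> (v i) (T0 i)" for i
        unfolding v_def T0_def by (rule is_subst_Y_op[OF compat_c nz(1)])
      then have "is_subst \<beta> (act3 0 1 0 0 0 1 h v i) (act3 0 1 \<beta> 0 0 1 h T0 i)" for i
        using is_subst_act3[of \<beta> v T0 0 1 0 0 0 1 h] by simp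
      then have "is_subst \<beta> (act3 1 \<gamma> 0 0 0 1 g (act3 0 1 0 0 0 1 h v) i)
          (act3 1 \<gamma> \<alpha> 0 0 1 g (act3 0 1 \<beta> 0 0 1 h T0) i)" for i
        using is_subst_act3[of \<beta> "act3 0 1 0 0 0 1 h v" _ 1 \<gamma> 0 0 0 1 g] by (simp add: \<alpha>)
      then have T: "is_subst \<beta> (?v i) (?T i)" for i
        using is_subst_act3[of \<beta> "act3 1 \<gamma> 0 0 0 1 g (act3 0 1 0 0 0 1 h v)" _ 1 \<gamma> 0 0 1 0 f]
        by (simp add: \<alpha>)
      have "?T i k l = subst \<gamma> (\<lambda>j k. ?S j k l) i k" for i k l
      proof -
        have vi: "?v i = (\<lambda>n l. subst \<gamma> (\<lambda>m n. U m n l) i n)"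
          using v_eq by (intro ext) (metis (no_types))
        from U_low obtain M where M: "\<And>m n l. m < M \<or> n < M \<or> l < M \<Longrightarrow> U m n l = 0"
          unfolding lower_truncated3_def by blast
        have "lower_truncated2 (\<lambda>n l. subst \<gamma> (\<lambda>m n. U m n l) i n)"
          unfolding lower_truncated2_def
        proof (intro exI[of _ "min M (2 * M - i)"] allI impI)
          fix n l assume nl: "n < min M (2 * M - i) \<or> l < min M (2 * M - i)"
          show "subst \<gamma> (\<lambda>m n. U m n l) i n = 0"
          proof (cases "l < M")
            case True
            then have "(\<lambda>m n. U m n l) = (\<lambda>m n. 0)" using M by (simp add: fun_eq_iff)
            then show ?thesis by simp
          next
            case False
            show ?thesis by (rule subst_low[of M]) (use M nl False in auto)
          qed
        qed
        then have "?T i = subst \<beta> (\<lambda>n l. subst \<gamma> (\<lambda>m n. U m n l) i n)"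
          using is_subst_eq_subst[OF T[of i]] unfolding vi by blast
        then show ?thesis
          using iterated_subst[OF U_low nz, of i k l] by (simp add: \<alpha>)
      qed
      moreover have "act3 1 \<gamma> \<alpha> 0 1 \<beta> f V = (lf3 1 0 0 ^^ n) (act3 1 \<gamma> \<alpha> 0 1 \<beta> f1 V)" for V
        unfolding f1(1) by (rule act3_split_linear) (simp_all add: \<alpha>)
      then have "?T = ?A ((lf3 1 0 0 ^^ n) T0)"
        by (simp only: lf3_pow_act_comm)
      ultimately show ?thesis by (simp only: fun_eq_iff) simp
    qed
    moreover have "?A ?P0 = (\<lambda>i k l. subst \<gamma> (\<lambda>j k. ?S j k l) i k)"
    proof -
      let ?P1 = "act3 0 1 \<beta> 0 0 1 h P" let ?P2 = "act3 1 0 \<alpha> 0 0 1 g ?P1"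
      let ?Q = "\<lambda>V. \<forall>j k. j < N \<or> k < N \<longrightarrow> V j k = (0 :: int \<Rightarrow> 'w)"
      have Q: "?Q (act3 a b c a' b' c' f V)" if "?Q V" for a b c a' b' c' f V
        by (rule poly2_act_invariant[where P = ?Q])
          (use that in \<open>auto simp: linform3_def fun_eq_iff\<close>)
      have Q0: "?Q P" using P_low by blast
      have "?S = act3 1 0 \<alpha> 0 1 \<beta> f1 ?P2"
        unfolding S12[symmetric] f_split P_def by (simp only: lf3_pow_act_comm)
      from fun_cong[OF fun_cong[OF fun_cong[OF this]]]
      have pointwise: "?S j k l = act3 1 0 \<alpha> 0 1 \<beta> f1 ?P2 j k l" for j k l .
      have "(\<lambda>i k l. subst \<gamma> (\<lambda>j k. ?S j k l) i k)
          = (\<lambda>i k l. subst \<gamma> (\<lambda>j k. act3 1 0 \<alpha> 0 1 \<beta> f1 ?P2 j k l) i k)"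
        by (simp only: pointwise)
      also have "\<dots> = act3 1 \<gamma> \<alpha> 0 1 \<beta> f1 (\<lambda>i k l. subst \<gamma> (\<lambda>j k. ?P2 j k l) i k)"
        using subst_act3[of N ?P2 \<gamma> 1 0 \<alpha> 0 1 \<beta> f1] Q[OF Q[OF Q0]] nz by simp
      also have "(\<lambda>i k l. subst \<gamma> (\<lambda>j k. ?P2 j k l) i k)
          = act3 1 \<gamma> \<alpha> 0 0 1 g (\<lambda>i k l. subst \<gamma> (\<lambda>j k. ?P1 j k l) i k)"
        using subst_act3[of N ?P1 \<gamma> 1 0 \<alpha> 0 0 1 g] Q[OF Q0] nz by simp
      also have "(\<lambda>i k l. subst \<gamma> (\<lambda>j k. ?P1 j k l) i k) = act3 0 1 \<beta> 0 0 1 h ?P0"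
        using subst_act3[of N P \<gamma> 0 1 \<beta> 0 0 1 h] Q0 nz by simp
      finally show ?thesis by (rule sym)
    qed
    ultimately have eq: "?A ((lf3 1 0 0 ^^ n) T0) = ?A ?P0" by simp
    define \<Delta> where "\<Delta> = (lf3 1 0 0 ^^ n) T0 - ?P0"
    interpret A1: module_hom sc3 sc3 "act3 1 \<gamma> \<alpha> 0 1 \<beta> f1" by (rule commuting_pair.hom2[OF pair3])
    interpret A2: module_hom sc3 sc3 "act3 1 \<gamma> \<alpha> 0 0 1 g" by (rule commuting_pair.hom2[OF pair3])
    interpret A3: module_hom sc3 sc3 "act3 0 1 \<beta> 0 0 1 h" by (rule commuting_pair.hom2[OF pair3])
    have A\<Delta>: "?A \<Delta> = 0" unfolding \<Delta>_def A3.diff A2.diff A1.diff eq by simp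
    have "iterated3 ?P0"
      by (rule iterated3_subst[of N]) (use P_low L12 in \<open>auto simp: P_def iterated3_def iterated2_def\<close>)
    then have \<Delta>: "iterated3 \<Delta>"
      unfolding \<Delta>_def T0_def by (intro iterated3_minus iterated3_funpow iterated3_Y_op_iterate compat_c nz)
    have "act3 1 \<gamma> \<alpha> 0 0 1 g (act3 0 1 \<beta> 0 0 1 h \<Delta>) = 0"
    proof (rule act3_injective[OF _ _ A\<Delta>])
      show "y = 0" if "iterated2 y" "poly2_act sc2 (lf2 \<gamma> \<alpha>) (lf2 1 \<beta>) f1 y = 0" for y
        using act2_diagonal_injective[OF f1(2) that(1)] that(2) \<alpha> by simp
    qed (intro iterated3_act3 \<Delta>)
    then have "act3 0 1 \<beta> 0 0 1 h \<Delta> = 0"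
      by (rule act3_injective[rotated 2])
        (auto intro!: iterated3_act3 \<Delta> intro: shifted_act_injective[OF g _ nz(2)])
    then have "\<Delta> = 0"
      by (rule act3_injective[rotated 2]) (auto intro!: \<Delta> intro: shifted_act_injective[OF h _ one_neq_zero])
    then show ?thesis by (simp add: \<Delta>_def)
  qed
  show ?thesis
    by (rule that[of N P n]) (use P_low comm iter in \<open>auto simp: P_def T12_def T21_def T0_def\<close>)
qed

end

section \<open>Expansions of powers of linear forms\<close>

lemma gbinomial_difference:
  fixes M t :: int
  shows "(if 0 \<le> t + M then (of_int M gchoose nat (t + M)) else 0)
      - (if t \<le> 0 then (of_int M gchoose nat (- t)) else 0)
    = (if M < 0 then (- 1) powi (t + M) * (of_int (t - 1) gchoose nat (- M - 1)) else (0 :: complex))"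
proof (cases "M < 0")
  case False
  then obtain m where m: "M = int m" by (metis nat_0_le not_less)
  consider "t > 0" | "t \<le> 0" "0 \<le> t + M" | "t \<le> 0" "t + M < 0" by linarith
  then show ?thesis
  proof cases
    case 1
    then have "m < nat (t + M)" using m by auto
    then show ?thesis using 1 by (simp add: m binomial_gbinomial[symmetric])
  next
    case 2
    then have "nat (- t) \<le> m" "nat (t + M) = m - nat (- t)" using m by auto
    then show ?thesis using 2 by (simp add: m binomial_gbinomial[symmetric] binomial_symmetric[symmetric])
  next
    case 3
    then have "m < nat (- t)" using m by auto
    then show ?thesis using 3 by (simp add: m binomial_gbinomial[symmetric])
  qed
next
  case True
  define u where "u = nat (- M - 1)"
  have M: "M = - 1 - int u" using True by (simp add: u_def)
  consider "0 \<le> t + M" | "t > 0" "t + M < 0" | "t \<le> 0" by linarith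
  then show ?thesis
  proof cases
    case 1
    define q where "q = nat (t + M)"
    have q: "t + M = int q" "t = int q + int u + 1" using 1 M by (auto simp: q_def)
    have "(of_int M gchoose q :: complex) = (- 1) ^ q * (of_nat (q + u) gchoose q)"
      by (subst gbinomial_negated_upper) (simp add: M)
    also have "(of_nat (q + u) gchoose q :: complex) = (of_nat (q + u) gchoose u)"
      using binomial_symmetric[of q "q + u"] by (simp add: binomial_gbinomial[symmetric] del: of_nat_add)
    finally have "(of_int M gchoose q :: complex) = (- 1) ^ q * (of_nat (q + u) gchoose u)" .
    moreover have "nat (t + M) = q" by (simp add: q_def)
    moreover have "(- 1 :: complex) powi (t + M) = (- 1) ^ q"
      unfolding q(1) by (rule power_int_of_nat)
    moreover have "(of_int (t - 1) :: complex) = of_nat (q + u)"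
    proof -
      have "t - 1 = int (q + u)" using q(2) by simp
      then show ?thesis by (simp only: of_int_of_nat_eq)
    qed
    moreover have "\<not> t \<le> 0" using q(2) by simp
    ultimately show ?thesis using True 1 by (simp only: u_def[symmetric] if_True if_False) simp
  next
    case 2
    define q where "q = nat (t - 1)"
    have q: "t = int q + 1" "q < u" using 2 M by (auto simp: q_def)
    then have "(of_int (t - 1) gchoose u :: complex) = 0"
      by (simp add: binomial_gbinomial[symmetric])
    then show ?thesis using 2 by (simp add: u_def[symmetric])
  next
    case 3
    define q where "q = nat (- t)"
    have q: "t = - int q" using 3 by (simp add: q_def)
    have "(of_int M gchoose q :: complex) = (- 1) ^ q * (of_nat (q + u) gchoose q)"
      by (subst gbinomial_negated_upper) (simp add: M)
    moreover have "(of_int (t - 1) gchoose u :: complex) = (- 1) ^ u * (of_nat (q + u) gchoose u)"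
      by (subst gbinomial_negated_upper) (simp add: q add_ac)
    moreover have "(of_nat (q + u) gchoose q :: complex) = (of_nat (q + u) gchoose u)"
      using binomial_symmetric[of q "q + u"] by (simp add: binomial_gbinomial[symmetric] del: of_nat_add)
    moreover have "(- 1 :: complex) powi (t + M) * (- 1) ^ u = - ((- 1) ^ q)"
    proof -
      have "(- 1 :: complex) powi (t + M) * (- 1) ^ u = (- 1) powi (t + M + int u)"
        by (simp add: power_int_add)
      also have "t + M + int u = - int (Suc q)" by (simp add: q M)
      also have "(- 1 :: complex) powi (- int (Suc q)) = - ((- 1) ^ q)"
        unfolding power_int_minus power_int_of_nat by (simp add: power_inverse[symmetric])
      finally show ?thesis .
    qed
    ultimately have "(- 1) powi (t + M) * (of_int (t - 1) gchoose u) = - (of_int M gchoose q :: complex)"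
      by (metis mult.assoc mult_minus_left)
    moreover have "\<not> 0 \<le> t + M" using q M by simp
    ultimately show ?thesis using True 3 by (simp add: u_def[symmetric] q_def[symmetric])
  qed
qed

text \<open>The coefficients in the identity
  \<open>x\<^sub>0\<^sup>-\<^sup>1\<delta>((x\<^sub>1 - \<gamma> x\<^sub>2)/x\<^sub>0) - x\<^sub>0\<^sup>-\<^sup>1\<delta>((- \<gamma> x\<^sub>2 + x\<^sub>1)/x\<^sub>0) = x\<^sub>1\<^sup>-\<^sup>1\<delta>((\<gamma> x\<^sub>2 + x\<^sub>0)/x\<^sub>1)\<close>.\<close>
lemma form_coeff_difference:
  assumes "\<gamma> \<noteq> 0"
  shows "form_coeff 1 (- \<gamma>) M (n - j + M) - form_coeff (- \<gamma>) 1 M (j - n)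
    = (\<Sum>p\<in>{0..- M - 1}. form_coeff \<gamma> 1 (- j - 1) p * subst_coeff \<gamma> n (- M - 1 - p))"
proof -
  define t where "t = n - j"
  have powers: "(- \<gamma>) ^ nat (t + M) = (- \<gamma>) powi (t + M)" if "0 \<le> t + M"
    using that by (simp add: power_int_def)
  have "form_coeff 1 (- \<gamma>) M (n - j + M) - form_coeff (- \<gamma>) 1 M (j - n)
    = (- \<gamma>) powi (t + M) * ((if 0 \<le> t + M then (of_int M gchoose nat (t + M)) else 0)
      - (if t \<le> 0 then (of_int M gchoose nat (- t)) else 0))"
    using powers by (auto simp: form_coeff_def t_def algebra_simps)
  also have "\<dots> = (if M < 0 then \<gamma> powi (t + M) * (of_int (t - 1) gchoose nat (- M - 1)) else 0)"
  proof -
    have "(- \<gamma>) powi (t + M) * (- 1) powi (t + M) = \<gamma> powi (t + M)"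
      by (simp add: power_int_mult_distrib[symmetric])
    then show ?thesis unfolding gbinomial_difference by (simp add: mult.assoc[symmetric])
  qed
  also have "\<dots> = (\<Sum>p\<in>{0..- M - 1}. form_coeff \<gamma> 1 (- j - 1) p * subst_coeff \<gamma> n (- M - 1 - p))"
  proof (cases "M < 0")
    case True
    define u where "u = nat (- M - 1)"
    have u: "- M - 1 = int u" using True by (simp add: u_def)
    have "(\<Sum>p\<in>{0..- M - 1}. form_coeff \<gamma> 1 (- j - 1) p * subst_coeff \<gamma> n (- M - 1 - p))
      = (\<Sum>q\<in>{0..u}. form_coeff \<gamma> 1 (- j - 1) (int q) * subst_coeff \<gamma> n (int u - int q))"
      by (rule sum.reindex_bij_witness[of _ int nat]) (auto simp: u)
    also have "\<dots> = (\<Sum>q\<in>{0..u}. \<gamma> powi (t + M) * ((of_int (- j - 1) gchoose q) * (of_int n gchoose (u - q))))"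
    proof (intro sum.cong refl)
      fix q assume q: "q \<in> {0..u}"
      have nat: "nat (int u - int q) = u - q" by auto
      have "\<gamma> powi (- j - 1 - int q) * \<gamma> powi (n - (int u - int q)) = \<gamma> powi (t + M)"
        using assms u by (subst power_int_add[symmetric]) (auto simp: t_def intro!: arg_cong[of _ _ "(powi) \<gamma>"])
      moreover have "form_coeff \<gamma> 1 (- j - 1) (int q) * subst_coeff \<gamma> n (int u - int q)
          = (\<gamma> powi (- j - 1 - int q) * \<gamma> powi (n - (int u - int q)))
            * ((of_int (- j - 1) gchoose q) * (of_int n gchoose (u - q)))"
        using q by (simp add: form_coeff_def subst_coeff_def nat del: of_int_diff of_int_minus)
      ultimately show "form_coeff \<gamma> 1 (- j - 1) (int q) * subst_coeff \<gamma> n (int u - int q)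
          = \<gamma> powi (t + M) * ((of_int (- j - 1) gchoose q) * (of_int n gchoose (u - q)))"
        by (simp only:)
    qed
    also have "\<dots> = \<gamma> powi (t + M) * (of_int (t - 1) gchoose u)"
    proof -
      have "of_int (- j - 1) + of_int n = (of_int (t - 1) :: complex)" by (simp add: t_def)
      then show ?thesis unfolding sum_distrib_left[symmetric] gbinomial_Vandermonde by (simp only:)
    qed
    finally show ?thesis using True by (simp add: u_def)
  qed simp
  finally show ?thesis .
qed

context complex_space
begin

text \<open>The series \<open>(c y + d z)\<^sup>M t(y, z)\<close>, expanded in nonnegative powers of \<open>z\<close>.\<close>
definition expansion ::
    "complex \<Rightarrow> complex \<Rightarrow> int \<Rightarrow> (int \<Rightarrow> int \<Rightarrow> 'w) \<Rightarrow> int \<Rightarrow> int \<Rightarrow> 'w"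
  where "expansion c d M t j k = Sum_any (\<lambda>r. scale (form_coeff c d M r) (t (j - (M - r)) (k - r)))"

lemma expansion_eq_sum:
  assumes "\<And>j k. k < K \<Longrightarrow> t j k = 0" and I: "finite I" "{0..k - K} \<subseteq> I"
  shows "expansion c d M t j k = (\<Sum>r\<in>I. scale (form_coeff c d M r) (t (j - (M - r)) (k - r)))"
  unfolding expansion_def
proof (rule Sum_any.expand_superset[OF I(1)], rule subsetI)
  fix r assume "r \<in> {r. scale (form_coeff c d M r) (t (j - (M - r)) (k - r)) \<noteq> 0}"
  then have "form_coeff c d M r \<noteq> 0" "t (j - (M - r)) (k - r) \<noteq> 0" by auto
  then have "0 \<le> r" "\<not> k - r < K" using assms(1) by (auto simp: form_coeff_def split: if_splits)
  with I(2) show "r \<in> I" by auto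
qed

text \<open>Powers of the form \<open>c y + d z\<close> can be moved into the series.\<close>
lemma expansion_lf2:
  assumes K: "\<And>j k. k < K \<Longrightarrow> t j k = 0" and c: "c \<noteq> 0"
  shows "expansion c d M (lf2 c d t) j k = expansion c d (M + 1) t j k"
proof -
  define B where "B = \<bar>k - K\<bar> + 1"
  have "expansion c d M (lf2 c d t) j k
      = (\<Sum>r\<in>{0..B}. scale (form_coeff c d M r) (lf2 c d t (j - (M - r)) (k - r)))"
    by (rule expansion_eq_sum[of K]) (auto simp: linform2_def K B_def)
  also have "\<dots> = (\<Sum>r\<in>{0..B}. scale (c * form_coeff c d M r) (t (j - (M + 1 - r)) (k - r)))
      + (\<Sum>r\<in>{0..B}. scale (d * form_coeff c d M r) (t (j - (M - r)) (k - r - 1)))"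
    by (simp add: linform2_def scale_right_distrib sum.distrib algebra_simps)
  also have "(\<Sum>r\<in>{0..B}. scale (d * form_coeff c d M r) (t (j - (M - r)) (k - r - 1)))
      = (\<Sum>r\<in>{1..B + 1}. scale (d * form_coeff c d M (r - 1)) (t (j - (M + 1 - r)) (k - r)))"
    by (rule sum.reindex_bij_witness[of _ "\<lambda>r. r - 1" "\<lambda>r. r + 1"]) (auto simp: algebra_simps)
  also have "\<dots> = (\<Sum>r\<in>{0..B}. scale (d * form_coeff c d M (r - 1)) (t (j - (M + 1 - r)) (k - r)))"
  proof -
    let ?f = "\<lambda>r. scale (d * form_coeff c d M (r - 1)) (t (j - (M + 1 - r)) (k - r))"
    have zero: "?f 0 = 0" "?f (B + 1) = 0" by (simp_all add: form_coeff_def K B_def)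
    have "sum ?f {1..B + 1} = sum ?f {0..B + 1}"
    proof (rule sum.mono_neutral_left)
      have "{0..B + 1} - {1..B + 1} \<subseteq> {0}" by auto
      then show "\<forall>r\<in>{0..B + 1} - {1..B + 1}. ?f r = 0" using zero(1) by blast
    qed auto
    also have "\<dots> = sum ?f {0..B}"
    proof (rule sum.mono_neutral_right)
      have "{0..B + 1} - {0..B} \<subseteq> {B + 1}" by auto
      then show "\<forall>r\<in>{0..B + 1} - {0..B}. ?f r = 0" using zero(2) by blast
    qed auto
    finally show ?thesis .
  qed
  also have "(\<Sum>r\<in>{0..B}. scale (c * form_coeff c d M r) (t (j - (M + 1 - r)) (k - r)))
      + (\<Sum>r\<in>{0..B}. scale (d * form_coeff c d M (r - 1)) (t (j - (M + 1 - r)) (k - r)))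
      = (\<Sum>r\<in>{0..B}. scale (form_coeff c d (M + 1) r) (t (j - (M + 1 - r)) (k - r)))"
    unfolding form_coeff_Pascal[OF c] by (simp add: scale_left_distrib sum.distrib)
  also have "\<dots> = expansion c d (M + 1) t j k"
    by (rule expansion_eq_sum[of K, symmetric]) (auto simp: K B_def)
  finally show ?thesis .
qed

lemma expansion_lf2_pow:
  assumes K: "\<And>j k. k < K \<Longrightarrow> t j k = 0" and c: "c \<noteq> 0"
  shows "expansion c d M ((lf2 c d ^^ n) t) j k = expansion c d (M + int n) t j k"
proof (induction n arbitrary: M)
  case (Suc n)
  have low: "(lf2 c d ^^ n) t j k = 0" if "k < K" for j k
    using that by (induction n arbitrary: j k) (simp_all add: K linform2_def)
  have "expansion c d M (lf2 c d ((lf2 c d ^^ n) t)) j k = expansion c d (M + 1) ((lf2 c d ^^ n) t) j k"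
    by (rule expansion_lf2[OF low c])
  then show ?case by (simp add: Suc.IH add_ac)
qed simp

text \<open>The three-term identity of delta functions applied to a series \<open>P\<close> that is truncated in both variables.\<close>
lemma expansion_Jacobi:
  assumes N: "\<And>j k. j < N \<or> k < N \<Longrightarrow> P j k = 0" and \<gamma>: "\<gamma> \<noteq> 0"
  shows "expansion 1 (- \<gamma>) M P j k - expansion (- \<gamma>) 1 M (\<lambda>k j. P j k) k j
    = expansion \<gamma> 1 (- j - 1) (\<lambda>k i. subst \<gamma> P i k) k (- M - 1)"
proof -
  let ?A = "{N..k + j - M - N}"
  let ?P = "\<lambda>n. P n (k + j - M - n)"
  have support: "{n. scale (F n) (?P n) \<noteq> 0} \<subseteq> ?A" for F
  proof
    fix n assume "n \<in> {n. scale (F n) (?P n) \<noteq> 0}"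
    then have "?P n \<noteq> 0" by auto
    then have "\<not> (n < N \<or> k + j - M - n < N)" using N by blast
    then show "n \<in> ?A" by auto
  qed
  have bij: "bij (\<lambda>n. n - j + M)" "bij (\<lambda>n. j - n)" for j :: int
    by (rule bij_betw_byWitness[where f' = "\<lambda>n. n + j - M"]; auto)
      (rule bij_betw_byWitness[where f' = "\<lambda>n. j - n"]; auto)
  have "expansion 1 (- \<gamma>) M P j k = Sum_any (\<lambda>n. scale (form_coeff 1 (- \<gamma>) M (n - j + M)) (?P n))"
    unfolding expansion_def
    by (rule Sum_any.reindex_cong[OF bij(1)[of j]]) (auto simp: fun_eq_iff algebra_simps)
  also have "\<dots> = (\<Sum>n\<in>?A. scale (form_coeff 1 (- \<gamma>) M (n - j + M)) (?P n))"
    by (rule Sum_any.expand_superset[OF _ support]) simp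
  finally have 1: "expansion 1 (- \<gamma>) M P j k = \<dots>" .
  have "expansion (- \<gamma>) 1 M (\<lambda>k j. P j k) k j
      = Sum_any (\<lambda>n. scale (form_coeff (- \<gamma>) 1 M (j - n)) (?P n))"
    unfolding expansion_def
    by (rule Sum_any.reindex_cong[OF bij(2)[of j]]) (auto simp: fun_eq_iff algebra_simps)
  also have "\<dots> = (\<Sum>n\<in>?A. scale (form_coeff (- \<gamma>) 1 M (j - n)) (?P n))"
    by (rule Sum_any.expand_superset[OF _ support]) simp
  finally have 2: "expansion (- \<gamma>) 1 M (\<lambda>k j. P j k) k j = \<dots>" .
  have "expansion \<gamma> 1 (- j - 1) (\<lambda>k i. subst \<gamma> P i k) k (- M - 1)
      = (\<Sum>p\<in>{0..- M - 1}. scale (form_coeff \<gamma> 1 (- j - 1) p)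
          (subst \<gamma> P (- M - 1 - p) (k - (- j - 1 - p))))"
    by (rule expansion_eq_sum[of 0]) (auto simp: subst_neg)
  also have "\<dots> = (\<Sum>p\<in>{0..- M - 1}. \<Sum>n\<in>?A.
      scale (form_coeff \<gamma> 1 (- j - 1) p * subst_coeff \<gamma> n (- M - 1 - p)) (?P n))"
  proof (intro sum.cong refl)
    fix p
    have "subst \<gamma> P (- M - 1 - p) (k - (- j - 1 - p))
        = (\<Sum>n\<in>?A. scale (subst_coeff \<gamma> n (- M - 1 - p)) (P n (k - (- j - 1 - p) - n + (- M - 1 - p))))"
      by (rule subst_eq_sum[of N]) (use N in auto)
    moreover have "k - (- j - 1 - p) - n + (- M - 1 - p) = k + j - M - n" for n by simp
    ultimately show "scale (form_coeff \<gamma> 1 (- j - 1) p) (subst \<gamma> P (- M - 1 - p) (k - (- j - 1 - p)))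
        = (\<Sum>n\<in>?A. scale (form_coeff \<gamma> 1 (- j - 1) p * subst_coeff \<gamma> n (- M - 1 - p)) (?P n))"
      by (simp only: scale_sum_right scale_scale)
  qed
  also have "\<dots> = (\<Sum>n\<in>?A. scale (\<Sum>p\<in>{0..- M - 1}.
      form_coeff \<gamma> 1 (- j - 1) p * subst_coeff \<gamma> n (- M - 1 - p)) (?P n))"
    unfolding scale_sum_left by (rule sum.swap)
  also have "\<dots> = (\<Sum>n\<in>?A. scale (form_coeff 1 (- \<gamma>) M (n - j + M)
      - form_coeff (- \<gamma>) 1 M (j - n)) (?P n))"
    by (simp only: form_coeff_difference[OF \<gamma>])
  also have "\<dots> = expansion 1 (- \<gamma>) M P j k - expansion (- \<gamma>) 1 M (\<lambda>k j. P j k) k j"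
    unfolding 1 2 by (simp only: scale_left_diff_distrib sum_subtractf)
  finally show ?thesis by simp
qed

lemma lf3_pow_slice: "(lf3 a b 0 ^^ n) V j k l = (lf2 a b ^^ n) (\<lambda>j k. V j k l) j k"
  by (induction n arbitrary: j k) (simp_all add: linform2_def linform3_def)

lemma lf2_pow_transpose: "(lf2 b a ^^ n) (\<lambda>k j. t j k) = (\<lambda>k j. (lf2 a b ^^ n) t j k)"
  by (induction n) (simp_all add: fun_eq_iff linform2_def add_ac)

text \<open>Multiplying by \<open>x\<^sub>0\<^sup>-\<^sup>n(x\<^sub>1 - \<gamma> x\<^sub>2)\<^sup>n\<close> does not change the products with the delta functions.\<close>
lemma Jacobi_from_weak:
  assumes N: "\<And>j k. j < N \<or> k < N \<Longrightarrow> P j k = 0" and \<gamma>: "\<gamma> \<noteq> 0"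
    and P12: "(lf3 1 (- \<gamma>) 0 ^^ n) T12 = P" and P21: "(lf3 1 (- \<gamma>) 0 ^^ n) T21 = P"
    and P0: "(lf3 1 0 0 ^^ n) T0 = (\<lambda>i k l. subst \<gamma> (\<lambda>j k. P j k l) i k)"
    and low: "\<And>j k. k < K \<Longrightarrow> T12 j k l = 0" "\<And>j k. j < K' \<Longrightarrow> T21 j k l = 0"
  shows "expansion 1 (- \<gamma>) (- i - 1) (\<lambda>j k. T12 j k l) j k
      - expansion (- \<gamma>) 1 (- i - 1) (\<lambda>k j. T21 j k l) k j
    = expansion \<gamma> 1 (- j - 1) (\<lambda>k i. T0 i k l) k i"
proof -
  let ?P = "\<lambda>j k. P j k l" let ?M = "- i - 1 - int n"
  have p12: "(lf2 1 (- \<gamma>) ^^ n) (\<lambda>j k. T12 j k l) = ?P"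
    unfolding P12[symmetric] lf3_pow_slice ..
  have p21: "(lf2 (- \<gamma>) 1 ^^ n) (\<lambda>k j. T21 j k l) = (\<lambda>k j. ?P j k)"
    unfolding P21[symmetric] lf3_pow_slice lf2_pow_transpose[where b = "- \<gamma>" and a = 1] ..
  have p0: "T0 i k l = subst \<gamma> ?P (i + int n) k" for i k
    using fun_cong[OF fun_cong[OF fun_cong[OF P0, of "i + int n"], of k], of l]
    by (simp add: lf3_pow_outer)
  have "expansion 1 (- \<gamma>) (- i - 1) (\<lambda>j k. T12 j k l) j k = expansion 1 (- \<gamma>) ?M ?P j k"
    unfolding p12[symmetric] by (subst expansion_lf2_pow[of K]) (use low in auto)
  moreover have "expansion (- \<gamma>) 1 (- i - 1) (\<lambda>k j. T21 j k l) k j = expansion (- \<gamma>) 1 ?M (\<lambda>k j. ?P j k) k j"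
    unfolding p21[symmetric] by (subst expansion_lf2_pow[of K']) (use low \<gamma> in auto)
  moreover have "expansion \<gamma> 1 (- j - 1) (\<lambda>k i. T0 i k l) k i
      = expansion \<gamma> 1 (- j - 1) (\<lambda>k i. subst \<gamma> ?P i k) k (- ?M - 1)"
    unfolding expansion_def p0 by (simp add: algebra_simps)
  moreover have "expansion 1 (- \<gamma>) ?M ?P j k - expansion (- \<gamma>) 1 ?M (\<lambda>k j. ?P j k) k j
    = expansion \<gamma> 1 (- j - 1) (\<lambda>k i. subst \<gamma> ?P i k) k (- ?M - 1)"
    by (rule expansion_Jacobi[of N, OF _ \<gamma>]) (auto simp: N)
  ultimately show ?thesis by (simp only:)
qed

section \<open>The Jacobi identity\<close>

text \<open>A coefficient of a product of series in three variables, when only the terms on a line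
  contribute.\<close>
lemma series3_mult_line:
  assumes I: "finite I" and h: "inj_on h I"
    and supp: "\<And>p q r. F p q r \<noteq> 0 \<Longrightarrow> g (i - p) (j - q) (k - r) \<noteq> 0 \<Longrightarrow> (p, q, r) \<in> h ` I"
  shows "finite {(p, q, r). field_scale scale (F p q r) (g (i - p) (j - q) (k - r)) \<noteq> 0}"
    and "series3_mult (field_scale scale) F g i j k l w
      = (\<Sum>x\<in>I. case h x of (p, q, r) \<Rightarrow> scale (F p q r) (g (i - p) (j - q) (k - r) l w))"
proof -
  let ?G = "\<lambda>(p, q, r). field_scale scale (F p q r) (g (i - p) (j - q) (k - r))"
  have sub: "{x. ?G x \<noteq> 0} \<subseteq> h ` I"
  proof (rule subsetI, clarify)
    fix p q r assume "field_scale scale (F p q r) (g (i - p) (j - q) (k - r)) \<noteq> 0"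
    then have "F p q r \<noteq> 0" "g (i - p) (j - q) (k - r) \<noteq> 0" by (auto simp: fun_eq_iff)
    then show "(p, q, r) \<in> h ` I" by (rule supp)
  qed
  have "{(p, q, r). field_scale scale (F p q r) (g (i - p) (j - q) (k - r)) \<noteq> 0} = {x. ?G x \<noteq> 0}"
    by auto
  then show "finite {(p, q, r). field_scale scale (F p q r) (g (i - p) (j - q) (k - r)) \<noteq> 0}"
    using finite_subset[OF sub] I by simp
  have "series3_mult (field_scale scale) F g i j k = (\<Sum>x\<in>I. ?G (h x))"
    unfolding series3_mult_def using Sum_any.expand_superset[OF _ sub] I h by (simp add: sum.reindex)
  then show "series3_mult (field_scale scale) F g i j k l w
      = (\<Sum>x\<in>I. case h x of (p, q, r) \<Rightarrow> scale (F p q r) (g (i - p) (j - q) (k - r) l w))"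
    by (simp add: sum_fun_apply case_prod_unfold)
qed

lemma delta_coeff_form_coeff:
  "delta_coeff c d 1 m p r = (if p + r = - m - 1 then form_coeff c d (- m - 1) r else 0)"
  by (cases "p + r = - m - 1")
    (simp_all add: delta_coeff_def binom_coeff_eq_form_coeff, simp add: binom_coeff_def)

lemma series_12_expansion:
  fixes A B :: "int \<Rightarrow> (int \<Rightarrow> 'w \<Rightarrow> 'w) \<Rightarrow> int \<Rightarrow> 'w \<Rightarrow> 'w"
  assumes low: "\<forall>j k. k < K \<longrightarrow> A j (B k u) = 0"
  shows "series3_mult_exists (field_scale scale) (\<lambda>p q r. delta_coeff c d 1 p q r) (series_12 A B u)"
    and "series3_mult (field_scale scale) (\<lambda>p q r. delta_coeff c d 1 p q r) (series_12 A B u) i j k l w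
      = expansion c d (- i - 1) (\<lambda>j k. A j (B k u) l w) j k"
proof -
  let ?h = "\<lambda>i r. (i, - i - 1 - r, r)" let ?I = "\<lambda>k. {0..k - K}"
  have supp: "(p, q, r) \<in> ?h i ` ?I k"
    if "delta_coeff c d 1 p q r \<noteq> 0" "series_12 A B u (i - p) (j - q) (k - r) \<noteq> 0" for i j k p q r
  proof -
    have "0 \<le> r" "q + r = - p - 1" "i - p = 0" "\<not> k - r < K"
      using that low by (auto simp: delta_coeff_form_coeff form_coeff_def series_12_def split: if_splits)
    then show ?thesis by (intro image_eqI[of _ _ r]) auto
  qed
  have inj: "inj_on (?h i) I" for i I by (auto simp: inj_on_def)
  show "series3_mult_exists (field_scale scale) (\<lambda>p q r. delta_coeff c d 1 p q r) (series_12 A B u)"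
    unfolding series3_mult_exists_def by (intro allI series3_mult_line(1)[OF _ inj supp]) simp_all
  have "expansion c d (- i - 1) (\<lambda>j k. A j (B k u) l w) j k
      = (\<Sum>r\<in>?I k. scale (form_coeff c d (- i - 1) r) (A (j - (- i - 1 - r)) (B (k - r) u) l w))"
    by (rule expansion_eq_sum[of K]) (auto simp: low)
  then show "series3_mult (field_scale scale) (\<lambda>p q r. delta_coeff c d 1 p q r) (series_12 A B u) i j k l w
      = expansion c d (- i - 1) (\<lambda>j k. A j (B k u) l w) j k"
    by (subst series3_mult_line(2)[OF _ inj supp])
      (auto simp: delta_coeff_form_coeff series_12_def intro!: sum.cong)
qed

lemma series_21_expansion:
  fixes A B :: "int \<Rightarrow> (int \<Rightarrow> 'w \<Rightarrow> 'w) \<Rightarrow> int \<Rightarrow> 'w \<Rightarrow> 'w"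
  assumes low: "\<forall>j k. j < K \<longrightarrow> B k (A j u) = 0"
  shows "series3_mult_exists (field_scale scale) (\<lambda>p q r. delta_coeff c d 1 p r q) (series_21 A B u)"
    and "series3_mult (field_scale scale) (\<lambda>p q r. delta_coeff c d 1 p r q) (series_21 A B u) i j k l w
      = expansion c d (- i - 1) (\<lambda>k j. B k (A j u) l w) k j"
proof -
  let ?h = "\<lambda>i q. (i, q, - i - 1 - q)" let ?I = "\<lambda>j. {0..j - K}"
  have supp: "(p, q, r) \<in> ?h i ` ?I j"
    if "delta_coeff c d 1 p r q \<noteq> 0" "series_21 A B u (i - p) (j - q) (k - r) \<noteq> 0" for i j k p q r
  proof -
    have "0 \<le> q" "r + q = - p - 1" "i - p = 0" "\<not> j - q < K"
      using that low by (auto simp: delta_coeff_form_coeff form_coeff_def series_21_def split: if_splits)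
    then show ?thesis by (intro image_eqI[of _ _ q]) auto
  qed
  have inj: "inj_on (?h i) I" for i I by (auto simp: inj_on_def)
  show "series3_mult_exists (field_scale scale) (\<lambda>p q r. delta_coeff c d 1 p r q) (series_21 A B u)"
    unfolding series3_mult_exists_def by (intro allI series3_mult_line(1)[OF _ inj supp]) simp_all
  have "expansion c d (- i - 1) (\<lambda>k j. B k (A j u) l w) k j
      = (\<Sum>q\<in>?I j. scale (form_coeff c d (- i - 1) q) (B (k - (- i - 1 - q)) (A (j - q) u) l w))"
    by (rule expansion_eq_sum[of K]) (auto simp: low)
  then show "series3_mult (field_scale scale) (\<lambda>p q r. delta_coeff c d 1 p r q) (series_21 A B u) i j k l w
      = expansion c d (- i - 1) (\<lambda>k j. B k (A j u) l w) k j"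
    by (subst series3_mult_line(2)[OF _ inj supp])
      (auto simp: delta_coeff_form_coeff series_21_def intro!: sum.cong)
qed

lemma series_iterate_expansion:
  fixes Y Y' :: "(int \<Rightarrow> 'w \<Rightarrow> 'w) \<Rightarrow> int \<Rightarrow> (int \<Rightarrow> 'w \<Rightarrow> 'w) \<Rightarrow> int \<Rightarrow> 'w \<Rightarrow> 'w"
  assumes low: "\<forall>i k. i < K \<longrightarrow> Y (Y' a i b) k u = 0"
  shows "series3_mult_exists (field_scale scale) (\<lambda>p q r. delta_coeff c d 1 q r p) (series_iterate Y Y' a b u)"
    and "series3_mult (field_scale scale) (\<lambda>p q r. delta_coeff c d 1 q r p) (series_iterate Y Y' a b u) i j k l w
      = expansion c d (- j - 1) (\<lambda>k i. Y (Y' a i b) k u l w) k i"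
proof -
  let ?h = "\<lambda>j p. (p, j, - j - 1 - p)" let ?I = "\<lambda>i. {0..i - K}"
  have supp: "(p, q, r) \<in> ?h j ` ?I i"
    if "delta_coeff c d 1 q r p \<noteq> 0" "series_iterate Y Y' a b u (i - p) (j - q) (k - r) \<noteq> 0" for i j k p q r
  proof -
    have "0 \<le> p" "r + p = - q - 1" "j - q = 0" "\<not> i - p < K"
      using that low by (auto simp: delta_coeff_form_coeff form_coeff_def series_iterate_def split: if_splits)
    then show ?thesis by (intro image_eqI[of _ _ p]) auto
  qed
  have inj: "inj_on (?h j) I" for j I by (auto simp: inj_on_def)
  show "series3_mult_exists (field_scale scale) (\<lambda>p q r. delta_coeff c d 1 q r p) (series_iterate Y Y' a b u)"
    unfolding series3_mult_exists_def by (intro allI series3_mult_line(1)[OF _ inj supp]) simp_all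
  have "expansion c d (- j - 1) (\<lambda>k i. Y (Y' a i b) k u l w) k i
      = (\<Sum>p\<in>?I i. scale (form_coeff c d (- j - 1) p) (Y (Y' a (i - p) b) (k - (- j - 1 - p)) u l w))"
    by (rule expansion_eq_sum[of K]) (auto simp: low)
  then show "series3_mult (field_scale scale) (\<lambda>p q r. delta_coeff c d 1 q r p) (series_iterate Y Y' a b u) i j k l w
      = expansion c d (- j - 1) (\<lambda>k i. Y (Y' a i b) k u l w) k i"
    by (subst series3_mult_line(2)[OF _ inj supp])
      (auto simp: delta_coeff_form_coeff series_iterate_def intro!: sum.cong)
qed

lemma twisted_Jacobi_holds:
  assumes a: "a \<in> fields scale" and b: "b \<in> fields scale" and c: "c \<in> fields scale"
    and ql: "mutually_quasi_local scale a b" "mutually_quasi_local scale a c"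
      "mutually_quasi_local scale b c"
    and compat: "compatible scale a b" "compatible scale a c" "compatible scale b c"
    and compat_a: "\<And>k. compatible scale a (Y_op scale \<beta> b k c)"
    and compat_b: "\<And>j. compatible scale b (Y_op scale \<alpha> a j c)"
    and compat_c: "\<And>i. compatible scale (Y_op scale (\<alpha> * inverse \<beta>) a i b) c"
    and nz: "\<alpha> \<noteq> 0" "\<beta> \<noteq> 0"
  shows "twisted_Jacobi scale \<alpha> \<beta> a b c"
proof -
  define \<gamma> where "\<gamma> = \<alpha> * inverse \<beta>"
  have \<gamma>: "\<gamma> \<noteq> 0" "\<alpha> = \<gamma> * \<beta>" using nz by (simp_all add: \<gamma>_def)
  let ?A = "Y_op scale \<alpha> a" let ?B = "Y_op scale \<beta> b" let ?C = "Y_op scale \<gamma> a"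
  let ?s = "field_scale scale"
  from lower_truncated_Y_op[of \<beta> b c] obtain Kb where Kb: "\<And>k. k < Kb \<Longrightarrow> ?B k c = 0"
    unfolding lower_truncated_def by blast
  from lower_truncated_Y_op[of \<alpha> a c] obtain Ka where Ka: "\<And>j. j < Ka \<Longrightarrow> ?A j c = 0"
    unfolding lower_truncated_def by blast
  from lower_truncated_Y_op[of \<gamma> a b] obtain Kc where Kc: "\<And>i. i < Kc \<Longrightarrow> ?C i b = 0"
    unfolding lower_truncated_def by blast
  have AB: "\<forall>j k. k < Kb \<longrightarrow> ?A j (?B k c) = 0"
    using compat_a Y_op_0(2)[OF _ nz(1) a] Kb by metis
  have BA: "\<forall>j k. j < Ka \<longrightarrow> ?B k (?A j c) = 0"
    using compat_b Y_op_0(2)[OF _ nz(2) b] Ka by metis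
  have CB: "\<forall>i k. i < Kc \<longrightarrow> Y_op scale \<beta> (?C i b) k c = 0"
    using compat_c[folded \<gamma>_def] Y_op_0(1)[OF _ nz(2)] Kc by metis
  have "series3_mult ?s (\<lambda>p q r. delta_coeff 1 (- \<gamma>) 1 p q r) (series_12 ?A ?B c) i j k
      - series3_mult ?s (\<lambda>p q r. delta_coeff (- \<gamma>) 1 1 p r q) (series_21 ?A ?B c) i j k
      = series3_mult ?s (\<lambda>p q r. delta_coeff \<gamma> 1 1 q r p)
          (series_iterate (Y_op scale \<beta>) (Y_op scale \<gamma>) a b c) i j k" for i j k
  proof (intro ext)
    fix l w
    obtain n N P where P: "\<And>j k. j < N \<or> k < N \<Longrightarrow> P j k = 0"
      "(lf3 1 (- \<gamma>) 0 ^^ n) (\<lambda>j k l. ?A j (?B k c) l w) = P"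
      "(lf3 1 (- \<gamma>) 0 ^^ n) (\<lambda>j k l. ?B k (?A j c) l w) = P"
      "(lf3 1 0 0 ^^ n) (\<lambda>i k l. Y_op scale \<beta> (?C i b) k c l w)
        = (\<lambda>i k l. subst \<gamma> (\<lambda>j k. P j k l) i k)"
      by (rule weak_commutativity_associativity[where w = w, OF a b c ql compat compat_a compat_b
            compat_c[folded \<gamma>_def] nz(2) \<gamma>]) blast
    have "expansion 1 (- \<gamma>) (- i - 1) (\<lambda>j k. ?A j (?B k c) l w) j k
      - expansion (- \<gamma>) 1 (- i - 1) (\<lambda>k j. ?B k (?A j c) l w) k j
      = expansion \<gamma> 1 (- j - 1) (\<lambda>k i. Y_op scale \<beta> (?C i b) k c l w) k i"
      by (rule Jacobi_from_weak[OF P(1) \<gamma>(1) P(2-4), where K = Kb and K' = Ka]) (auto simp: AB BA)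
    then show "(series3_mult ?s (\<lambda>p q r. delta_coeff 1 (- \<gamma>) 1 p q r) (series_12 ?A ?B c) i j k
      - series3_mult ?s (\<lambda>p q r. delta_coeff (- \<gamma>) 1 1 p r q) (series_21 ?A ?B c) i j k) l w
      = series3_mult ?s (\<lambda>p q r. delta_coeff \<gamma> 1 1 q r p)
          (series_iterate (Y_op scale \<beta>) (Y_op scale \<gamma>) a b c) i j k l w"
      unfolding minus_apply series_12_expansion(2)[of Kb ?A ?B, OF AB]
        series_21_expansion(2)[of Ka ?B ?A, OF BA]
        series_iterate_expansion(2)[of Kc "Y_op scale \<beta>" "Y_op scale \<gamma>", OF CB] .
  qed
  then show ?thesis
    unfolding twisted_Jacobi_def Let_def \<gamma>_def[symmetric]
    using series_12_expansion(1)[of Kb ?A ?B, OF AB] series_21_expansion(1)[of Ka ?B ?A, OF BA]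
      series_iterate_expansion(1)[of Kc "Y_op scale \<beta>" "Y_op scale \<gamma>", OF CB] by blast
qed

text \<open>At \<open>\<alpha> = \<beta> = 1\<close> the two forms of the delta functions agree.\<close>
lemma delta_coeff_one:
  "(\<lambda>p q r. delta_coeff 1 (- 1) (- 1) p r q) = (\<lambda>p q r. delta_coeff (- 1) 1 1 p r q)"
  "(\<lambda>p q r. delta_coeff 1 (- 1) 1 r q p) = (\<lambda>p q r. delta_coeff 1 1 1 q r p)"
proof -
  have "delta_coeff 1 (- 1) (- 1) p r q = delta_coeff (- 1) 1 1 p r q" for p q r
  proof (cases "0 \<le> q \<and> r + q = - p - 1")
    case True
    then obtain m where q: "q = int m" by (metis nat_0_le)
    from True q have "p + 1 = - (r + int m)" by simp
    then have "(- 1 :: complex) powi (p + 1) * (- 1) ^ m = (- 1) powi r"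
      by (simp add: power_int_minus power_int_add power_int_minus_left split: if_splits)
    with True show ?thesis by (simp add: delta_coeff_def binom_coeff_def q)
  qed (auto simp: delta_coeff_def binom_coeff_def)
  then show "(\<lambda>p q r. delta_coeff 1 (- 1) (- 1) p r q) = (\<lambda>p q r. delta_coeff (- 1) 1 1 p r q)"
    by simp
  have "delta_coeff 1 (- 1) 1 r q p = delta_coeff 1 1 1 q r p" for p q r
  proof (cases "0 \<le> p \<and> q + p = - r - 1")
    case True
    then obtain m where p: "p = int m" by (metis nat_0_le)
    from True have r: "- r - 1 = q + int m" "- q - 1 = r + int m" by (simp_all add: p)
    have "(of_int (- r - 1) gchoose m :: complex) = (- 1) ^ m * (of_nat m - of_int (- r - 1) - 1 gchoose m)"
      by (rule gbinomial_negated_upper)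
    also have "(of_nat m - of_int (- r - 1) - 1 :: complex) = of_int (- q - 1)"
      unfolding r(2) by simp
    finally show ?thesis using True by (simp add: delta_coeff_def binom_coeff_def p)
  qed (auto simp: delta_coeff_def binom_coeff_def)
  then show "(\<lambda>p q r. delta_coeff 1 (- 1) 1 r q p) = (\<lambda>p q r. delta_coeff 1 1 1 q r p)"
    by simp
qed

lemma closed_Y_op:
  assumes "Y_closed scale \<Gamma> U" "\<alpha> \<in> \<Gamma>" "a \<in> U" "b \<in> U"
  shows "Y_op scale \<alpha> a k b \<in> U"
proof -
  have "nth_prod scale \<alpha> (- k - 1) a b \<in> U" using assms unfolding Y_closed_def by blast
  then show ?thesis by (simp add: nth_prod_def)
qed

lemma closed_twisted_Jacobi:
  assumes U: "Y_closed scale \<Gamma> U" "quasi_local scale U" and \<Gamma>: "mult_subgroup \<Gamma>"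
    and "\<alpha> \<in> \<Gamma>" "\<beta> \<in> \<Gamma>" "a \<in> U" "b \<in> U" "c \<in> U"
  shows "twisted_Jacobi scale \<alpha> \<beta> a b c"
proof -
  have "U \<subseteq> fields scale" "\<And>a b. a \<in> U \<Longrightarrow> b \<in> U \<Longrightarrow> mutually_quasi_local scale a b"
    using U(2) by (auto simp: quasi_local_def)
  moreover have "\<And>a b. a \<in> U \<Longrightarrow> b \<in> U \<Longrightarrow> compatible scale a b"
    using U(1) by (auto simp: Y_closed_def)
  moreover have "\<alpha> \<noteq> 0" "\<beta> \<noteq> 0" "\<alpha> * inverse \<beta> \<in> \<Gamma>"
    using \<Gamma> assms(4,5) unfolding mult_subgroup_def by auto
  ultimately show ?thesis
    using assms(4-8) closed_Y_op[OF U(1)] by (intro twisted_Jacobi_holds) auto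
qed

lemma closed_vertex_algebra:
  assumes U: "Y_closed scale \<Gamma> U" "quasi_local scale U" "id_field \<in> U" and \<Gamma>: "mult_subgroup \<Gamma>"
  shows "vertex_algebra (field_scale scale) U (Y_op scale 1) id_field"
proof -
  interpret V: vector_space "field_scale scale" by (rule vector_space_field_scale)
  have sub: "V.subspace U" and fields: "\<And>a. a \<in> U \<Longrightarrow> a \<in> fields scale"
    using U(1) by (auto simp: Y_closed_def fields_subspace_def)
  have compat: "compatible scale a b" if "a \<in> U" "b \<in> U" for a b
    using U(1) that by (auto simp: Y_closed_def)
  have one: "1 \<in> \<Gamma>" using \<Gamma> by (simp add: mult_subgroup_def)
  have add: "a + b \<in> U" if "a \<in> U" "b \<in> U" for a b using V.subspace_add[OF sub that] .
  have scale: "field_scale scale r a \<in> U" if "a \<in> U" for a r using V.subspace_scale[OF sub that] .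
  show ?thesis
  proof
    show "V.subspace U" "id_field \<in> U" by (fact sub, fact U(3))
    fix u v u' v' w :: "int \<Rightarrow> 'w \<Rightarrow> 'w" and n i j k r
    show "Y_op scale 1 u n v \<in> U" if "u \<in> U" "v \<in> U"
      using closed_Y_op[OF U(1) one that] .
    show "lower_truncated (\<lambda>n. Y_op scale 1 u n v)" by (rule lower_truncated_Y_op)
    show "Y_op scale 1 (u + u') n v = Y_op scale 1 u n v + Y_op scale 1 u' n v"
      if "u \<in> U" "u' \<in> U" "v \<in> U"
      using that by (intro Y_op_add_left compat add) auto
    show "Y_op scale 1 (field_scale scale r u) n v = field_scale scale r (Y_op scale 1 u n v)"
      if "u \<in> U" "v \<in> U"
      using that by (intro Y_op_scale_left compat scale) auto
    show "Y_op scale 1 u n (v + v') = Y_op scale 1 u n v + Y_op scale 1 u n v'"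
      if "u \<in> U" "v \<in> U" "v' \<in> U"
      using that by (intro Y_op_add_right compat add fields) auto
    show "Y_op scale 1 u n (field_scale scale r v) = field_scale scale r (Y_op scale 1 u n v)"
      if "u \<in> U" "v \<in> U"
      using that by (intro Y_op_scale_right compat scale fields) auto
    show "Y_op scale 1 id_field n v = (if n = 0 then v else 0)" if "v \<in> U"
      using that by (intro Y_op_id_left compat U(3) fields) auto
    have right: "Y_op scale 1 v n id_field = exp_deriv_field scale 1 (rescale_field scale 1 v) n"
      if "v \<in> U" for n
      using Y_op_id_right[OF fields[OF that] compat[OF that U(3)], of 1] by simp
    show "Y_op scale 1 v n id_field = 0" if "v \<in> U" "n < 0"
      using right[OF that(1)] that(2) by (simp add: exp_deriv_field_def fun_eq_iff)
    show "Y_op scale 1 v 0 id_field = v" if "v \<in> U"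
      using right[OF that] by (simp add: exp_deriv_field_def fun_eq_iff rescale_field_def op_scale_def)
    show "series3_mult (field_scale scale) (\<lambda>p q r. delta_coeff 1 (- 1) 1 p q r)
          (series_12 (Y_op scale 1 u) (Y_op scale 1 v) w) i j k
        - series3_mult (field_scale scale) (\<lambda>p q r. delta_coeff 1 (- 1) (- 1) p r q)
          (series_21 (Y_op scale 1 u) (Y_op scale 1 v) w) i j k
        = series3_mult (field_scale scale) (\<lambda>p q r. delta_coeff 1 (- 1) 1 r q p)
          (series_iterate (Y_op scale 1) (Y_op scale 1) u v w) i j k"
      if "u \<in> U" "v \<in> U" "w \<in> U"
      using closed_twisted_Jacobi[OF U(1,2) \<Gamma> one one that]
      unfolding twisted_Jacobi_def Let_def delta_coeff_one by simp
  qed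
qed

end

theorem theorem4p9:
  fixes scale :: "complex \<Rightarrow> 'w::ab_group_add \<Rightarrow> 'w" and \<Gamma> :: "complex set"
  assumes "vector_space scale" and "mult_subgroup \<Gamma>"
  shows "(\<forall>U. Y_closed scale \<Gamma> U \<and> quasi_local scale U \<and> id_field \<in> U \<longrightarrow>
      (\<forall>\<alpha>\<in>\<Gamma>. \<forall>a\<in>U.
          (\<forall>k. Y_op scale \<alpha> id_field k a = (if k = 0 then a else 0))
        \<and> (\<forall>k. Y_op scale \<alpha> a k id_field
                = exp_deriv_field scale (inverse \<alpha>) (rescale_field scale \<alpha> a) k))
    \<and> (\<forall>a\<in>U. \<forall>b\<in>U. \<forall>\<alpha>\<in>\<Gamma>. \<forall>\<beta>\<in>\<Gamma>. \<forall>c\<in>U. twisted_Jacobi scale \<alpha> \<beta> a b c)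
    \<and> vertex_algebra (field_scale scale) U (Y_op scale 1) id_field)
  \<and> (\<forall>S. quasi_local scale S \<longrightarrow>
      vertex_algebra (field_scale scale) (generated scale \<Gamma> S) (Y_op scale 1) id_field)"
proof -
  interpret complex_space scale using assms(1) by (simp add: complex_space_def)
  show ?thesis
  proof (intro conjI allI impI ballI)
    fix U \<alpha> a k
    assume U: "Y_closed scale \<Gamma> U \<and> quasi_local scale U \<and> id_field \<in> U" and "\<alpha> \<in> \<Gamma>" and a: "a \<in> U"
    then have \<alpha>: "\<alpha> \<noteq> 0" using assms(2) by (auto simp: mult_subgroup_def)
    have fields: "a \<in> fields scale" and compat: "compatible scale a id_field" "compatible scale id_field a"
      using U a by (auto simp: quasi_local_def Y_closed_def)
    show "Y_op scale \<alpha> id_field k a = (if k = 0 then a else 0)"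
      by (rule Y_op_id_left[OF fields compat(2) \<alpha>])
    show "Y_op scale \<alpha> a k id_field = exp_deriv_field scale (inverse \<alpha>) (rescale_field scale \<alpha> a) k"
      by (rule Y_op_id_right[OF fields compat(1) \<alpha>])
  next
    fix U a b \<alpha> \<beta> c
    assume "Y_closed scale \<Gamma> U \<and> quasi_local scale U \<and> id_field \<in> U"
      "a \<in> U" "b \<in> U" "\<alpha> \<in> \<Gamma>" "\<beta> \<in> \<Gamma>" "c \<in> U"
    then show "twisted_Jacobi scale \<alpha> \<beta> a b c"
      using closed_twisted_Jacobi[OF _ _ assms(2)] by blast
  next
    fix U assume "Y_closed scale \<Gamma> U \<and> quasi_local scale U \<and> id_field \<in> U"
    then show "vertex_algebra (field_scale scale) U (Y_op scale 1) id_field"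
      using closed_vertex_algebra[OF _ _ _ assms(2)] by blast
  next
    fix S assume "quasi_local scale S"
    from generated_closed[OF this assms(2)]
    show "vertex_algebra (field_scale scale) (generated scale \<Gamma> S) (Y_op scale 1) id_field"
      by (rule closed_vertex_algebra[OF _ _ _ assms(2)])
  qed
qed

end
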